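(* Let $0<p<1$ be a fixed constant, let $k\ge 2$, let $\pi=k_1+\dots+k_t$ be a proper partition of $k$, and let $\ell\ge 1$ be an integer. Let $\mathcal H=\{H_n\}_{n\to\infty}$ be a sequence of $k$-uniform hypergraphs with loops such that $|V(H_n)|=n$ and $H_n$ is $\lfloor pn\rfloor$-coregular. Then the following properties of $\mathcal H$ are equivalent: (1) $\mathtt{Eig}[\pi]$: $\lambda_{1,\pi}(H_n)=pn^{k/2}+o(n^{k/2})$ and $\lambda_{2,\pi}(H_n)=o(n^{k/2})$. (2) $\mathtt{Expand}[\pi]$: for all $S_i\subseteq\binom{V(H_n)}{k_i}$, $1\le i\le t$, $$e(S_1,\dots,S_t)=p\prod_{i=1}^t|S_i|+o(n^k),$$ where $e(S_1,\dots,S_t)$ is the number of tuples $(s_1,\dots,s_t)$ with $s_i\in S_i$ such that $s_1\cup\dots\cup s_t$ is a hyperedge of $H_n$. (3) $\mathtt{Count}[\pi\text{-linear}]$: for every fixed $k$-uniform, $\pi$-linear hypergraph $F$ with $f$ vertices and $m$ edges, the number of labeled copies of $F$ in $H_n$ is $p^m n^f+o(n^f)$. (4) $\mathtt{Cycle}_4[\pi]$: the number of labeled copies of $C_{\pi,4}$ in $H_n$ is at most $p^{|E(C_{\pi,4})|}n^{|V(C_{\pi,4})|}+o(n^{|V(C_{\pi,4})|})$. (5) $\mathtt{Cycle}_{4\ell}[\pi]$: the number of labeled copies of $C_{\pi,4\ell}$ in $H_n$ is at most $p^{|E(C_{\pi,4\ell})|}n^{|V(C_{\pi,4\ell})|}+o(n^{|V(C_{\pi,4\ell})|})$.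 Moreover, in the chain of implications (1)$\Rightarrow$(2)$\Rightarrow$(3)$\Rightarrow$(4)$\Rightarrow$(5)$\Rightarrow$(1), all implications except (5)$\Rightarrow$(1) remain true when the hypothesis that $H_n$ is $\lfloor pn\rfloor$-coregular is replaced by the weaker condition $|E(H_n)|\ge p\binom nk+o(n^k)$.
   Context: **Hypergraphs.** A $k$-uniform hypergraph $F$ is a finite vertex set $V(F)$ with a set $E(F)$ of $k$-element subsets of $V(F)$. A $k$-uniform hypergraph with loops $H$ is a finite set $V(H)$ with a collection (set) $E(H)$ of $k$-element multisets of elements of $V(H)$. It is $d$-coregular if for every $(k-1)$-multiset $S$ of vertices there are exactly $d$ edges containing $S$. A labeled copy of $F$ in $H$ is an edge-preserving injection $V(F)\to V(H)$ (the image of each edge of $F$ is an edge of $H$). In $e(S_1,\dots,S_t)$ the union is taken as multisets. **Partitions.** A proper partition $\pi=k_1+\dots+k_t$ of $k$ is an unordered list of $t\ge2$ positive integers with sum $k$; an ordering of it is an ordered partition $\vec\pi=(k_1,\dots,k_t)$. **$\pi$-linear.** A $k$-uniform hypergraph $F$ is $\pi$-linear if there is an ordering $E_1,\dots,E_m$ of its edges such that for every $i$ there is a partition of $E_i$ into $A_{i,1},\dots,A_{i,t}$ with $|A_{i,s}|=k_s$ for $1\le s\le t$ and such that for every $j<i$ there exists $s$ with $E_j\cap E_i\subseteq A_{i,s}$. **Eigenvalues.** Let $H$ be a $k$-uniform hypergraph with loops on $n$ vertices and $W=\mathbb R^{V(H)}$ with standard basis $(e_v)_{v\in V(H)}$ and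 Euclidean norm. The adjacency map $\tau=\tau_H:W^k\to\mathbb R$ is the $k$-linear map with $\tau(e_{v_1},\dots,e_{v_k})=1$ if the multiset $\{v_1,\dots,v_k\}\in E(H)$ and $0$ otherwise. $J:W^k\to\mathbb R$ is the $k$-linear map equal to $1$ on every tuple of standard basis vectors. For a $k$-linear $\sigma:W^k\to\mathbb R$ and $\vec\pi=(k_1,\dots,k_t)$, the $t$-linear map $\sigma_{\vec\pi}:W^{\otimes k_1}\times\dots\times W^{\otimes k_t}\to\mathbb R$ is defined on standard basis tensors by $\sigma_{\vec\pi}(b_{1,1}\otimes\dots\otimes b_{1,k_1},\dots,b_{t,1}\otimes\dots\otimes b_{t,k_t})=\sigma(b_{1,1},\dots,b_{1,k_1},\dots,b_{t,1},\dots,b_{t,k_t})$ and extended multilinearly. Each $W^{\otimes k_i}$ carries the Euclidean norm for which the standard basis tensors are orthonormal. The spectral norm of a $t$-linear map is $\|\phi\|=\sup\{|\phi(x_1,\dots,x_t)|:\|x_i\|=1\ \forall i\}$. Define, for any ordering $\vec\pi$ of $\pi$ (the choice does not matter), $$\lambda_{1,\pi}(H)=\|\tau_{\vec\pi}\|,\qquad \lambda_{2,\pi}(H)=\Big\|\tau_{\vec\pi}-\frac{k!|E(H)|}{n^k}J_{\vec\pi}\Big\|.$$ **Steps, paths, cycles.** For $\vec\pi=(1,\dots,1)$ with $t$ parts, the step $S_{\vec\pi}$ has vertex set the disjoint union $A\,\dot\cup\,B_2\,\dot\cup\dots\dot\cup\,B_t$, where $A$ has $2^{t-1}$ elements labeled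 by the binary strings of length $t-1$ and each $B_j$ has $2^{t-2}$ elements labeled by the binary strings of length $t-2$; $\{a,b_2,\dots,b_t\}$ with $a\in A$, $b_j\in B_j$ is an edge iff for every $1\le j\le t-1$ the code of $b_{j+1}$ is obtained from the code of $a$ by removing its $j$th bit. For general $\vec\pi=(k_1,\dots,k_t)$, the step $S_{\vec\pi}$ has vertex set $(A\times[k_1])\,\dot\cup\,(B_2\times[k_2])\,\dot\cup\dots\dot\cup\,(B_t\times[k_t])$, and each edge $\{a,b_2,\dots,b_t\}$ of $S_{(1,\dots,1)}$ gives the edge $\{(a,1),\dots,(a,k_1),(b_2,1),\dots,(b_2,k_2),\dots,(b_t,1),\dots,(b_t,k_t)\}$. The attach tuples $A^{(0)}$, $A^{(1)}$ of $S_{\vec\pi}$ are the ordered tuples of the vertices $(a,z)$, $a\in A$, whose code ends in $0$, respectively in $1$, listed lexicographically by code and, for equal codes, by $z$. For $\ell'\ge1$, the path $P_{\vec\pi,2\ell'}$ is formed from copies $T_1,\dots,T_{\ell'}$ of $S_{\vec\pi}$ with attach tuples $A^{(0)}_i,A^{(1)}_i$ by identifying (coordinate by coordinate) $A^{(1)}_i$ with $A^{(0)}_{i+1}$ for $1\le i\le\ell'-1$; its attach tuples are $A^{(0)}_1$ and $A^{(1)}_{\ell'}$. For $\ell'\ge2$, the cycle $C_{\vec\pi,2\ell'}$ is formed from $P_{\vec\pi,2\ell'}$ by identifying (coordinate by coordinate) its two attach tuples. Up to isomorphism this does not depend on the ordering $\vec\pi$ of $\pi$, and $C_{\pi,2\ell'}$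 denotes $C_{\vec\pi,2\ell'}$ for any ordering $\vec\pi$ of $\pi$. **Asymptotics.** All $o(\cdot)$ are as $n\to\infty$ with $p,k,\pi,\ell$ (and $F$) fixed; in $\mathtt{Expand}[\pi]$ the error term is uniform over the choice of $S_1,\dots,S_t$. *)

theory Defs
  imports "HOL-Analysis.Analysis" "HOL-Library.Multiset" "HOL-Library.FuncSet"
    "HOL-Library.Landau_Symbols" "HOL-Library.Disjoint_Sets"
begin

section \<open>Hypergraphs\<close>

datatype ('v, 'e) hgraph = HGraph (verts: "'v set") (edges: "'e set")

type_synonym 'v hypergraph = "('v, 'v set) hgraph"
type_synonym 'v loop_hypergraph = "('v, 'v multiset) hgraph"

definition uniform_hypergraph :: "nat \<Rightarrow> 'v hypergraph \<Rightarrow> bool" where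
  "uniform_hypergraph k F \<longleftrightarrow>
     finite (verts F) \<and> (\<forall>e\<in>edges F. e \<subseteq> verts F \<and> card e = k)"

definition uniform_loop_hypergraph :: "nat \<Rightarrow> 'v loop_hypergraph \<Rightarrow> bool" where
  "uniform_loop_hypergraph k H \<longleftrightarrow>
     finite (verts H) \<and> (\<forall>e\<in>edges H. set_mset e \<subseteq> verts H \<and> size e = k)"

definition coregular :: "nat \<Rightarrow> nat \<Rightarrow> 'v loop_hypergraph \<Rightarrow> bool" where
  "coregular k d H \<longleftrightarrow>
     (\<forall>S. set_mset S \<subseteq> verts H \<and> size S = k - 1 \<longrightarrow> card {e \<in> edges H. S \<subseteq># e} = d)"

definition labeled_copies :: "'u hypergraph \<Rightarrow> 'v loop_hypergraph \<Rightarrow> ('u \<Rightarrow> 'v) set" where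
  "labeled_copies F H =
     {\<phi> \<in> verts F \<rightarrow>\<^sub>E verts H.
        inj_on \<phi> (verts F) \<and> (\<forall>e\<in>edges F. image_mset \<phi> (mset_set e) \<in> edges H)}"

text \<open>A proper partition \<open>\<pi>\<close> of \<open>k\<close> is given by an arbitrary ordering \<open>ks = [k\<^sub>1, \<dots>, k\<^sub>t]\<close> of
  its parts.  Lists are indexed from \<open>0\<close>, so \<open>k\<^sub>j\<close> is \<open>ks ! (j - 1)\<close>.\<close>

definition proper_partition :: "nat \<Rightarrow> nat list \<Rightarrow> bool" where
  "proper_partition k ks \<longleftrightarrow> length ks \<ge> 2 \<and> (\<forall>x\<in>set ks. x \<ge> 1) \<and> sum_list ks = k"

definition pi_linear :: "nat list \<Rightarrow> 'v hypergraph \<Rightarrow> bool" where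
  "pi_linear ks F \<longleftrightarrow>
     (\<exists>es. distinct es \<and> set es = edges F \<and>
        (\<forall>i<length es. \<exists>A.
           disjoint_family_on A {..<length ks} \<and>
           (\<Union>s<length ks. A s) = es ! i \<and>
           (\<forall>s<length ks. card (A s) = ks ! s) \<and>
           (\<forall>j<i. \<exists>s<length ks. es ! j \<inter> es ! i \<subseteq> A s)))"

definition expand_count :: "'v loop_hypergraph \<Rightarrow> 'v set set list \<Rightarrow> nat" where
  "expand_count H Ss = card {ss \<in> listset Ss. (\<Sum>s\<leftarrow>ss. mset_set s) \<in> edges H}"


section \<open>Eigenvalues\<close>

text \<open>With \<open>V = verts H\<close>, a vector of \<open>W = \<real>\<^sup>V\<close> is a function on \<open>V\<close>, and a tensor in the \<open>m\<close>-fold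
  tensor power of \<open>W\<close> is the function on \<open>m\<close>-tuples over \<open>V\<close> giving its coordinates in the standard
  basis tensors; both are represented by total functions whose values elsewhere are ignored.
  Multilinear maps take the list of their arguments.\<close>

definition tuples :: "'v set \<Rightarrow> nat \<Rightarrow> 'v list set" where
  "tuples V m = {vs. set vs \<subseteq> V \<and> length vs = m}"

definition std_basis :: "'v \<Rightarrow> 'v \<Rightarrow> real" where
  "std_basis v = indicat_real {v}"

definition adjacency_map :: "'v loop_hypergraph \<Rightarrow> ('v \<Rightarrow> real) list \<Rightarrow> real" where
  "adjacency_map H ws =
     (\<Sum>vs\<in>tuples (verts H) (length ws).
        (\<Prod>i<length ws. (ws ! i) (vs ! i)) * of_bool (mset vs \<in> edges H))"

definition all_ones_map :: "'v set \<Rightarrow> ('v \<Rightarrow> real) list \<Rightarrow> real" where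
  "all_ones_map V ws = (\<Sum>vs\<in>tuples V (length ws). \<Prod>i<length ws. (ws ! i) (vs ! i))"

text \<open>The \<open>t\<close>-linear map \<open>\<sigma>\<close> regrouped along \<open>ks\<close>: its value on the basis tensors indexed by the
  tuples \<open>bs ! 0, bs ! 1, \<dots>\<close> is \<open>\<sigma>\<close> of all the basis vectors in a row.\<close>

definition regroup ::
    "'v set \<Rightarrow> nat list \<Rightarrow> (('v \<Rightarrow> real) list \<Rightarrow> real) \<Rightarrow> ('v list \<Rightarrow> real) list \<Rightarrow> real" where
  "regroup V ks \<sigma> xs =
     (\<Sum>bs\<in>listset (map (tuples V) ks).
        (\<Prod>i<length ks. (xs ! i) (bs ! i)) * \<sigma> (map std_basis (concat bs)))"

text \<open>The supremum is over a nonempty bounded set as soon as \<open>V\<close> is finite and nonempty; its value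
  for \<open>V = {}\<close> is irrelevant in the asymptotic statements below.\<close>

definition spectral_norm ::
    "'v set \<Rightarrow> nat list \<Rightarrow> (('v list \<Rightarrow> real) list \<Rightarrow> real) \<Rightarrow> real" where
  "spectral_norm V ks \<phi> =
     (SUP xs \<in> {xs. list_all2 (\<lambda>x m. L2_set x (tuples V m) = 1) xs ks}. \<bar>\<phi> xs\<bar>)"

definition lambda1 :: "nat list \<Rightarrow> 'v loop_hypergraph \<Rightarrow> real" where
  "lambda1 ks H = spectral_norm (verts H) ks (regroup (verts H) ks (adjacency_map H))"

definition lambda2 :: "nat list \<Rightarrow> 'v loop_hypergraph \<Rightarrow> real" where
  "lambda2 ks H = spectral_norm (verts H) ks
     (\<lambda>xs. regroup (verts H) ks (adjacency_map H) xs
        - fact (sum_list ks) * real (card (edges H)) / real (card (verts H)) ^ sum_list ks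
            * regroup (verts H) ks (all_ones_map (verts H)) xs)"


section \<open>Steps, paths and cycles\<close>

text \<open>Binary strings are lists of Booleans, with \<open>False\<close> for the bit 0.  \<open>VA a z\<close> is the vertex
  \<open>(a, z)\<close> of \<open>A \<times> [k\<^sub>1]\<close>, and \<open>VB j b z\<close> is the vertex \<open>(b, z)\<close> of \<open>B\<^sub>j \<times> [k\<^sub>j]\<close>.\<close>

datatype step_vertex = VA "bool list" nat | VB nat "bool list" nat

text \<open>Removes the \<open>j\<close>th bit, counting from 1.\<close>

definition remove_bit :: "nat \<Rightarrow> bool list \<Rightarrow> bool list" where
  "remove_bit j a = take (j - 1) a @ drop j a"

text \<open>The code \<open>a\<close> determines the codes \<open>b\<^sub>2, \<dots>, b\<^sub>t\<close> of the other elements of the edge.\<close>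

definition step_edge :: "nat list \<Rightarrow> bool list \<Rightarrow> step_vertex set" where
  "step_edge ks a =
     {VA a z | z. z \<in> {1..ks ! 0}} \<union>
     {VB (j + 1) (remove_bit j a) z | j z. j \<in> {1..length ks - 1} \<and> z \<in> {1..ks ! j}}"

definition step :: "nat list \<Rightarrow> step_vertex hypergraph" where
  "step ks = HGraph
     ({VA a z | a z. length a = length ks - 1 \<and> z \<in> {1..ks ! 0}} \<union>
      {VB j b z | j b z. j \<in> {2..length ks} \<and> length b = length ks - 2 \<and> z \<in> {1..ks ! (j - 1)}})
     (step_edge ks ` {a. length a = length ks - 1})"

text \<open>All binary strings of a given length, in lexicographic order.\<close>

fun lex_codes :: "nat \<Rightarrow> bool list list" where
  "lex_codes 0 = [[]]"
| "lex_codes (Suc m) = map ((#) False) (lex_codes m) @ map ((#) True) (lex_codes m)"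

definition attach_tuple :: "nat list \<Rightarrow> bool \<Rightarrow> step_vertex list" where
  "attach_tuple ks u =
     [VA a z. a \<leftarrow> filter (\<lambda>a. last a = u) (lex_codes (length ks - 1)), z \<leftarrow> [1..<ks ! 0 + 1]]"

definition image_hypergraph :: "('u \<Rightarrow> 'v) \<Rightarrow> 'u hypergraph \<Rightarrow> 'v hypergraph" where
  "image_hypergraph f F = HGraph (f ` verts F) ((`) f ` edges F)"

text \<open>Identification of two tuples, coordinate by coordinate, is the image under the map
  that sends each entry of \<open>xs\<close> to the corresponding entry of \<open>ys\<close> and fixes everything else.  Below,
  \<open>xs\<close> is always distinct and has no entry in common with \<open>ys\<close>.\<close>

definition identify :: "'v list \<Rightarrow> 'v list \<Rightarrow> 'v \<Rightarrow> 'v" where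
  "identify xs ys v = (case map_of (zip xs ys) v of None \<Rightarrow> v | Some w \<Rightarrow> w)"

text \<open>The vertex \<open>v\<close> of the copy \<open>T\<^sub>i\<close> is \<open>(i, v)\<close>.\<close>

definition copies :: "nat list \<Rightarrow> nat \<Rightarrow> (nat \<times> step_vertex) hypergraph" where
  "copies ks r = HGraph
     (\<Union>i\<in>{1..r}. Pair i ` verts (step ks))
     (\<Union>i\<in>{1..r}. (`) (Pair i) ` edges (step ks))"

definition copy_attach :: "nat list \<Rightarrow> bool \<Rightarrow> nat \<Rightarrow> (nat \<times> step_vertex) list" where
  "copy_attach ks u i = map (Pair i) (attach_tuple ks u)"

text \<open>\<open>step_path ks r\<close> and \<open>step_cycle ks r\<close>, formed from \<open>r\<close> steps, are the path and the cycle of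
  length \<open>2 * r\<close>.  The attach tuples \<open>copy_attach ks False 1\<close> and \<open>copy_attach ks True r\<close> of the path
  are fixed by the identification in \<open>step_path\<close>.\<close>

definition step_path :: "nat list \<Rightarrow> nat \<Rightarrow> (nat \<times> step_vertex) hypergraph" where
  "step_path ks r = image_hypergraph
     (identify (concat (map (\<lambda>i. copy_attach ks False (i + 1)) [1..<r]))
               (concat (map (\<lambda>i. copy_attach ks True i) [1..<r])))
     (copies ks r)"

definition step_cycle :: "nat list \<Rightarrow> nat \<Rightarrow> (nat \<times> step_vertex) hypergraph" where
  "step_cycle ks r = image_hypergraph
     (identify (copy_attach ks True r) (copy_attach ks False 1)) (step_path ks r)"


section \<open>Properties of a sequence of hypergraphs\<close>

text \<open>In these definitions \<open>H n\<close> is meant to have \<open>n\<close> vertices.\<close>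

definition Eig :: "real \<Rightarrow> nat list \<Rightarrow> (nat \<Rightarrow> 'v loop_hypergraph) \<Rightarrow> bool" where
  "Eig p ks H \<longleftrightarrow>
     (\<lambda>n. lambda1 ks (H n) - p * real n powr (real (sum_list ks) / 2))
        \<in> o(\<lambda>n. real n powr (real (sum_list ks) / 2)) \<and>
     (\<lambda>n. lambda2 ks (H n)) \<in> o(\<lambda>n. real n powr (real (sum_list ks) / 2))"

definition Expand :: "real \<Rightarrow> nat list \<Rightarrow> (nat \<Rightarrow> 'v loop_hypergraph) \<Rightarrow> bool" where
  "Expand p ks H \<longleftrightarrow>
     (\<exists>r \<in> o(\<lambda>n. real n ^ sum_list ks). \<forall>n Ss.
        list_all2 (\<lambda>S m. S \<subseteq> {s. s \<subseteq> verts (H n) \<and> card s = m}) Ss ks \<longrightarrow>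
        \<bar>real (expand_count (H n) Ss) - p * (\<Prod>S\<leftarrow>Ss. real (card S))\<bar> \<le> r n)"

text \<open>Every finite hypergraph has an isomorphic copy on vertices of type \<^typ>\<open>nat\<close>.\<close>

definition Count_linear :: "real \<Rightarrow> nat list \<Rightarrow> (nat \<Rightarrow> 'v loop_hypergraph) \<Rightarrow> bool" where
  "Count_linear p ks H \<longleftrightarrow>
     (\<forall>F :: nat hypergraph. uniform_hypergraph (sum_list ks) F \<and> pi_linear ks F \<longrightarrow>
        (\<lambda>n. real (card (labeled_copies F (H n)))
              - p ^ card (edges F) * real n ^ card (verts F))
          \<in> o(\<lambda>n. real n ^ card (verts F)))"

text \<open>\<open>Cycle p ks r\<close> is the upper bound on the number of labeled copies of the cycle of
  length \<open>2 * r\<close>.\<close>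

definition Cycle :: "real \<Rightarrow> nat list \<Rightarrow> nat \<Rightarrow> (nat \<Rightarrow> 'v loop_hypergraph) \<Rightarrow> bool" where
  "Cycle p ks r H \<longleftrightarrow>
     (\<exists>err \<in> o(\<lambda>n. real n ^ card (verts (step_cycle ks r))). \<forall>n.
        real (card (labeled_copies (step_cycle ks r) (H n)))
          \<le> p ^ card (edges (step_cycle ks r)) * real n ^ card (verts (step_cycle ks r)) + err n)"

definition edge_dense :: "real \<Rightarrow> nat \<Rightarrow> (nat \<Rightarrow> 'v loop_hypergraph) \<Rightarrow> bool" where
  "edge_dense p k H \<longleftrightarrow>
     (\<exists>err \<in> o(\<lambda>n. real n ^ k). \<forall>n.
        real (card (edges (H n))) \<ge> p * real (n choose k) + err n)"

end

theory Submission
  imports Defs "HOL-Combinatorics.Multiset_Permutations"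
begin

text \<open>The four implications from eigenvalues to expansion, to counts of linear hypergraphs, to
  counts of the shorter and then of the longer cycles only use a lower bound on the number of
  edges; the return from long cycles to eigenvalues uses coregularity.

  Eigenvalues imply expansion by testing the second form on normalised indicators of families of
  sets, each set being represented by one tuple. The edge density in this form tends to \<open>p\<close>: the
  hypothesis bounds it from below, and the first eigenvalue from above. Expansion implies the
  counts by replacing the edges of a linear hypergraph by the constant \<open>p\<close>, beginning with the
  last (\<open>remove_edge_bound\<close>). With the images of all other vertices fixed, the earlier edges
  contribute a product of weights of the blocks of the last edge, and a multilinear form is
  bounded by its values on indicators. The cycles are themselves linear, since any two of their
  edges meet inside one block (\<open>pi_linear_step_cycle\<close>).

  Everything about cycles rests on a transfer matrix. The number of weighted maps of a step with
  prescribed values on its attach tuples is a symmetric matrix \<open>M\<close>, and the weighted number of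
  maps of the cycle formed from \<open>r\<close> steps is the trace of the \<open>r\<close>th power of \<open>M\<close>
  (\<open>hom_sum_cycle_eq_trace\<close>). The bound for the longer cycles follows from the
  submultiplicativity of the Frobenius norm.

  For the return, each vertex of a cycle lies in exactly two edges and the cycle is connected.
  Write the indicator of the edges as \<open>g + c\<close> with \<open>c\<close> the exact density; by coregularity, \<open>g\<close>
  sums to zero in every single coordinate. Expanding the cycle sum, every mixed term vanishes,
  because it has a vertex in exactly one edge of weight \<open>g\<close> (\<open>hom_sum_cycle_add_const\<close>). So the
  assumed upper bound says that the cycle sum of \<open>g\<close> is of lower order. On the other hand, a
  step is built from an edge by \<open>t - 1\<close> doublings, where \<open>t\<close> is the number of parts, each of
  which is an application of the Cauchy--Schwarz inequality to one part. Hence the form with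
  kernel \<open>g\<close> at unit tensors, raised to the power \<open>2 ^ (t - 1)\<close>, is at most a quadratic form of
  \<open>M\<close> at a unit vector, and even powers of the latter are bounded by traces of powers of \<open>M\<close>
  (\<open>tensor_form_pow_le_trace\<close>). Thus the form with kernel \<open>g\<close> has small norm, and the
  eigenvalues differ from it by multiples of \<open>J\<close>.\<close>

section \<open>Sums over spaces of functions\<close>

lemma in_listset_iff:
  "xs \<in> listset As \<longleftrightarrow> length xs = length As \<and> (\<forall>i<length As. xs ! i \<in> As ! i)"
proof (induction As arbitrary: xs)
  case (Cons A As)
  show ?case
    by (cases xs) (auto simp: set_Cons_def Cons.IH nth_Cons' less_Suc_eq_0_disj)
qed auto

lemma sum_listset_eq_PiE:
  fixes h :: "'a list \<Rightarrow> real"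
  shows "(\<Sum>xs\<in>listset (map S [0..<t]). h xs) = (\<Sum>y\<in>Pi\<^sub>E {..<t} S. h (map y [0..<t]))"
proof (rule sum.reindex_bij_witness
    [where i = "\<lambda>y. map y [0..<t]" and j = "\<lambda>xs. \<lambda>i\<in>{..<t}. xs ! i"])
  fix xs assume "xs \<in> listset (map S [0..<t])"
  then have xs: "length xs = t" "\<forall>i<t. xs ! i \<in> S i" by (auto simp: in_listset_iff)
  show *: "map (\<lambda>i\<in>{..<t}. xs ! i) [0..<t] = xs"
    using xs by (intro nth_equalityI) auto
  show "(\<lambda>i\<in>{..<t}. xs ! i) \<in> Pi\<^sub>E {..<t} S" using xs by auto
  show "h (map (\<lambda>i\<in>{..<t}. xs ! i) [0..<t]) = h xs" by (simp only: *)
next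
  fix y assume y: "y \<in> Pi\<^sub>E {..<t} S"
  then show "(\<lambda>i\<in>{..<t}. map y [0..<t] ! i) = y"
    by (auto simp: fun_eq_iff restrict_def PiE_def extensional_def)
  show "map y [0..<t] \<in> listset (map S [0..<t])" using y by (auto simp: in_listset_iff)
qed

lemma sum_PiE_Un_disjoint:
  fixes h :: "('i \<Rightarrow> 'a) \<Rightarrow> real"
  assumes "I \<inter> J = {}"
  shows "(\<Sum>\<phi>\<in>Pi\<^sub>E (I \<union> J) D. h \<phi>)
       = (\<Sum>x\<in>Pi\<^sub>E I D. \<Sum>y\<in>Pi\<^sub>E J D. h (merge I J (x, y)))"
  unfolding sum.cartesian_product
proof (rule sum.reindex_bij_witness
    [where i = "merge I J" and j = "\<lambda>\<phi>. (restrict \<phi> I, restrict \<phi> J)"])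
  fix \<phi> assume p: "\<phi> \<in> Pi\<^sub>E (I \<union> J) D"
  show *: "merge I J (restrict \<phi> I, restrict \<phi> J) = \<phi>"
    using p by (auto simp: fun_eq_iff merge_def PiE_def extensional_def)
  show "(restrict \<phi> I, restrict \<phi> J) \<in> Pi\<^sub>E I D \<times> Pi\<^sub>E J D" using p by auto
  show "(case (restrict \<phi> I, restrict \<phi> J) of (x, y) \<Rightarrow> h (merge I J (x, y))) = h \<phi>"
    by (simp only: * prod.case)
next
  fix xy assume "xy \<in> Pi\<^sub>E I D \<times> Pi\<^sub>E J D"
  then obtain x y where [simp]: "xy = (x, y)" and "x \<in> Pi\<^sub>E I D" "y \<in> Pi\<^sub>E J D" by auto
  then show "merge I J xy \<in> Pi\<^sub>E (I \<union> J) D"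
    by (intro PiE_I) (auto simp: merge_def)
  show "(restrict (merge I J xy) I, restrict (merge I J xy) J) = xy"
    using assms \<open>x \<in> _\<close> \<open>y \<in> _\<close>
    by (auto simp: fun_eq_iff merge_def PiE_def extensional_def restrict_def)
qed

text \<open>Injective and arbitrary maps may be exchanged in asymptotic counts: of the \<open>n ^ f\<close> maps
  from \<open>f\<close> points to \<open>n\<close> points only \<open>O(n ^ (f - 1))\<close> are not injective.\<close>

lemma card_not_inj_maps_le:
  fixes V :: "'v set"
  assumes "finite I" "finite V"
  shows "card {\<phi> \<in> I \<rightarrow>\<^sub>E V. \<not> inj_on \<phi> I} \<le> (card I)\<^sup>2 * card V ^ (card I - 1)"
proof -
  let ?N = "\<lambda>uv. {\<phi> \<in> I \<rightarrow>\<^sub>E V. \<phi> (fst uv) = \<phi> (snd uv)}"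
  let ?P = "{uv \<in> I \<times> I. fst uv \<noteq> snd uv}"
  have fin: "finite (I \<rightarrow>\<^sub>E V)" using assms by (auto intro: finite_PiE)
  have "card {\<phi> \<in> I \<rightarrow>\<^sub>E V. \<not> inj_on \<phi> I} \<le> card (\<Union>uv\<in>?P. ?N uv)"
    using assms fin by (intro card_mono) (auto simp: inj_on_def intro: finite_PiE)
  also have "\<dots> \<le> (\<Sum>uv\<in>?P. card (?N uv))"
    using assms by (intro card_UN_le) auto
  also have "\<dots> \<le> (\<Sum>uv\<in>?P. card V ^ (card I - 1))"
  proof (rule sum_mono)
    fix uv assume uv: "uv \<in> ?P"
    then obtain u v where [simp]: "uv = (u, v)" and u: "u \<in> I" and v: "v \<in> I" and ne: "u \<noteq> v"
      by auto
    \<comment> \<open>the value at \<open>u\<close> is the value at \<open>v\<close>\<close>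
    have "inj_on (\<lambda>\<phi>. restrict \<phi> (I - {u})) (?N uv)"
    proof (rule inj_onI)
      fix \<phi> \<psi> assume a: "\<phi> \<in> ?N uv" "\<psi> \<in> ?N uv" "restrict \<phi> (I - {u}) = restrict \<psi> (I - {u})"
      have e: "\<phi> w = \<psi> w" if "w \<in> I - {u}" for w
        using that a(3) by (metis restrict_apply')
      then have "\<phi> w = \<psi> w" if "w \<in> I" for w
        using that a(1,2) v ne by (cases "w = u") auto
      then show "\<phi> = \<psi>" using a(1,2) by (intro PiE_ext[of _ I "\<lambda>_. V"]) auto
    qed
    moreover have "(\<lambda>\<phi>. restrict \<phi> (I - {u})) ` ?N uv \<subseteq> (I - {u}) \<rightarrow>\<^sub>E V"
      by (intro image_subsetI restrict_PiE_iff[THEN iffD2]) auto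
    ultimately have "card (?N uv) \<le> card ((I - {u}) \<rightarrow>\<^sub>E V)"
      using assms by (intro card_inj_on_le) (auto intro: finite_PiE)
    also have "\<dots> = card V ^ (card I - 1)" using assms u by (simp add: card_PiE)
    finally show "card (?N uv) \<le> card V ^ (card I - 1)" .
  qed
  also have "\<dots> \<le> (card I)\<^sup>2 * card V ^ (card I - 1)"
  proof -
    have "card ?P \<le> card (I \<times> I)" using assms by (intro card_mono) auto
    then show ?thesis by (simp add: power2_eq_square card_cartesian_product)
  qed
  finally show ?thesis .
qed

lemma abs_weighted_sum_le:
  fixes v L :: "'a \<Rightarrow> real"
  assumes "finite D" "\<And>x. x \<in> D \<Longrightarrow> 0 \<le> v x \<and> v x \<le> C" "0 \<le> C"
    and "\<And>X. X \<subseteq> D \<Longrightarrow> \<bar>\<Sum>x\<in>X. L x\<bar> \<le> r"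
  shows "\<bar>\<Sum>x\<in>D. v x * L x\<bar> \<le> C * r"
proof -
  have upper: "(\<Sum>x\<in>D. v x * M x) \<le> C * r"
    if M: "\<And>X. X \<subseteq> D \<Longrightarrow> \<bar>\<Sum>x\<in>X. M x\<bar> \<le> r" for M :: "'a \<Rightarrow> real"
  proof -
    have "(\<Sum>x\<in>D. v x * M x) \<le> (\<Sum>x\<in>D. if M x > 0 then C * M x else 0)"
      using assms(2) by (intro sum_mono) (auto intro: mult_right_mono mult_nonneg_nonpos)
    also have "\<dots> = C * (\<Sum>x\<in>{x\<in>D. M x > 0}. M x)"
      using assms(1) by (simp add: sum.inter_filter sum_distrib_left if_distrib cong: if_cong)
    also have "\<dots> \<le> C * r"
      using M[of "{x\<in>D. M x > 0}"] assms(3) by (intro mult_left_mono) auto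
    finally show ?thesis .
  qed
  have "(\<Sum>x\<in>D. v x * (- L x)) \<le> C * r"
    using assms(4) by (intro upper) (auto simp: sum_negf)
  with upper[of L] assms(4) show ?thesis by (auto simp: sum_negf abs_le_iff)
qed

lemma sum_PiE_insert:
  fixes h :: "('i \<Rightarrow> 'a) \<Rightarrow> real"
  assumes "a \<notin> T"
  shows "(\<Sum>y\<in>Pi\<^sub>E (insert a T) D. h y) = (\<Sum>x\<in>D a. \<Sum>y\<in>Pi\<^sub>E T D. h (y(a := x)))"
proof -
  have "inj_on (\<lambda>(x, y). y(a := x)) (D a \<times> Pi\<^sub>E T D)"
    using assms by (rule inj_combinator)
  then show ?thesis
    unfolding PiE_insert_eq sum.cartesian_product
    by (subst sum.reindex) (auto simp: case_prod_beta o_def)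
qed

text \<open>A multilinear form that is at most \<open>r\<close> in absolute value on all families of indicator
  vectors is at most \<open>C ^ card T * r\<close> on weights with values in \<open>{0..C}\<close>: in one coordinate the
  form is linear, so the extreme values are attained at \<open>C\<close> times an indicator.\<close>

lemma multilinear_bound_from_indicators:
  fixes K :: "('i \<Rightarrow> 'a) \<Rightarrow> real" and v :: "'i \<Rightarrow> 'a \<Rightarrow> real"
  assumes "finite T" "\<And>s. s \<in> T \<Longrightarrow> finite (D s)" "0 \<le> C"
    and "\<And>s x. s \<in> T \<Longrightarrow> x \<in> D s \<Longrightarrow> 0 \<le> v s x \<and> v s x \<le> C"
    and "\<And>S. (\<And>s. s \<in> T \<Longrightarrow> S s \<subseteq> D s) \<Longrightarrow> \<bar>\<Sum>y\<in>Pi\<^sub>E T S. K y\<bar> \<le> r"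
  shows "\<bar>\<Sum>y\<in>Pi\<^sub>E T D. (\<Prod>s\<in>T. v s (y s)) * K y\<bar> \<le> C ^ card T * r"
  using assms
proof (induction T arbitrary: K r rule: finite_induct)
  case empty
  then show ?case using empty.prems(4)[of D] by simp
next
  case (insert a T)
  define K' where "K' y = (\<Sum>x\<in>D a. v a x * K (y(a := x)))" for y
  have "\<bar>\<Sum>y\<in>Pi\<^sub>E T D. (\<Prod>s\<in>T. v s (y s)) * K' y\<bar> \<le> C ^ card T * (C * r)"
  proof (rule insert.IH)
    fix S assume S: "\<And>s. s \<in> T \<Longrightarrow> S s \<subseteq> D s"
    have "(\<Sum>y\<in>Pi\<^sub>E T S. K' y) = (\<Sum>x\<in>D a. v a x * (\<Sum>y\<in>Pi\<^sub>E T S. K (y(a := x))))"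
      unfolding K'_def by (subst sum.swap) (simp add: sum_distrib_left)
    moreover have "\<bar>\<dots>\<bar> \<le> C * r"
    proof (rule abs_weighted_sum_le)
      fix X assume X: "X \<subseteq> D a"
      have "(\<Sum>x\<in>X. \<Sum>y\<in>Pi\<^sub>E T S. K (y(a := x))) = (\<Sum>y\<in>Pi\<^sub>E (insert a T) (S(a := X)). K y)"
      proof -
        have "Pi\<^sub>E T (S(a := X)) = Pi\<^sub>E T S" using insert.hyps by (intro PiE_cong) auto
        then show ?thesis using insert.hyps by (simp add: sum_PiE_insert)
      qed
      also have "\<bar>\<dots>\<bar> \<le> r" using S X by (intro insert.prems) auto
      finally show "\<bar>\<Sum>x\<in>X. \<Sum>y\<in>Pi\<^sub>E T S. K (y(a := x))\<bar> \<le> r" .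
    qed (use insert.prems in auto)
    ultimately show "\<bar>\<Sum>y\<in>Pi\<^sub>E T S. K' y\<bar> \<le> C * r" by simp
  qed (use insert.prems in auto)
  moreover have "(\<Sum>y\<in>Pi\<^sub>E (insert a T) D. (\<Prod>s\<in>insert a T. v s (y s)) * K y)
      = (\<Sum>y\<in>Pi\<^sub>E T D. (\<Prod>s\<in>T. v s (y s)) * K' y)"
  proof -
    have *: "(\<Prod>s\<in>T. v s (if s = a then x else y s)) = (\<Prod>s\<in>T. v s (y s))" for x y
      using insert.hyps by (intro prod.cong) auto
    show ?thesis
      unfolding sum_PiE_insert[OF insert.hyps(2)] K'_def sum_distrib_left
      using insert.hyps by (subst sum.swap) (simp add: * algebra_simps)
  qed
  ultimately show ?case using insert.hyps by (simp add: algebra_simps)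
qed

text \<open>The maps \<open>f\<close> and \<open>g\<close> embed two copies of the index set \<open>I\<close> which share exactly the points
  of \<open>B\<close>. A sum over all functions on the union of the copies is a sum over the functions on \<open>B\<close>
  of products of two independent sums. For \<open>P = Q\<close> this is the sum of squares which the
  Cauchy--Schwarz inequality produces.\<close>

lemma sum_glued_pair:
  fixes P Q :: "('u \<Rightarrow> 'v) \<Rightarrow> real"
  assumes "B \<subseteq> I" "inj_on f I" "inj_on g I" "\<And>b. b \<in> B \<Longrightarrow> f b = b" "\<And>b. b \<in> B \<Longrightarrow> g b = b"
    and disj: "f ` (I - B) \<inter> g ` (I - B) = {}"
  shows "(\<Sum>\<phi>\<in>(f ` I \<union> g ` I) \<rightarrow>\<^sub>E V. P (restrict (\<phi> \<circ> f) I) * Q (restrict (\<phi> \<circ> g) I))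
       = (\<Sum>\<beta>\<in>B \<rightarrow>\<^sub>E V. (\<Sum>\<psi>\<in>(I - B) \<rightarrow>\<^sub>E V. P (merge B (I - B) (\<beta>, \<psi>)))
                       * (\<Sum>\<psi>\<in>(I - B) \<rightarrow>\<^sub>E V. Q (merge B (I - B) (\<beta>, \<psi>))))"
proof -
  let ?J = "f ` I \<union> g ` I"
  define join :: "('u \<Rightarrow> 'v) \<times> ('u \<Rightarrow> 'v) \<times> ('u \<Rightarrow> 'v) \<Rightarrow> 'u \<Rightarrow> 'v"
    where "join = (\<lambda>(\<beta>, \<psi>, \<rho>). \<lambda>v\<in>?J. if v \<in> B then \<beta> v
      else if v \<in> f ` (I - B) then \<psi> (inv_into I f v) else \<rho> (inv_into I g v))"
  define cut where "cut \<phi> = (restrict \<phi> B, restrict (\<phi> \<circ> f) (I - B), restrict (\<phi> \<circ> g) (I - B))"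
    for \<phi> :: "'u \<Rightarrow> 'v"
  have fB: "f x \<notin> B" if "x \<in> I - B" for x
    using that assms(1,2,4) by (metis DiffD1 DiffD2 inj_onD subsetD)
  have gB: "g x \<notin> B" if "x \<in> I - B" for x
    using that assms(1,3,5) by (metis DiffD1 DiffD2 inj_onD subsetD)
  have gf: "g x \<notin> f ` (I - B)" if "x \<in> I - B" for x
    using that disj by auto
  have BJ: "B \<subseteq> ?J" using assms(1,4) by (metis image_eqI subsetD subsetI UnI1)
  have jf: "join (\<beta>, \<psi>, \<rho>) (f x) = (if x \<in> B then \<beta> x else \<psi> x)" if "x \<in> I" for x \<beta> \<psi> \<rho>
    using that fB[of x] assms(2,4) by (auto simp: join_def)
  have jg: "join (\<beta>, \<psi>, \<rho>) (g x) = (if x \<in> B then \<beta> x else \<rho> x)" if "x \<in> I" for x \<beta> \<psi> \<rho>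
    using that gB[of x] gf[of x] assms(3,5) by (auto simp: join_def)
  have "(\<Sum>\<beta>\<in>B \<rightarrow>\<^sub>E V. (\<Sum>\<psi>\<in>(I - B) \<rightarrow>\<^sub>E V. P (merge B (I - B) (\<beta>, \<psi>)))
                       * (\<Sum>\<psi>\<in>(I - B) \<rightarrow>\<^sub>E V. Q (merge B (I - B) (\<beta>, \<psi>))))
     = (\<Sum>(\<beta>, \<psi>, \<rho>)\<in>(B \<rightarrow>\<^sub>E V) \<times> ((I - B) \<rightarrow>\<^sub>E V) \<times> ((I - B) \<rightarrow>\<^sub>E V).
          P (merge B (I - B) (\<beta>, \<psi>)) * Q (merge B (I - B) (\<beta>, \<rho>)))"
    by (simp add: sum_product sum.cartesian_product)
  also have "\<dots> = (\<Sum>\<phi>\<in>?J \<rightarrow>\<^sub>E V. P (restrict (\<phi> \<circ> f) I) * Q (restrict (\<phi> \<circ> g) I))"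
  proof (rule sum.reindex_bij_witness[where i = cut and j = join])
    fix a assume a: "a \<in> (B \<rightarrow>\<^sub>E V) \<times> ((I - B) \<rightarrow>\<^sub>E V) \<times> ((I - B) \<rightarrow>\<^sub>E V)"
    obtain \<beta> \<psi> \<rho> where [simp]: "a = (\<beta>, \<psi>, \<rho>)" by (cases a) auto
    have jB: "join (\<beta>, \<psi>, \<rho>) b = \<beta> b" if "b \<in> B" for b using that BJ by (auto simp: join_def)
    show "cut (join a) = a"
      using a by (auto simp: cut_def fun_eq_iff jf jg jB PiE_def extensional_def restrict_def)
    show "join a \<in> ?J \<rightarrow>\<^sub>E V"
    proof
      fix v assume "v \<in> ?J"
      then consider x where "x \<in> I" "v = f x" | x where "x \<in> I" "v = g x" by auto
      then show "join a v \<in> V" using a by cases (auto simp: jf jg)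
    qed (auto simp: join_def)
    have "restrict (join a \<circ> f) I = merge B (I - B) (\<beta>, \<psi>)"
      "restrict (join a \<circ> g) I = merge B (I - B) (\<beta>, \<rho>)"
      using assms(1) by (auto simp: fun_eq_iff merge_def jf jg)
    then show "P (restrict (join a \<circ> f) I) * Q (restrict (join a \<circ> g) I) =
        (case a of (\<beta>, \<psi>, \<rho>) \<Rightarrow> P (merge B (I - B) (\<beta>, \<psi>)) * Q (merge B (I - B) (\<beta>, \<rho>)))"
      by simp
  next
    fix \<phi> assume p: "\<phi> \<in> ?J \<rightarrow>\<^sub>E V"
    have jB: "join (cut \<phi>) b = \<phi> b" if "b \<in> B" for b using that BJ by (auto simp: join_def cut_def)
    show "cut \<phi> \<in> (B \<rightarrow>\<^sub>E V) \<times> ((I - B) \<rightarrow>\<^sub>E V) \<times> ((I - B) \<rightarrow>\<^sub>E V)"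
      using p BJ by (auto simp: cut_def)
    show "join (cut \<phi>) = \<phi>"
    proof
      fix v
      show "join (cut \<phi>) v = \<phi> v"
      proof (cases "v \<in> ?J")
        case True
        then consider x where "x \<in> I" "v = f x" | x where "x \<in> I" "v = g x" by auto
        then show ?thesis
          using assms(4,5) by cases (auto simp: jf jg cut_def)
      next
        case False
        then show ?thesis using p by (simp add: join_def cut_def PiE_def extensional_def)
      qed
    qed
  qed
  finally show ?thesis by simp
qed

text \<open>Functions on a quotient of \<open>X\<close> are the functions on \<open>X\<close> that are constant on the classes.\<close>

lemma sum_maps_on_image:
  fixes h :: "('u \<Rightarrow> 'v) \<Rightarrow> real"
  shows "(\<Sum>\<Phi>\<in>(q ` X) \<rightarrow>\<^sub>E V. h (restrict (\<Phi> \<circ> q) X))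
       = (\<Sum>\<phi> | \<phi> \<in> X \<rightarrow>\<^sub>E V \<and> (\<forall>u\<in>X. \<forall>v\<in>X. q u = q v \<longrightarrow> \<phi> u = \<phi> v). h \<phi>)"
proof (rule sum.reindex_bij_witness
    [where i = "\<lambda>\<phi>. \<lambda>y\<in>q ` X. \<phi> (inv_into X q y)" and j = "\<lambda>\<Phi>. restrict (\<Phi> \<circ> q) X"])
  fix \<phi> assume p: "\<phi> \<in> {\<phi>. \<phi> \<in> X \<rightarrow>\<^sub>E V \<and> (\<forall>u\<in>X. \<forall>v\<in>X. q u = q v \<longrightarrow> \<phi> u = \<phi> v)}"
  then show "(\<lambda>y\<in>q ` X. \<phi> (inv_into X q y)) \<in> (q ` X) \<rightarrow>\<^sub>E V"
    by (auto simp: inv_into_into intro!: PiE_mem[of \<phi> X "\<lambda>_. V"])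
  show "restrict ((\<lambda>y\<in>q ` X. \<phi> (inv_into X q y)) \<circ> q) X = \<phi>"
  proof
    fix x
    show "restrict ((\<lambda>y\<in>q ` X. \<phi> (inv_into X q y)) \<circ> q) X x = \<phi> x"
    proof (cases "x \<in> X")
      case True
      then have "inv_into X q (q x) \<in> X" "q (inv_into X q (q x)) = q x"
        by (auto intro: inv_into_into f_inv_into_f)
      then have "\<phi> (inv_into X q (q x)) = \<phi> x" using p True by blast
      then show ?thesis using True by simp
    next
      case False
      then show ?thesis using p by (simp add: PiE_def extensional_def)
    qed
  qed
next
  fix \<Phi> assume P: "\<Phi> \<in> (q ` X) \<rightarrow>\<^sub>E V"
  show "(\<lambda>y\<in>q ` X. restrict (\<Phi> \<circ> q) X (inv_into X q y)) = \<Phi>"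
  proof
    fix y
    show "(\<lambda>y\<in>q ` X. restrict (\<Phi> \<circ> q) X (inv_into X q y)) y = \<Phi> y"
    proof (cases "y \<in> q ` X")
      case True
      then have "inv_into X q y \<in> X" "q (inv_into X q y) = y"
        by (rule inv_into_into, rule f_inv_into_f)
      then show ?thesis using True by simp
    next
      case False
      then show ?thesis using P by (simp add: PiE_def extensional_def)
    qed
  qed
  show "restrict (\<Phi> \<circ> q) X \<in> {\<phi>. \<phi> \<in> X \<rightarrow>\<^sub>E V \<and> (\<forall>u\<in>X. \<forall>v\<in>X. q u = q v \<longrightarrow> \<phi> u = \<phi> v)}"
    using P by auto
qed simp

section \<open>Weighted homomorphism sums\<close>

text \<open>The product of the weights \<open>g\<close> of the images of all edges of \<open>F\<close> under a map \<open>\<phi>\<close>. Images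
  are formed as multisets, so \<open>\<phi>\<close> need not be injective.\<close>

definition hom_weight :: "('v multiset \<Rightarrow> real) \<Rightarrow> 'u hypergraph \<Rightarrow> ('u \<Rightarrow> 'v) \<Rightarrow> real" where
  "hom_weight g F \<phi> = (\<Prod>e\<in>edges F. g (image_mset \<phi> (mset_set e)))"

text \<open>The weighted number of maps from \<open>F\<close> to the vertex set \<open>V\<close>. With \<open>g\<close> the indicator of the
  edges of a hypergraph with loops this is the number of homomorphisms.\<close>

definition hom_sum :: "('v multiset \<Rightarrow> real) \<Rightarrow> 'u hypergraph \<Rightarrow> 'v set \<Rightarrow> real" where
  "hom_sum g F V = (\<Sum>\<phi>\<in>verts F \<rightarrow>\<^sub>E V. hom_weight g F \<phi>)"

text \<open>The indicator function of the edge set.\<close>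

definition edge_ind :: "'v loop_hypergraph \<Rightarrow> 'v multiset \<Rightarrow> real" where
  "edge_ind H e = of_bool (e \<in> edges H)"

lemma edge_ind_bounds: "0 \<le> edge_ind H e" "edge_ind H e \<le> 1"
  by (auto simp: edge_ind_def)

lemma hom_weight_edge_ind:
  assumes "finite (edges F)"
  shows "hom_weight (edge_ind H) F \<phi>
       = of_bool (\<forall>e\<in>edges F. image_mset \<phi> (mset_set e) \<in> edges H)"
proof (cases "\<forall>e\<in>edges F. image_mset \<phi> (mset_set e) \<in> edges H")
  case False
  then show ?thesis using assms unfolding hom_weight_def edge_ind_def by (auto intro!: prod_zero)
qed (simp add: hom_weight_def edge_ind_def)

lemma finite_edges_uniform: "uniform_hypergraph k F \<Longrightarrow> finite (edges F)"
  unfolding uniform_hypergraph_def by (rule finite_subset[of _ "Pow (verts F)"]) auto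

lemma labeled_copies_vs_hom_sum:
  assumes "uniform_hypergraph k F" "finite (verts H)"
  shows "real (card (labeled_copies F H)) \<le> hom_sum (edge_ind H) F (verts H)"
    and "hom_sum (edge_ind H) F (verts H) \<le> real (card (labeled_copies F H))
           + real ((card (verts F))\<^sup>2) * real (card (verts H)) ^ (card (verts F) - 1)"
proof -
  have fin: "finite (verts F)" using assms by (simp add: uniform_hypergraph_def)
  let ?A = "verts F \<rightarrow>\<^sub>E verts H"
  let ?w = "hom_weight (edge_ind H) F"
  have fA: "finite ?A" using assms fin by (auto intro: finite_PiE)
  note w = hom_weight_edge_ind[OF finite_edges_uniform[OF assms(1)], of H]
  have c: "real (card (labeled_copies F H)) = (\<Sum>\<phi> | \<phi> \<in> ?A \<and> inj_on \<phi> (verts F). ?w \<phi>)"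
  proof -
    have "labeled_copies F H = {\<phi> \<in> {\<phi> \<in> ?A. inj_on \<phi> (verts F)}.
        \<forall>e\<in>edges F. image_mset \<phi> (mset_set e) \<in> edges H}"
      unfolding labeled_copies_def by auto
    then show ?thesis using fA
      by (simp add: w sum.inter_filter[symmetric] of_bool_def)
  qed
  have split: "hom_sum (edge_ind H) F (verts H) = (\<Sum>\<phi> | \<phi> \<in> ?A \<and> inj_on \<phi> (verts F). ?w \<phi>)
      + (\<Sum>\<phi> | \<phi> \<in> ?A \<and> \<not> inj_on \<phi> (verts F). ?w \<phi>)"
    unfolding hom_sum_def using fA
    by (subst sum.union_disjoint[symmetric]) (auto intro: sum.cong)
  have "0 \<le> (\<Sum>\<phi> | \<phi> \<in> ?A \<and> \<not> inj_on \<phi> (verts F). ?w \<phi>)"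
    by (intro sum_nonneg) (simp add: w)
  then show "real (card (labeled_copies F H)) \<le> hom_sum (edge_ind H) F (verts H)"
    using c split by simp
  have "(\<Sum>\<phi> | \<phi> \<in> ?A \<and> \<not> inj_on \<phi> (verts F). ?w \<phi>)
      \<le> real (card {\<phi> \<in> ?A. \<not> inj_on \<phi> (verts F)})"
    using sum_bounded_above[of "{\<phi> \<in> ?A. \<not> inj_on \<phi> (verts F)}" ?w 1] by (simp add: w)
  also have "\<dots> \<le> real ((card (verts F))\<^sup>2 * card (verts H) ^ (card (verts F) - 1))"
    using card_not_inj_maps_le[OF fin assms(2)] by (intro of_nat_mono)
  finally show "hom_sum (edge_ind H) F (verts H) \<le> real (card (labeled_copies F H))
           + real ((card (verts F))\<^sup>2) * real (card (verts H)) ^ (card (verts F) - 1)"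
    using c split by simp
qed

section \<open>Expansion controls linear hypergraphs\<close>

lemma finite_listset:
  assumes "\<And>A. A \<in> set As \<Longrightarrow> finite A"
  shows "finite (listset As)"
  using assms
proof (induction As)
  case (Cons A As)
  have "listset (A # As) = (\<lambda>(x, xs). x # xs) ` (A \<times> listset As)"
    by (auto simp: set_Cons_def)
  then show ?case using Cons by simp
qed simp

lemma expand_count_deviation:
  assumes "finite V" "\<And>j. j < t \<Longrightarrow> S j \<subseteq> {s. s \<subseteq> V \<and> card s = ks ! j}"
  shows "real (expand_count H (map S [0..<t])) - p * (\<Prod>X\<leftarrow>map S [0..<t]. real (card X))
       = (\<Sum>Y\<in>Pi\<^sub>E {..<t} S. edge_ind H (\<Sum>j<t. mset_set (Y j)) - p)"
proof -
  have fS: "finite (S j)" if "j < t" for j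
    using assms(2)[OF that] assms(1) by (auto intro: finite_subset[of _ "Pow V"])
  have fin: "finite (listset (map S [0..<t]))"
    using fS by (intro finite_listset) auto
  have 1: "real (expand_count H (map S [0..<t]))
      = (\<Sum>ss\<in>listset (map S [0..<t]). edge_ind H (\<Sum>s\<leftarrow>ss. mset_set s))"
    unfolding expand_count_def edge_ind_def of_bool_def using fin
    by (simp add: sum.inter_filter[symmetric])
  have 2: "(\<Sum>s\<leftarrow>map Y [0..<t]. mset_set s) = (\<Sum>j<t. mset_set (Y j))" for Y
    by (simp add: interv_sum_list_conv_sum_set_nat atLeast0LessThan o_def)
  have 3: "(\<Prod>X\<leftarrow>map S [0..<t]. real (card X)) = real (card (Pi\<^sub>E {..<t} S))"
    by (simp add: card_PiE o_def atLeast0LessThan prod.list_conv_set_nth)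
  show ?thesis
    unfolding 1 sum_listset_eq_PiE 2 3 by (simp add: sum_subtractf)
qed

text \<open>A weighted sum whose kernel depends on each coordinate only through \<open>\<pi> s\<close> is a sum over
  the images, weighted by the sums over the fibres.\<close>

lemma sum_PiE_pushforward:
  fixes u :: "'i \<Rightarrow> 'a \<Rightarrow> real"
  assumes "finite T" "\<And>s. s \<in> T \<Longrightarrow> finite (B s)" "\<And>s. s \<in> T \<Longrightarrow> finite (D s)"
    and "\<And>s x. s \<in> T \<Longrightarrow> x \<in> B s \<Longrightarrow> \<pi> s x \<in> D s"
  shows "(\<Sum>y\<in>Pi\<^sub>E T B. (\<Prod>s\<in>T. u s (y s)) * K (\<lambda>s\<in>T. \<pi> s (y s)))
       = (\<Sum>Y\<in>Pi\<^sub>E T D. (\<Prod>s\<in>T. \<Sum>x | x \<in> B s \<and> \<pi> s x = Y s. u s x) * K Y)"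
proof -
  let ?f = "\<lambda>y. \<lambda>s\<in>T. \<pi> s (y s)"
  let ?h = "\<lambda>y. (\<Prod>s\<in>T. u s (y s)) * K (?f y)"
  have "(\<Sum>y\<in>Pi\<^sub>E T B. ?h y) = (\<Sum>Y\<in>Pi\<^sub>E T D. \<Sum>y | y \<in> Pi\<^sub>E T B \<and> ?f y = Y. ?h y)"
  proof (intro sum.group[symmetric] finite_PiE image_subsetI restrict_PiE_iff[THEN iffD2] ballI)
    fix y s assume "y \<in> Pi\<^sub>E T B" "s \<in> T"
    then show "\<pi> s (y s) \<in> D s" using assms(4) by (meson PiE_mem)
  qed (use assms in auto)
  also have "\<dots> = (\<Sum>Y\<in>Pi\<^sub>E T D. (\<Prod>s\<in>T. \<Sum>x | x \<in> B s \<and> \<pi> s x = Y s. u s x) * K Y)"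
  proof (rule sum.cong[OF refl])
    fix Y assume Y: "Y \<in> Pi\<^sub>E T D"
    have eq: "{y. y \<in> Pi\<^sub>E T B \<and> ?f y = Y} = Pi\<^sub>E T (\<lambda>s. {x. x \<in> B s \<and> \<pi> s x = Y s})"
    proof (intro set_eqI iffI)
      fix y assume "y \<in> {y. y \<in> Pi\<^sub>E T B \<and> ?f y = Y}"
      then show "y \<in> Pi\<^sub>E T (\<lambda>s. {x. x \<in> B s \<and> \<pi> s x = Y s})" by auto
    next
      fix y assume y: "y \<in> Pi\<^sub>E T (\<lambda>s. {x. x \<in> B s \<and> \<pi> s x = Y s})"
      then have "?f y = Y" using Y by (intro PiE_ext[of _ T "\<lambda>s. D s" Y])
        (force simp: PiE_iff)+
      then show "y \<in> {y. y \<in> Pi\<^sub>E T B \<and> ?f y = Y}" using y by auto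
    qed
    have "(\<Sum>y | y \<in> Pi\<^sub>E T B \<and> ?f y = Y. ?h y)
        = (\<Sum>y | y \<in> Pi\<^sub>E T B \<and> ?f y = Y. (\<Prod>s\<in>T. u s (y s)) * K Y)"
      by (intro sum.cong) auto
    also have "\<dots> = (\<Prod>s\<in>T. \<Sum>x | x \<in> B s \<and> \<pi> s x = Y s. u s x) * K Y"
      unfolding eq sum_distrib_right[symmetric] using assms
      by (subst prod_sum_PiE) auto
    finally show "(\<Sum>y | y \<in> Pi\<^sub>E T B \<and> ?f y = Y. ?h y)
        = (\<Prod>s\<in>T. \<Sum>x | x \<in> B s \<and> \<pi> s x = Y s. u s x) * K Y" .
  qed
  finally show ?thesis .
qed

lemma sum_PiE_disjoint_blocks:
  fixes h :: "('i \<Rightarrow> 'a \<Rightarrow> 'v) \<Rightarrow> real"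
  assumes "disjoint_family_on A T"
  shows "(\<Sum>\<psi>\<in>(\<Union>s\<in>T. A s) \<rightarrow>\<^sub>E V. h (\<lambda>s\<in>T. restrict \<psi> (A s)))
       = (\<Sum>y\<in>Pi\<^sub>E T (\<lambda>s. A s \<rightarrow>\<^sub>E V). h y)"
proof -
  define ix where "ix v = (SOME s. s \<in> T \<and> v \<in> A s)" for v
  have ix: "ix v = s" if "s \<in> T" "v \<in> A s" for s v
  proof -
    have "ix v \<in> T \<and> v \<in> A (ix v)" unfolding ix_def using that by (metis (mono_tags, lifting) someI)
    then show ?thesis using that assms by (auto simp: disjoint_family_on_def)
  qed
  show ?thesis
  proof (rule sum.reindex_bij_witness
      [where i = "\<lambda>y. \<lambda>v\<in>(\<Union>s\<in>T. A s). y (ix v) v" and j = "\<lambda>\<psi>. \<lambda>s\<in>T. restrict \<psi> (A s)"])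
    fix \<psi> assume p: "\<psi> \<in> (\<Union>s\<in>T. A s) \<rightarrow>\<^sub>E V"
    show "(\<lambda>v\<in>(\<Union>s\<in>T. A s). (\<lambda>s\<in>T. restrict \<psi> (A s)) (ix v) v) = \<psi>"
    proof
      fix v
      show "(\<lambda>v\<in>(\<Union>s\<in>T. A s). (\<lambda>s\<in>T. restrict \<psi> (A s)) (ix v) v) v = \<psi> v"
      proof (cases "v \<in> (\<Union>s\<in>T. A s)")
        case True
        then obtain s where "s \<in> T" "v \<in> A s" by auto
        with ix[OF this] True show ?thesis by simp
      next
        case False
        then show ?thesis using p by (simp add: PiE_def extensional_def)
      qed
    qed
    show "(\<lambda>s\<in>T. restrict \<psi> (A s)) \<in> Pi\<^sub>E T (\<lambda>s. A s \<rightarrow>\<^sub>E V)" using p by auto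
  next
    fix y assume y: "y \<in> Pi\<^sub>E T (\<lambda>s. A s \<rightarrow>\<^sub>E V)"
    show "(\<lambda>v\<in>(\<Union>s\<in>T. A s). y (ix v) v) \<in> (\<Union>s\<in>T. A s) \<rightarrow>\<^sub>E V"
    proof (intro restrict_PiE_iff[THEN iffD2] ballI)
      fix v assume "v \<in> (\<Union>s\<in>T. A s)"
      then obtain s where s: "s \<in> T" "v \<in> A s" by auto
      with ix[OF this] PiE_mem[OF PiE_mem[OF y s(1)] s(2)] show "y (ix v) v \<in> V" by simp
    qed
    show "(\<lambda>s\<in>T. restrict (\<lambda>v\<in>(\<Union>s\<in>T. A s). y (ix v) v) (A s)) = y"
    proof
      fix s
      show "(\<lambda>s\<in>T. restrict (\<lambda>v\<in>(\<Union>s\<in>T. A s). y (ix v) v) (A s)) s = y s"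
      proof (cases "s \<in> T")
        case True
        then have "y s \<in> A s \<rightarrow>\<^sub>E V" using y by auto
        moreover have "restrict (\<lambda>v\<in>(\<Union>s\<in>T. A s). y (ix v) v) (A s) v = y s v" if "v \<in> A s" for v
          using that True ix[OF True that] by auto
        ultimately have "restrict (\<lambda>v\<in>(\<Union>s\<in>T. A s). y (ix v) v) (A s) v = y s v" for v
          by (cases "v \<in> A s") (simp_all add: PiE_def extensional_def)
        then show ?thesis using True by (simp add: fun_eq_iff)
      next
        case False
        then show ?thesis using y by (simp add: PiE_def extensional_def)
      qed
    qed
  qed simp
qed

text \<open>Expansion speaks about families of sets, counting about tuples weighted by the copies of
  the other edges. The weights are pushed forward to the sets underlying the injective tuples,
  where each of them is at most \<open>k ^ k\<close>, and then replaced by indicators.\<close>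

lemma block_deviation_bound:
  fixes H :: "'v loop_hypergraph" and A :: "nat \<Rightarrow> 'u set"
  assumes V: "finite (verts H)" and A: "disjoint_family_on A {..<length ks}"
    and cA: "\<And>s. s < length ks \<Longrightarrow> card (A s) = ks ! s \<and> finite (A s) \<and> ks ! s \<le> k" and k: "1 \<le> k"
    and u: "\<And>s y. s < length ks \<Longrightarrow> 0 \<le> u s y \<and> u s y \<le> 1"
    and dev: "\<And>Ss. list_all2 (\<lambda>S m. S \<subseteq> {s. s \<subseteq> verts H \<and> card s = m}) Ss ks \<Longrightarrow>
        \<bar>real (expand_count H Ss) - p * (\<Prod>S\<leftarrow>Ss. real (card S))\<bar> \<le> r"
  shows "\<bar>\<Sum>\<psi>\<in>(\<Union>s<length ks. A s) \<rightarrow>\<^sub>E verts H.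
            (\<Prod>s<length ks. of_bool (inj_on \<psi> (A s)) * u s (restrict \<psi> (A s))) *
            (edge_ind H (\<Sum>s<length ks. image_mset \<psi> (mset_set (A s))) - p)\<bar>
         \<le> real (k ^ k) ^ length ks * r"
proof -
  let ?t = "length ks" and ?V = "verts H"
  define K where "K Y = edge_ind H (\<Sum>s<?t. mset_set (Y s)) - p" for Y
  define D where "D s = {X. X \<subseteq> ?V \<and> card X = ks ! s}" for s
  define w where "w s y = of_bool (inj_on y (A s)) * u s y" for s y
  define v where "v s X = (\<Sum>y | y \<in> {y \<in> A s \<rightarrow>\<^sub>E ?V. inj_on y (A s)} \<and> y ` A s = X. w s y)" for s X
  have fD: "finite (D s)" for s unfolding D_def using V
      by (auto intro: finite_subset[of _ "Pow ?V"])
  have "(\<Sum>\<psi>\<in>(\<Union>s<?t. A s) \<rightarrow>\<^sub>E ?V.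
            (\<Prod>s<?t. of_bool (inj_on \<psi> (A s)) * u s (restrict \<psi> (A s))) *
            (edge_ind H (\<Sum>s<?t. image_mset \<psi> (mset_set (A s))) - p))
      = (\<Sum>\<psi>\<in>(\<Union>s<?t. A s) \<rightarrow>\<^sub>E ?V. (\<lambda>y. (\<Prod>s<?t. w s (y s)) * K (\<lambda>s\<in>{..<?t}. y s ` A s))
           (\<lambda>s\<in>{..<?t}. restrict \<psi> (A s)))" (is "sum ?L _ = sum ?R _")
  proof (rule sum.cong[OF refl])
    fix \<psi>
    show "?L \<psi> = ?R \<psi>"
    proof (cases "\<forall>s<?t. inj_on \<psi> (A s)")
      case True
      then have "(\<Sum>s<?t. image_mset \<psi> (mset_set (A s))) = (\<Sum>s<?t. mset_set (\<psi> ` A s))"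
        by (intro sum.cong) (auto simp: image_mset_mset_set)
      moreover have "restrict \<psi> (A s) ` A s = \<psi> ` A s" for s by auto
      then have "(\<Sum>s<?t. mset_set ((\<lambda>s\<in>{..<?t}. (\<lambda>s\<in>{..<?t}. restrict \<psi> (A s)) s ` A s) s))
          = (\<Sum>s<?t. mset_set (\<psi> ` A s))" by (intro sum.cong) auto
      moreover have "(\<Prod>s<?t. w s ((\<lambda>s\<in>{..<?t}. restrict \<psi> (A s)) s))
          = (\<Prod>s<?t. of_bool (inj_on \<psi> (A s)) * u s (restrict \<psi> (A s)))"
        by (intro prod.cong) (auto simp: w_def inj_on_restrict_eq)
      ultimately show ?thesis by (simp only: K_def)
    next
      case False
      then obtain s where s: "s < ?t" "\<not> inj_on \<psi> (A s)" by auto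
      then have "(\<Prod>s<?t. of_bool (inj_on \<psi> (A s)) * u s (restrict \<psi> (A s))) = 0"
        by (intro prod_zero) auto
      moreover have "(\<Prod>s<?t. w s ((\<lambda>s\<in>{..<?t}. restrict \<psi> (A s)) s)) = 0"
        using s by (intro prod_zero) (auto simp: w_def inj_on_restrict_eq)
      ultimately show ?thesis by (simp only: mult_zero_left)
    qed
  qed
  also have "\<dots> = (\<Sum>y\<in>Pi\<^sub>E {..<?t} (\<lambda>s. A s \<rightarrow>\<^sub>E ?V).
       (\<Prod>s<?t. w s (y s)) * K (\<lambda>s\<in>{..<?t}. y s ` A s))"
    by (rule sum_PiE_disjoint_blocks[OF A])
  also have "\<dots> = (\<Sum>y\<in>Pi\<^sub>E {..<?t} (\<lambda>s. {y \<in> A s \<rightarrow>\<^sub>E ?V. inj_on y (A s)}).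
       (\<Prod>s<?t. w s (y s)) * K (\<lambda>s\<in>{..<?t}. y s ` A s))"
  proof (rule sum.mono_neutral_right)
    show "finite (Pi\<^sub>E {..<?t} (\<lambda>s. A s \<rightarrow>\<^sub>E ?V))" using V cA by (auto intro!: finite_PiE)
    show "\<forall>y\<in>Pi\<^sub>E {..<?t} (\<lambda>s. A s \<rightarrow>\<^sub>E ?V) - Pi\<^sub>E {..<?t} (\<lambda>s. {y \<in> A s \<rightarrow>\<^sub>E ?V. inj_on y (A s)}).
        (\<Prod>s<?t. w s (y s)) * K (\<lambda>s\<in>{..<?t}. y s ` A s) = 0"
    proof
      fix y assume y: "y \<in> Pi\<^sub>E {..<?t} (\<lambda>s. A s \<rightarrow>\<^sub>E ?V) - Pi\<^sub>E {..<?t} (\<lambda>s. {y \<in> A s \<rightarrow>\<^sub>E ?V.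
          inj_on y (A s)})"
      then obtain s where "s < ?t" "\<not> inj_on (y s) (A s)" by (auto simp: PiE_iff)
      then have "(\<Prod>s<?t. w s (y s)) = 0" by (intro prod_zero) (auto simp: w_def)
      then show "(\<Prod>s<?t. w s (y s)) * K (\<lambda>s\<in>{..<?t}. y s ` A s) = 0" by simp
    qed
  qed (intro PiE_mono, auto)
  also have "\<dots> = (\<Sum>Y\<in>Pi\<^sub>E {..<?t} D. (\<Prod>s<?t. v s (Y s)) * K Y)"
    unfolding v_def
  proof (rule sum_PiE_pushforward)
    fix s assume "s \<in> {..<?t}"
    then show "finite {y \<in> A s \<rightarrow>\<^sub>E ?V. inj_on y (A s)}"
      using V cA by (auto intro!: finite_PiE intro: finite_subset[of _ "A s \<rightarrow>\<^sub>E ?V"])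
    fix y assume "y \<in> {y \<in> A s \<rightarrow>\<^sub>E ?V. inj_on y (A s)}"
    then show "y ` A s \<in> D s" using cA \<open>s \<in> _\<close> by (auto simp: D_def card_image)
  qed (use fD in auto)
  finally have eq: "(\<Sum>\<psi>\<in>(\<Union>s<?t. A s) \<rightarrow>\<^sub>E ?V.
            (\<Prod>s<?t. of_bool (inj_on \<psi> (A s)) * u s (restrict \<psi> (A s))) *
            (edge_ind H (\<Sum>s<?t. image_mset \<psi> (mset_set (A s))) - p))
      = (\<Sum>Y\<in>Pi\<^sub>E {..<?t} D. (\<Prod>s<?t. v s (Y s)) * K Y)" .
  have "\<bar>\<dots>\<bar> \<le> real (k ^ k) ^ card {..<?t} * r"
  proof (rule multilinear_bound_from_indicators)
    fix s X assume s: "s \<in> {..<?t}" and X: "X \<in> D s"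
    let ?Y = "{y. y \<in> {y \<in> A s \<rightarrow>\<^sub>E ?V. inj_on y (A s)} \<and> y ` A s = X}"
    have w01: "0 \<le> w s y" "w s y \<le> 1" for y using u[of s y] s by (auto simp: w_def)
    have "v s X \<le> real (card ?Y)"
      unfolding v_def using sum_bounded_above[of ?Y "w s" 1] w01 by simp
    also have "card ?Y \<le> card (A s \<rightarrow>\<^sub>E X)"
      using cA[of s] s X V by (intro card_mono finite_PiE) (auto simp: D_def intro: finite_subset)
    also have "\<dots> = (ks ! s) ^ (ks ! s)" using cA[of s] s X by (simp add: card_PiE D_def)
    also have "\<dots> \<le> k ^ k" using cA[of s] s k power_mono[of "ks ! s" k "ks ! s"]
        power_increasing[of "ks ! s" k k] by (auto intro: order_trans)
    finally show "0 \<le> v s X \<and> v s X \<le> real (k ^ k)"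
      unfolding v_def using w01 by (auto intro!: sum_nonneg)
  next
    fix S assume S: "\<And>s. s \<in> {..<?t} \<Longrightarrow> S s \<subseteq> D s"
    then have "(\<Sum>Y\<in>Pi\<^sub>E {..<?t} S. K Y) = real (expand_count H (map S [0..<?t]))
        - p * (\<Prod>X\<leftarrow>map S [0..<?t]. real (card X))"
      unfolding K_def by (intro expand_count_deviation[symmetric, OF V, where ks
          = ks]) (auto simp: D_def)
    also have "\<bar>\<dots>\<bar> \<le> r"
      using S by (intro dev) (auto simp: list_all2_conv_all_nth D_def)
    finally show "\<bar>\<Sum>Y\<in>Pi\<^sub>E {..<?t} S. K Y\<bar> \<le> r" .
  qed (use fD in auto)
  then show ?thesis unfolding eq by simp
qed

lemma mset_set_disjoint_family:
  assumes "finite T" "disjoint_family_on A T" "\<And>s. s \<in> T \<Longrightarrow> finite (A s)"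
  shows "mset_set (\<Union>s\<in>T. A s) = (\<Sum>s\<in>T. mset_set (A s))"
  using assms
proof (induction T rule: finite_induct)
  case (insert a T)
  have "A a \<inter> (\<Union>s\<in>T. A s) = {}"
    using insert.prems(1) insert.hyps by (auto simp: disjoint_family_on_def)
  then show ?case
    using insert by (simp add: mset_set_Union disjoint_family_on_def)
qed simp

lemma image_mset_sum: "image_mset f (\<Sum>s\<in>T. M s) = (\<Sum>s\<in>T. image_mset f (M s))"
  by (induction T rule: infinite_finite_induct) auto

text \<open>Replacing the last edge \<open>e0\<close> by the constant \<open>p\<close> changes the count little. Once the images
  of the vertices outside \<open>e0\<close> are fixed, every earlier edge depends on one block of \<open>e0\<close> only,
  so the remaining sum has the form handled by expansion.\<close>

lemma remove_edge_bound:
  fixes H :: "'v loop_hypergraph" and A :: "nat \<Rightarrow> 'u set"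
  assumes V: "finite (verts H)" and I: "finite I" and E': "finite E'" and e0: "e0 \<subseteq> I"
    and sub: "\<And>e. e \<in> E' \<Longrightarrow> e \<subseteq> I"
    and A: "disjoint_family_on A {..<length ks}" and UA: "(\<Union>s<length ks. A s) = e0"
    and cA: "\<And>s. s < length ks \<Longrightarrow> card (A s) = ks ! s \<and> ks ! s \<le> k" and k: "1 \<le> k"
    and lin: "\<And>e. e \<in> E' \<Longrightarrow> \<exists>s<length ks. e \<inter> e0 \<subseteq> A s"
    and p: "0 \<le> p" "p \<le> 1"
    and dev: "\<And>Ss. list_all2 (\<lambda>S m. S \<subseteq> {s. s \<subseteq> verts H \<and> card s = m}) Ss ks \<Longrightarrow>
        \<bar>real (expand_count H Ss) - p * (\<Prod>S\<leftarrow>Ss. real (card S))\<bar> \<le> r"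
  shows "\<bar>\<Sum>\<phi>\<in>I \<rightarrow>\<^sub>E verts H. (\<Prod>e\<in>E'. edge_ind H (image_mset \<phi> (mset_set e))) *
            (edge_ind H (image_mset \<phi> (mset_set e0)) - p)\<bar>
         \<le> real (k ^ k) ^ length ks * r * real (card (verts H)) ^ (card I - card e0)
           + real ((card I)\<^sup>2) * real (card (verts H)) ^ (card I - 1)"
proof -
  let ?t = "length ks" and ?V = "verts H"
  define X where "X \<phi> = (\<Prod>e\<in>E'. edge_ind H (image_mset \<phi> (mset_set e))) *
            (edge_ind H (image_mset \<phi> (mset_set e0)) - p)" for \<phi>
  define good :: "('u \<Rightarrow> 'v) \<Rightarrow> bool" where "good \<phi> \<longleftrightarrow> (\<forall>s<?t. inj_on \<phi> (A s))" for \<phi>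
  obtain \<sigma> where \<sigma>: "\<And>e. e \<in> E' \<Longrightarrow> \<sigma> e < ?t \<and> e \<inter> e0 \<subseteq> A (\<sigma> e)" using lin by metis
  have fe0: "finite e0" using e0 I finite_subset by auto
  have As: "A s \<subseteq> e0" "finite (A s)" if "s < ?t" for s
    using that UA fe0 by (auto intro: finite_subset[of _ e0])
  have fA: "finite (I \<rightarrow>\<^sub>E ?V)" using I V by (auto intro: finite_PiE)
  have X1: "\<bar>X \<phi>\<bar> \<le> 1" for \<phi>
  proof -
    have "\<bar>\<Prod>e\<in>E'. edge_ind H (image_mset \<phi> (mset_set e))\<bar> \<le> 1"
      unfolding abs_prod by (intro prod_le_1) (simp add: edge_ind_bounds)
    moreover have "\<bar>edge_ind H (image_mset \<phi> (mset_set e0)) - p\<bar> \<le> 1"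
      using p edge_ind_bounds[of H "image_mset \<phi> (mset_set e0)"] by auto
    ultimately show ?thesis unfolding X_def abs_mult by (intro mult_le_one) auto
  qed
  have bad: "\<bar>\<Sum>\<phi> | \<phi> \<in> I \<rightarrow>\<^sub>E ?V \<and> \<not> good \<phi>. X \<phi>\<bar> \<le> real ((card I)\<^sup>2)
      * real (card ?V) ^ (card I - 1)"
  proof -
    have "\<bar>\<Sum>\<phi> | \<phi> \<in> I \<rightarrow>\<^sub>E ?V \<and> \<not> good \<phi>. X \<phi>\<bar> \<le> (\<Sum>\<phi> | \<phi> \<in> I \<rightarrow>\<^sub>E ?V \<and> \<not> good \<phi>. 1)"
      using X1 by (intro order_trans[OF sum_abs] sum_mono) auto
    also have "\<dots> = real (card {\<phi> \<in> I \<rightarrow>\<^sub>E ?V. \<not> good \<phi>})" by simp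
    also have "\<dots> \<le> real (card {\<phi> \<in> I \<rightarrow>\<^sub>E ?V. \<not> inj_on \<phi> I})"
    proof (intro of_nat_mono card_mono)
      show "{\<phi> \<in> I \<rightarrow>\<^sub>E ?V. \<not> good \<phi>} \<subseteq> {\<phi> \<in> I \<rightarrow>\<^sub>E ?V. \<not> inj_on \<phi> I}"
        using As(1) e0 unfolding good_def by (blast intro: inj_on_subset)
    qed (use fA in auto)
    also have "\<dots> \<le> real ((card I)\<^sup>2 * card ?V ^ (card I - 1))"
      using card_not_inj_maps_le[OF I V] by (intro of_nat_mono)
    finally show ?thesis by simp
  qed
  have main: "\<bar>\<Sum>\<phi> | \<phi> \<in> I \<rightarrow>\<^sub>E ?V \<and> good \<phi>. X \<phi>\<bar>
      \<le> real (k ^ k) ^ length ks * r * real (card ?V) ^ (card I - card e0)"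
  proof -
    let ?m = "\<lambda>\<gamma> \<psi>. merge (I - e0) e0 (\<gamma>, \<psi>)"
    \<comment> \<open>\<open>\<gamma>\<close> is the restriction of a map to the vertices outside \<open>e0\<close>, \<open>\<psi>\<close> the one to \<open>e0\<close>\<close>
    have "(\<Sum>\<phi> | \<phi> \<in> I \<rightarrow>\<^sub>E ?V \<and> good \<phi>. X \<phi>) = (\<Sum>\<phi>\<in>I \<rightarrow>\<^sub>E ?V. of_bool (good \<phi>) * X \<phi>)"
      using fA by (simp add: sum.inter_filter of_bool_def if_distrib[of "\<lambda>c. c * _"] cong: if_cong)
    also have "\<dots> = (\<Sum>\<phi>\<in>((I - e0) \<union> e0) \<rightarrow>\<^sub>E ?V. of_bool (good \<phi>) * X \<phi>)"
      using e0 by (simp add: Un_absorb2)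
    also have "\<dots> = (\<Sum>\<gamma>\<in>(I - e0) \<rightarrow>\<^sub>E ?V. \<Sum>\<psi>\<in>e0 \<rightarrow>\<^sub>E ?V. of_bool (good (?m \<gamma> \<psi>)) * X (?m \<gamma> \<psi>))"
      by (rule sum_PiE_Un_disjoint) auto
    also have "\<bar>\<dots>\<bar> \<le> (\<Sum>\<gamma>\<in>(I - e0) \<rightarrow>\<^sub>E ?V. real (k ^ k) ^ length ks * r)"
    proof (rule order_trans[OF sum_abs sum_mono])
      fix \<gamma> assume "\<gamma> \<in> (I - e0) \<rightarrow>\<^sub>E ?V"
      define u where "u s y = (\<Prod>e | e \<in> E' \<and> \<sigma> e = s.
          edge_ind H (image_mset (merge (I - e0) (A s) (\<gamma>, y)) (mset_set e)))" for s y
      have "of_bool (good (?m \<gamma> \<psi>)) * X (?m \<gamma> \<psi>) =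
          (\<Prod>s<?t. of_bool (inj_on \<psi> (A s)) * u s (restrict \<psi> (A s))) *
            (edge_ind H (\<Sum>s<?t. image_mset \<psi> (mset_set (A s))) - p)" for \<psi>
      proof -
        have "inj_on (?m \<gamma> \<psi>) (A s) \<longleftrightarrow> inj_on \<psi> (A s)" if "s < ?t" for s
          using As[OF that] by (intro inj_on_cong) (auto simp: merge_def)
        then have 1: "of_bool (good (?m \<gamma> \<psi>)) = (\<Prod>s<?t. of_bool (inj_on \<psi> (A s)) :: real)"
          unfolding good_def by (auto simp: prod_zero_iff)
        have "(\<Prod>e\<in>E'. edge_ind H (image_mset (?m \<gamma> \<psi>) (mset_set e)))
            = (\<Prod>s<?t. \<Prod>e | e \<in> E' \<and> \<sigma> e = s. edge_ind H (image_mset (?m \<gamma> \<psi>) (mset_set e)))"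
          using \<sigma> E' by (intro prod.group[symmetric]) auto
        also have "\<dots> = (\<Prod>s<?t. u s (restrict \<psi> (A s)))"
          unfolding u_def
        proof (intro prod.cong refl arg_cong[of _ _ "edge_ind H"] image_mset_cong)
          fix s e v assume s: "s \<in> {..<?t}" and e: "e \<in> {e \<in> E'. \<sigma> e = s}" and "v \<in># mset_set e"
          then have v: "v \<in> e" using sub[of e] I by (cases "finite e") auto
          then show "?m \<gamma> \<psi> v = merge (I - e0) (A s) (\<gamma>, restrict \<psi> (A s)) v"
            using \<sigma>[of e] e sub[of e] As[of s] s by (auto simp: merge_def)
        qed
        finally have 2: "(\<Prod>e\<in>E'. edge_ind H (image_mset (?m \<gamma> \<psi>) (mset_set e)))
            = (\<Prod>s<?t. u s (restrict \<psi> (A s)))" .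
        have "mset_set e0 = (\<Sum>s<?t. mset_set (A s))"
          unfolding UA[symmetric] using As A
          by (intro mset_set_disjoint_family) auto
        then have "image_mset (?m \<gamma> \<psi>) (mset_set e0) = (\<Sum>s<?t. image_mset (?m \<gamma> \<psi>) (mset_set (A
            s)))"
          by (simp add: image_mset_sum)
        also have "\<dots> = (\<Sum>s<?t. image_mset \<psi> (mset_set (A s)))"
          using As by (intro sum.cong refl image_mset_cong) (auto simp: merge_def)
        finally show ?thesis unfolding X_def 1 2 by (simp add: prod.distrib)
      qed
      moreover have "\<bar>\<Sum>\<psi>\<in>(\<Union>s<length ks. A s) \<rightarrow>\<^sub>E ?V.
            (\<Prod>s<?t. of_bool (inj_on \<psi> (A s)) * u s (restrict \<psi> (A s))) *
            (edge_ind H (\<Sum>s<?t. image_mset \<psi> (mset_set (A s))) - p)\<bar>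
         \<le> real (k ^ k) ^ length ks * r"
      proof (rule block_deviation_bound[OF V A _ k _ dev])
        fix s y
        show "0 \<le> u s y \<and> u s y \<le> 1"
          unfolding u_def by (auto intro!: prod_nonneg prod_le_1 simp: edge_ind_bounds)
      qed (use cA As in auto)
      ultimately show "\<bar>\<Sum>\<psi>\<in>e0 \<rightarrow>\<^sub>E ?V. of_bool (good (?m \<gamma> \<psi>)) * X (?m \<gamma> \<psi>)\<bar>
          \<le> real (k ^ k) ^ length ks * r"
        unfolding UA by simp
    qed
    also have "\<dots> = real (k ^ k) ^ length ks * r * real (card ?V) ^ (card I - card e0)"
      using I e0 fe0 by (simp add: card_PiE card_Diff_subset)
    finally show ?thesis .
  qed
  have "(\<Sum>\<phi>\<in>I \<rightarrow>\<^sub>E ?V. X \<phi>) = (\<Sum>\<phi> | \<phi> \<in> I \<rightarrow>\<^sub>E ?V \<and> good \<phi>. X \<phi>) + (\<Sum>\<phi> | \<phi> \<in> I \<rightarrow>\<^sub>E ?V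
      \<and> \<not> good \<phi>. X \<phi>)"
    using fA by (subst sum.union_disjoint[symmetric]) (auto intro: sum.cong)
  then show ?thesis using main bad unfolding X_def by linarith
qed

lemma linear_hom_sum_bound:
  fixes H :: "'v loop_hypergraph" and F :: "'u hypergraph"
  assumes V: "finite (verts H)" and F: "uniform_hypergraph k F" "pi_linear ks F"
    and ks: "proper_partition k ks" and p: "0 \<le> p" "p \<le> 1"
    and dev: "\<And>Ss. list_all2 (\<lambda>S m. S \<subseteq> {s. s \<subseteq> verts H \<and> card s = m}) Ss ks \<Longrightarrow>
        \<bar>real (expand_count H Ss) - p * (\<Prod>S\<leftarrow>Ss. real (card S))\<bar> \<le> r"
  shows "\<bar>hom_sum (edge_ind H) F (verts H) - p ^ card (edges F)
      * real (card (verts H)) ^ card (verts F)\<bar>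
      \<le> real (card (edges F)) * (real (k ^ k) ^ length ks * r
          * real (card (verts H)) ^ (card (verts F) - k)
           + real ((card (verts F))\<^sup>2) * real (card (verts H)) ^ (card (verts F) - 1))"
proof -
  let ?I = "verts F" and ?V = "verts H" and ?t = "length ks"
  have I: "finite ?I" using F by (simp add: uniform_hypergraph_def)
  obtain es where es: "distinct es" "set es = edges F"
    and lin: "\<And>i. i < length es \<Longrightarrow> \<exists>A. disjoint_family_on A {..<?t} \<and> (\<Union>s<?t. A s) = es ! i \<and>
         (\<forall>s<?t. card (A s) = ks ! s) \<and> (\<forall>j<i. \<exists>s<?t. es ! j \<inter> es ! i \<subseteq> A s)"
    using F(2) unfolding pi_linear_def by blast
  have e: "e \<subseteq> ?I" "card e = k" if "e \<in> set es" for e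
    using F(1) that es by (auto simp: uniform_hypergraph_def)
  have ksk: "ks ! s \<le> k" if "s < ?t" for s
    using ks that member_le_sum_list[of "ks ! s" ks] by (auto simp: proper_partition_def)
  have k: "1 \<le> k"
  proof -
    have "0 < ?t" "\<forall>x\<in>set ks. x \<ge> 1" using ks by (auto simp: proper_partition_def)
    then have "1 \<le> ks ! 0" by (metis nth_mem)
    then show ?thesis using ksk[of 0] \<open>0 < ?t\<close> by linarith
  qed
  define B where "B = real (k ^ k) ^ ?t * r * real (card ?V) ^ (card ?I - k)
           + real ((card ?I)\<^sup>2) * real (card ?V) ^ (card ?I - 1)"
  define S where "S m = (\<Sum>\<phi>\<in>?I \<rightarrow>\<^sub>E ?V. \<Prod>e\<in>set (take m es). edge_ind H (image_mset \<phi> (mset_set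
      e)))" for m
  have "\<bar>S m - p ^ m * real (card ?V) ^ card ?I\<bar> \<le> real m * B" if "m \<le> length es" for m
    using that
  proof (induction m)
    case 0
    then show ?case using I by (simp add: S_def card_PiE)
  next
    case (Suc m)
    then have m: "m < length es" by simp
    obtain A where A: "disjoint_family_on A {..<?t}" "(\<Union>s<?t. A s) = es ! m"
        "\<And>s. s < ?t \<Longrightarrow> card (A s) = ks ! s" "\<And>j. j < m \<Longrightarrow> \<exists>s<?t. es ! j \<inter> es ! m \<subseteq> A s"
      using lin[OF m] by metis
    have em: "es ! m \<in> set es" using m by simp
    have "\<bar>\<Sum>\<phi>\<in>?I \<rightarrow>\<^sub>E ?V. (\<Prod>e\<in>set (take m es). edge_ind H (image_mset \<phi> (mset_set e))) *
            (edge_ind H (image_mset \<phi> (mset_set (es ! m))) - p)\<bar>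
         \<le> real (k ^ k) ^ ?t * r * real (card ?V) ^ (card ?I - card (es ! m))
           + real ((card ?I)\<^sup>2) * real (card ?V) ^ (card ?I - 1)"
    proof (rule remove_edge_bound[OF V I _ _ _ A(1,2) _ k _ p dev])
      show "e \<subseteq> ?I" if "e \<in> set (take m es)" for e
        using that e by (meson in_set_takeD)
      show "\<exists>s<?t. e \<inter> es ! m \<subseteq> A s" if "e \<in> set (take m es)" for e
        using that A(4) m by (auto simp: in_set_conv_nth)
    qed (use A(3) ksk e em in auto)
    also have "\<dots> = B" using e em by (simp add: B_def)
    also have "(\<Sum>\<phi>\<in>?I \<rightarrow>\<^sub>E ?V. (\<Prod>e\<in>set (take m es). edge_ind H (image_mset \<phi> (mset_set e))) *
            (edge_ind H (image_mset \<phi> (mset_set (es ! m))) - p)) = S (Suc m) - p * S m"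
    proof -
      have "es ! m \<notin> set (take m es)"
        using m es(1) by (auto simp: in_set_conv_nth nth_eq_iff_index_eq)
      then show ?thesis using m
        by (simp add: S_def take_Suc_conv_app_nth algebra_simps sum_subtractf sum_distrib_left)
    qed
    finally have 1: "\<bar>S (Suc m) - p * S m\<bar> \<le> B" .
    have "\<bar>p * S m - p * (p ^ m * real (card ?V) ^ card ?I)\<bar> \<le> 1 * (real m * B)"
      unfolding right_diff_distrib[symmetric] abs_mult using Suc p by (intro mult_mono) auto
    then show ?case using 1 by (simp add: algebra_simps)
  qed
  from this[of "length es"] show ?thesis
    using es distinct_card[OF es(1)] by (simp add: S_def hom_sum_def hom_weight_def B_def)
qed

section \<open>Powers of symmetric matrices\<close>

text \<open>Real matrices are functions of two indices, and \<open>D\<close> is the finite index set.\<close>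

fun mat_pow :: "('a \<Rightarrow> 'a \<Rightarrow> real) \<Rightarrow> 'a set \<Rightarrow> nat \<Rightarrow> 'a \<Rightarrow> 'a \<Rightarrow> real" where
  "mat_pow M D 0 x y = of_bool (x = y)"
| "mat_pow M D (Suc m) x y = (\<Sum>z\<in>D. mat_pow M D m x z * M z y)"

text \<open>The trace of the \<open>m\<close>th power of \<open>M\<close>.\<close>

definition mat_trace_pow :: "('a \<Rightarrow> 'a \<Rightarrow> real) \<Rightarrow> 'a set \<Rightarrow> nat \<Rightarrow> real" where
  "mat_trace_pow M D m = (\<Sum>x\<in>D. mat_pow M D m x x)"

lemma mat_pow_add:
  assumes "finite D" "y \<in> D"
  shows "mat_pow M D (a + b) x y = (\<Sum>z\<in>D. mat_pow M D a x z * mat_pow M D b z y)"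
  using assms(2)
proof (induction b arbitrary: y)
  case 0
  then show ?case using assms(1) by (simp add: of_bool_def if_distrib cong: if_cong)
next
  case (Suc b)
  have "mat_pow M D (a + Suc b) x y
      = (\<Sum>w\<in>D. (\<Sum>z\<in>D. mat_pow M D a x z * mat_pow M D b z w) * M w y)"
    using Suc.IH by simp
  also have "\<dots> = (\<Sum>z\<in>D. mat_pow M D a x z * mat_pow M D (Suc b) z y)"
    unfolding sum_distrib_right mat_pow.simps sum_distrib_left
    by (subst sum.swap) (simp add: mult.assoc)
  finally show ?case .
qed

lemma mat_pow_1:
  assumes "finite D" "x \<in> D"
  shows "mat_pow M D (Suc 0) x y = M x y"
  using assms by (simp add: of_bool_def if_distrib[of "\<lambda>c. c * _"] cong: if_cong)

lemma mat_pow_sym: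
  assumes "finite D" "\<And>x y. x \<in> D \<Longrightarrow> y \<in> D \<Longrightarrow> M x y = M y x" "x \<in> D" "y \<in> D"
  shows "mat_pow M D m x y = mat_pow M D m y x"
  using assms(3,4)
proof (induction m arbitrary: x y)
  case (Suc m)
  have "mat_pow M D (Suc m) x y = (\<Sum>z\<in>D. M y z * mat_pow M D m z x)"
    unfolding mat_pow.simps
  proof (intro sum.cong refl)
    fix z assume z: "z \<in> D"
    have "mat_pow M D m x z = mat_pow M D m z x" using Suc.IH[OF Suc.prems(1) z] .
    moreover have "M z y = M y z" using assms(2)[OF z Suc.prems(2)] .
    ultimately show "mat_pow M D m x z * M z y = M y z * mat_pow M D m z x" by simp
  qed
  also have "\<dots> = (\<Sum>z\<in>D. mat_pow M D (Suc 0) y z * mat_pow M D m z x)"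
    by (simp only: mat_pow_1[OF assms(1) Suc.prems(2)])
  also have "\<dots> = mat_pow M D (Suc 0 + m) y x"
    by (rule mat_pow_add[OF assms(1) Suc.prems(1), symmetric])
  finally show ?case by (simp only: add_Suc add_0)
qed auto

lemma mat_trace_pow_double:
  assumes "finite D" "\<And>x y. x \<in> D \<Longrightarrow> y \<in> D \<Longrightarrow> M x y = M y x"
  shows "mat_trace_pow M D (2 * m) = (\<Sum>x\<in>D. \<Sum>y\<in>D. (mat_pow M D m x y)\<^sup>2)"
proof -
  have "mat_pow M D (2 * m) x x = (\<Sum>y\<in>D. (mat_pow M D m x y)\<^sup>2)" if "x \<in> D" for x
    using mat_pow_add[OF assms(1) that, of M m m x] mat_pow_sym[OF assms that]
    by (simp add: mult_2 power2_eq_square)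
  then show ?thesis by (simp add: mat_trace_pow_def)
qed

text \<open>Submultiplicativity of the Frobenius norm.\<close>

lemma mat_trace_pow_submult:
  assumes "finite D" "\<And>x y. x \<in> D \<Longrightarrow> y \<in> D \<Longrightarrow> M x y = M y x" "m \<ge> 1"
  shows "mat_trace_pow M D (2 * m) \<le> (mat_trace_pow M D 2) ^ m"
proof -
  let ?N = "\<lambda>m. \<Sum>x\<in>D. \<Sum>y\<in>D. (mat_pow M D m x y)\<^sup>2"
  have N1: "?N 1 = (\<Sum>x\<in>D. \<Sum>y\<in>D. (M x y)\<^sup>2)"
    unfolding One_nat_def by (intro sum.cong refl) (simp only: mat_pow_1[OF assms(1)])
  have "?N m \<le> (?N 1) ^ m" using assms(3)
  proof (induction m rule: dec_induct)
    case (step m)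
    have "?N (Suc m) \<le> (\<Sum>x\<in>D. \<Sum>y\<in>D. (\<Sum>z\<in>D. (mat_pow M D m x z)\<^sup>2) * (\<Sum>z\<in>D. (M z y)\<^sup>2))"
      by (intro sum_mono) (simp add: Cauchy_Schwarz_ineq_sum)
    also have "\<dots> = ?N m * (\<Sum>y\<in>D. \<Sum>z\<in>D. (M z y)\<^sup>2)" by (simp add: sum_product)
    also have "\<dots> = ?N m * ?N 1" unfolding N1 by (subst (2) sum.swap) simp
    also have "\<dots> \<le> (?N 1) ^ m * ?N 1" using step by (intro mult_right_mono sum_nonneg) auto
    finally show ?case by (simp add: mult.commute)
  qed simp
  then show ?thesis
    using mat_trace_pow_double[OF assms(1,2), where m = m] mat_trace_pow_double[OF assms(1,2),
        where m = 1]
    by (simp only: mult_1_right)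
qed

text \<open>The numbers \<open>a j = \<parallel>M\<^sup>j v\<parallel>\<^sup>2\<close> are log-convex with \<open>a 0 = 1\<close>, hence \<open>a 1 ^ m \<le> a m\<close>;
  moreover \<open>\<langle>v, M v\<rangle>\<^sup>2 \<le> a 1\<close>, and \<open>a m\<close> is at most the squared Frobenius norm of the \<open>m\<close>th
  power.\<close>

lemma quadratic_form_pow_le_trace:
  assumes D: "finite D" and sym: "\<And>x y. x \<in> D \<Longrightarrow> y \<in> D \<Longrightarrow> M x y = M y x"
    and unit: "(\<Sum>x\<in>D. (v x)\<^sup>2) = 1"
  shows "(\<Sum>x\<in>D. \<Sum>y\<in>D. M x y * v x * v y) ^ (2 * m) \<le> mat_trace_pow M D (2 * m)"
proof -
  define w where "w j x = (\<Sum>y\<in>D. mat_pow M D j x y * v y)" for j x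
  define a where "a j = (\<Sum>x\<in>D. (w j x)\<^sup>2)" for j
  have w0: "w 0 x = v x" if "x \<in> D" for x
    using that D by (simp add: w_def of_bool_def if_distrib[of "\<lambda>c. c * _"] cong: if_cong)
  have wS: "w (Suc j) x = (\<Sum>z\<in>D. M x z * w j z)" if x: "x \<in> D" for j x
  proof -
    have "w (Suc j) x = (\<Sum>y\<in>D. (\<Sum>z\<in>D. M x z * mat_pow M D j z y) * v y)"
      unfolding w_def
    proof (intro sum.cong refl)
      fix y assume "y \<in> D"
      then have "mat_pow M D (Suc 0 + j) x y = (\<Sum>z\<in>D. M x z * mat_pow M D j z y)"
        unfolding mat_pow_add[OF D \<open>y \<in> D\<close>] by (simp only: mat_pow_1[OF D x])
      then show "mat_pow M D (Suc j) x y * v y = (\<Sum>z\<in>D. M x z * mat_pow M D j z y) * v y"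
        by (simp only: add_Suc add_0)
    qed
    also have "\<dots> = (\<Sum>z\<in>D. M x z * w j z)"
      unfolding w_def sum_distrib_right sum_distrib_left
      by (subst sum.swap) (simp add: mult.assoc)
    finally show ?thesis .
  qed
  have a0: "a 0 = 1" using unit w0 by (simp add: a_def)
  have a_nonneg: "0 \<le> a j" for j by (simp add: a_def sum_nonneg)
  have conv: "(a (Suc j))\<^sup>2 \<le> a j * a (Suc (Suc j))" for j
  proof -
    have "a (Suc j) = (\<Sum>x\<in>D. (\<Sum>z\<in>D. M x z * w j z) * w (Suc j) x)"
      unfolding a_def using wS by (intro sum.cong) (simp_all add: power2_eq_square)
    also have "\<dots> = (\<Sum>z\<in>D. w j z * (\<Sum>x\<in>D. M x z * w (Suc j) x))"
      unfolding sum_distrib_right sum_distrib_left by (subst sum.swap) (simp add: mult_ac)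
    also have "\<dots> = (\<Sum>z\<in>D. w j z * w (Suc (Suc j)) z)"
    proof (intro sum.cong refl arg_cong[of _ _ "(*) _"])
      fix z assume z: "z \<in> D"
      show "(\<Sum>x\<in>D. M x z * w (Suc j) x) = w (Suc (Suc j)) z"
        unfolding wS[OF z, of "Suc j"] using sym z by (intro sum.cong) auto
    qed
    finally show ?thesis unfolding a_def by (simp add: Cauchy_Schwarz_ineq_sum)
  qed
  have ratio: "a 1 * a j \<le> a (Suc j)" for j
  proof (induction j)
    case (Suc j)
    show ?case
    proof (cases "a (Suc j) = 0")
      case True
      then show ?thesis using a_nonneg by simp
    next
      case False
      then have pos: "a (Suc j) > 0" using a_nonneg[of "Suc j"] by linarith
      have "(a (Suc j))\<^sup>2 > 0" using pos by simp
      then have "a j > 0" using conv[of j] a_nonneg[of j] by (cases "a j = 0") auto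
      have "a j * (a 1 * a (Suc j)) = (a 1 * a j) * a (Suc j)" by simp
      also have "\<dots> \<le> a (Suc j) * a (Suc j)" using Suc pos by (intro mult_right_mono) auto
      also have "\<dots> \<le> a j * a (Suc (Suc j))" using conv[of j] by (simp add: power2_eq_square)
      finally show ?thesis using \<open>a j > 0\<close> by simp
    qed
  qed (simp add: a0)
  have pow: "(a 1) ^ m \<le> a m"
  proof (induction m)
    case (Suc m)
    have "a 1 ^ Suc m \<le> a 1 * a m" using Suc a_nonneg[of 1] by (simp add: mult_left_mono)
    then show ?case using ratio[of m] by linarith
  qed (simp add: a0)
  have q: "(\<Sum>x\<in>D. \<Sum>y\<in>D. M x y * v x * v y) = (\<Sum>x\<in>D. v x * w 1 x)"
    using wS[of _ 0] w0 by (intro sum.cong) (simp_all add: sum_distrib_left mult_ac)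
  have "(\<Sum>x\<in>D. \<Sum>y\<in>D. M x y * v x * v y)\<^sup>2 \<le> a 1"
    unfolding q using Cauchy_Schwarz_ineq_sum[of v "w 1" D] unit by (simp add: a_def)
  then have "(\<Sum>x\<in>D. \<Sum>y\<in>D. M x y * v x * v y) ^ (2 * m) \<le> (a 1) ^ m"
    unfolding power_mult by (intro power_mono) auto
  also note pow
  also have "a m \<le> (\<Sum>x\<in>D. (\<Sum>y\<in>D. (mat_pow M D m x y)\<^sup>2) * (\<Sum>y\<in>D. (v y)\<^sup>2))"
    unfolding a_def w_def by (intro sum_mono Cauchy_Schwarz_ineq_sum)
  also have "\<dots> = mat_trace_pow M D (2 * m)"
    using unit mat_trace_pow_double[OF D sym, where m = m] by simp
  finally show ?thesis .
qed

text \<open>A walk of length \<open>m\<close> is a map on the \<open>m + 1\<close> points \<open>{1..Suc m}\<close>.\<close>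

lemma sum_walks:
  assumes "finite D"
  shows "(\<Sum>X\<in>{1..Suc m} \<rightarrow>\<^sub>E D. (\<Prod>i\<in>{1..m}. M (X i) (X (Suc i))) * h (X 1) (X (Suc m)))
       = (\<Sum>x\<in>D. \<Sum>y\<in>D. mat_pow M D m x y * h x y)"
proof (induction m arbitrary: h)
  case 0
  have "(\<Sum>X\<in>{1..Suc 0} \<rightarrow>\<^sub>E D. h (X 1) (X 1)) = (\<Sum>x\<in>D. h x x)"
    using sum_PiE_insert[of "Suc 0" "{}" "\<lambda>X. h (X 1) (X 1)" "\<lambda>_. D"] by simp
  also have "\<dots> = (\<Sum>x\<in>D. \<Sum>y\<in>D. of_bool (x = y) * h x y)"
    using assms by (intro sum.cong) (simp_all add: of_bool_def if_distrib[of "\<lambda>c. c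
        * _"] cong: if_cong)
  finally show ?case by simp
next
  case (Suc m)
  have ins: "{1..Suc (Suc m)} = insert (Suc (Suc m)) {1..Suc m}" by auto
  have "(\<Sum>X\<in>{1..Suc (Suc m)} \<rightarrow>\<^sub>E D.
          (\<Prod>i\<in>{1..Suc m}. M (X i) (X (Suc i))) * h (X 1) (X (Suc (Suc m))))
      = (\<Sum>z\<in>D. \<Sum>X\<in>{1..Suc m} \<rightarrow>\<^sub>E D.
          (\<Prod>i\<in>{1..m}. M (X i) (X (Suc i))) * (M (X (Suc m)) z * h (X 1) z))"
    unfolding ins by (subst sum_PiE_insert) (auto intro!: sum.cong prod.cong)
  also have "\<dots> = (\<Sum>X\<in>{1..Suc m} \<rightarrow>\<^sub>E D.
          (\<Prod>i\<in>{1..m}. M (X i) (X (Suc i))) * (\<Sum>z\<in>D. M (X (Suc m)) z * h (X 1) z))"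
    by (subst sum.swap) (simp add: sum_distrib_left)
  also have "\<dots> = (\<Sum>x\<in>D. \<Sum>y\<in>D. mat_pow M D m x y * (\<Sum>z\<in>D. M y z * h x z))"
    by (rule Suc.IH)
  also have "\<dots> = (\<Sum>x\<in>D. \<Sum>z\<in>D. mat_pow M D (Suc m) x z * h x z)"
    unfolding mat_pow.simps sum_distrib_left sum_distrib_right
    by (rule sum.cong[OF refl], subst sum.swap) (simp add: mult.assoc)
  finally show ?case .
qed

text \<open>The successor in the cyclic order of \<open>{1..r}\<close>.\<close>

definition cyc_next :: "nat \<Rightarrow> nat \<Rightarrow> nat" where
  "cyc_next r i = (if i = r then 1 else Suc i)"

lemma sum_closed_walks:
  assumes "finite D" "r \<ge> 1"
  shows "(\<Sum>X\<in>{1..r} \<rightarrow>\<^sub>E D. \<Prod>i\<in>{1..r}. M (X i) (X (cyc_next r i))) = mat_trace_pow M D r"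
proof -
  obtain m where r: "r = Suc m" using assms(2) by (cases r) auto
  have "(\<Prod>i\<in>{1..r}. M (X i) (X (cyc_next r i)))
      = (\<Prod>i\<in>{1..m}. M (X i) (X (Suc i))) * M (X (Suc m)) (X 1)" for X
  proof -
    have "{1..r} = insert (Suc m) {1..m}" using r by auto
    then show ?thesis using r by (auto simp: cyc_next_def intro!: prod.cong)
  qed
  then have "(\<Sum>X\<in>{1..r} \<rightarrow>\<^sub>E D. \<Prod>i\<in>{1..r}. M (X i) (X (cyc_next r i)))
     = (\<Sum>X\<in>{1..Suc m} \<rightarrow>\<^sub>E D. (\<Prod>i\<in>{1..m}. M (X i) (X (Suc i))) * M (X (Suc m)) (X 1))"
    using r by simp
  also have "\<dots> = (\<Sum>x\<in>D. \<Sum>y\<in>D. mat_pow M D m x y * M y x)"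
    by (rule sum_walks[OF assms(1), where h = "\<lambda>x y. M y x"])
  also have "\<dots> = mat_trace_pow M D r" by (simp add: mat_trace_pow_def r)
  finally show ?thesis .
qed

section \<open>Blocks of vertices and tuples\<close>

lemma sum_PiE_bij:
  fixes K :: "('i \<Rightarrow> 'b) \<Rightarrow> real"
  assumes "finite T" "\<And>s. s \<in> T \<Longrightarrow> finite (B s)" "\<And>s. s \<in> T \<Longrightarrow> bij_betw (\<pi> s) (B s) (D s)"
  shows "(\<Sum>y\<in>Pi\<^sub>E T B. K (\<lambda>s\<in>T. \<pi> s (y s))) = (\<Sum>Y\<in>Pi\<^sub>E T D. K Y)"
proof -
  have "(\<Sum>y\<in>Pi\<^sub>E T B. K (\<lambda>s\<in>T. \<pi> s (y s)))
      = (\<Sum>y\<in>Pi\<^sub>E T B. (\<Prod>s\<in>T. 1) * K (\<lambda>s\<in>T. \<pi> s (y s)))" by simp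
  also have "\<dots> = (\<Sum>Y\<in>Pi\<^sub>E T D. (\<Prod>s\<in>T. \<Sum>x | x \<in> B s \<and> \<pi> s x = Y s. 1) * K Y)"
    by (rule sum_PiE_pushforward)
       (use assms in \<open>auto simp: bij_betw_finite[OF assms(3), symmetric] dest: bij_betwE\<close>)
  also have "\<dots> = (\<Sum>Y\<in>Pi\<^sub>E T D. K Y)"
  proof (rule sum.cong[OF refl])
    fix Y assume Y: "Y \<in> Pi\<^sub>E T D"
    have "(\<Sum>x | x \<in> B s \<and> \<pi> s x = Y s. 1) = (1::real)" if s: "s \<in> T" for s
    proof -
      have "Y s \<in> \<pi> s ` B s" using assms(3)[OF s] Y s by (auto simp: bij_betw_def)
      then obtain x where "x \<in> B s" "Y s = \<pi> s x" by auto
      then have "{x. x \<in> B s \<and> \<pi> s x = Y s} = {x}"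
        using assms(3)[OF s] by (auto simp: bij_betw_def inj_on_def)
      then show ?thesis by simp
    qed
    then show "(\<Prod>s\<in>T. \<Sum>x | x \<in> B s \<and> \<pi> s x = Y s. 1) * K Y = K Y" by simp
  qed
  finally show ?thesis .
qed

text \<open>The tuple of values of \<open>\<phi>\<close> on the points \<open>f 1, \<dots>, f m\<close>.\<close>

definition block :: "(nat \<Rightarrow> 'u) \<Rightarrow> nat \<Rightarrow> ('u \<Rightarrow> 'v) \<Rightarrow> 'v list" where
  "block f m \<phi> = map (\<lambda>z. \<phi> (f z)) [1..<m + 1]"

lemma block_cong: "(\<And>z. z \<in> {1..m} \<Longrightarrow> \<phi> (f z) = \<psi> (f' z)) \<Longrightarrow> block f m \<phi> = block f' m \<psi>"
  by (auto simp: block_def)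

lemma bij_betw_block:
  assumes "inj_on f {1..m}"
  shows "bij_betw (block f m) (f ` {1..m} \<rightarrow>\<^sub>E V) (tuples V m)"
proof (rule bij_betw_byWitness[where f' = "\<lambda>xs. \<lambda>u\<in>f ` {1..m}. xs ! (inv_into {1..m} f u - 1)"])
  show "\<forall>\<phi>\<in>f ` {1..m} \<rightarrow>\<^sub>E V. (\<lambda>u\<in>f ` {1..m}. block f m \<phi> ! (inv_into {1..m} f u - 1)) = \<phi>"
  proof
    fix \<phi> assume p: "\<phi> \<in> f ` {1..m} \<rightarrow>\<^sub>E V"
    show "(\<lambda>u\<in>f ` {1..m}. block f m \<phi> ! (inv_into {1..m} f u - 1)) = \<phi>"
    proof
      fix u
      show "(\<lambda>u\<in>f ` {1..m}. block f m \<phi> ! (inv_into {1..m} f u - 1)) u = \<phi> u"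
      proof (cases "u \<in> f ` {1..m}")
        case True
        then have 1: "inv_into {1..m} f u \<in> {1..m}" "f (inv_into {1..m} f u) = u"
          by (rule inv_into_into, rule f_inv_into_f)
        then have "block f m \<phi> ! (inv_into {1..m} f u - 1) = \<phi> (f (inv_into {1..m} f u))"
          unfolding block_def by (subst nth_map) (auto simp del: upt_Suc)
        then show ?thesis using True 1 by simp
      next
        case False
        then show ?thesis using p by (simp add: PiE_def extensional_def)
      qed
    qed
  qed
  show "\<forall>xs\<in>tuples V m. block f m (\<lambda>u\<in>f ` {1..m}. xs ! (inv_into {1..m} f u - 1)) = xs"
  proof
    fix xs assume "xs \<in> tuples V m"
    then have l: "length xs = m" by (simp add: tuples_def)
    show "block f m (\<lambda>u\<in>f ` {1..m}. xs ! (inv_into {1..m} f u - 1)) = xs"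
    proof (rule nth_equalityI)
      show "length (block f m (\<lambda>u\<in>f ` {1..m}. xs ! (inv_into {1..m} f u - 1))) = length xs"
        by (simp add: block_def l del: upt_Suc)
      fix i assume "i < length (block f m (\<lambda>u\<in>f ` {1..m}. xs ! (inv_into {1..m} f u - 1)))"
      then have "i < m" by (simp add: block_def del: upt_Suc)
      then show "block f m (\<lambda>u\<in>f ` {1..m}. xs ! (inv_into {1..m} f u - 1)) ! i = xs ! i"
        using assms by (simp add: block_def inv_into_f_f del: upt_Suc)
    qed
  qed
  show "block f m ` (f ` {1..m} \<rightarrow>\<^sub>E V) \<subseteq> tuples V m"
  proof (rule image_subsetI)
    fix \<phi> assume p: "\<phi> \<in> f ` {1..m} \<rightarrow>\<^sub>E V"
    have "\<phi> (f z) \<in> V" if "z \<in> {1..m}" for z using PiE_mem[OF p imageI[OF that]] .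
    then show "block f m \<phi> \<in> tuples V m" by (auto simp: block_def tuples_def simp del: upt_Suc)
  qed
  show "(\<lambda>xs. \<lambda>u\<in>f ` {1..m}. xs ! (inv_into {1..m} f u - 1)) ` tuples V m \<subseteq> f ` {1..m} \<rightarrow>\<^sub>E V"
  proof (intro image_subsetI restrict_PiE_iff[THEN iffD2] ballI)
    fix xs u assume xs: "xs \<in> tuples V m" and "u \<in> f ` {1..m}"
    then have "inv_into {1..m} f u \<in> {1..m}" by (intro inv_into_into)
    then have "inv_into {1..m} f u - 1 < length xs" using xs by (auto simp: tuples_def)
    then have "xs ! (inv_into {1..m} f u - 1) \<in> set xs" by (rule nth_mem)
    then show "xs ! (inv_into {1..m} f u - 1) \<in> V" using xs by (auto simp: tuples_def)
  qed
qed

lemma sum_blocks_eq_PiE_tuples: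
  fixes K :: "('i \<Rightarrow> 'v list) \<Rightarrow> real"
  assumes T: "finite T" and V: "finite V" and inj: "\<And>s. s \<in> T \<Longrightarrow> inj_on (f s) {1..m s}"
    and dis: "disjoint_family_on (\<lambda>s. f s ` {1..m s}) T"
  shows "(\<Sum>\<phi>\<in>(\<Union>s\<in>T. f s ` {1..m s}) \<rightarrow>\<^sub>E V. K (\<lambda>s\<in>T. block (f s) (m s) \<phi>))
       = (\<Sum>Y\<in>Pi\<^sub>E T (\<lambda>s. tuples V (m s)). K Y)"
proof -
  have "(\<lambda>s\<in>T. block (f s) (m s) \<phi>)
      = (\<lambda>s\<in>T. block (f s) (m s) ((\<lambda>s\<in>T. restrict \<phi> (f s ` {1..m s})) s))" for \<phi> :: "_ \<Rightarrow> 'v"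
    by (intro restrict_ext block_cong) auto
  then have "(\<Sum>\<phi>\<in>(\<Union>s\<in>T. f s ` {1..m s}) \<rightarrow>\<^sub>E V. K (\<lambda>s\<in>T. block (f s) (m s) \<phi>))
      = (\<Sum>y\<in>Pi\<^sub>E T (\<lambda>s. f s ` {1..m s} \<rightarrow>\<^sub>E V). K (\<lambda>s\<in>T. block (f s) (m s) (y s)))"
    unfolding sum_PiE_disjoint_blocks[OF dis, of "\<lambda>y. K (\<lambda>s\<in>T. block (f s) (m s) (y s))" V,
        symmetric]
    by (intro sum.cong refl arg_cong[of _ _ K])
  also have "\<dots> = (\<Sum>Y\<in>Pi\<^sub>E T (\<lambda>s. tuples V (m s)). K Y)"
    using T V inj by (intro sum_PiE_bij bij_betw_block) (auto intro!: finite_PiE)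
  finally show ?thesis .
qed

lemma finite_tuples: "finite V \<Longrightarrow> finite (tuples V m)"
  using finite_lists_length_eq[of V m] by (simp add: tuples_def)

lemma sum_prod_blocks:
  fixes h :: "'i \<Rightarrow> 'v list \<Rightarrow> real"
  assumes "finite T" "finite V" "\<And>s. s \<in> T \<Longrightarrow> inj_on (f s) {1..m s}"
    and "disjoint_family_on (\<lambda>s. f s ` {1..m s}) T"
  shows "(\<Sum>\<phi>\<in>(\<Union>s\<in>T. f s ` {1..m s}) \<rightarrow>\<^sub>E V. \<Prod>s\<in>T. h s (block (f s) (m s) \<phi>))
       = (\<Prod>s\<in>T. \<Sum>x\<in>tuples V (m s). h s x)"
proof -
  have "(\<Sum>\<phi>\<in>(\<Union>s\<in>T. f s ` {1..m s}) \<rightarrow>\<^sub>E V. \<Prod>s\<in>T. h s (block (f s) (m s) \<phi>))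
      = (\<Sum>\<phi>\<in>(\<Union>s\<in>T. f s ` {1..m s}) \<rightarrow>\<^sub>E V. \<Prod>s\<in>T. h s ((\<lambda>s\<in>T. block (f s) (m s) \<phi>) s))"
    by (intro sum.cong prod.cong) auto
  also have "\<dots> = (\<Sum>Y\<in>Pi\<^sub>E T (\<lambda>s. tuples V (m s)). \<Prod>s\<in>T. h s (Y s))"
    by (rule sum_blocks_eq_PiE_tuples[OF assms])
  also have "\<dots> = (\<Prod>s\<in>T. \<Sum>x\<in>tuples V (m s). h s x)"
    using assms by (subst prod_sum_PiE) (auto intro: finite_tuples)
  finally show ?thesis .
qed

section \<open>Partial steps and the Cauchy--Schwarz inequality\<close>

text \<open>The codes of length \<open>s\<close>.\<close>

definition codes :: "nat \<Rightarrow> bool list set" where "codes s = {a. length a = s}"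

lemma finite_codes: "finite (codes s)"
  unfolding codes_def using finite_lists_length_eq[of "UNIV :: bool set" s] by simp

lemma card_codes: "card (codes s) = 2 ^ s"
  unfolding codes_def using card_lists_length_eq[of "UNIV :: bool set" s] by simp

lemma codes_Suc: "codes (Suc s) = (\<lambda>a. a @ [False]) ` codes s \<union> (\<lambda>a. a @ [True]) ` codes s"
proof -
  have "a \<in> codes (Suc s) \<Longrightarrow> \<exists>b\<in>codes s. a = b @ [False] \<or> a = b @ [True]" for a
  proof -
    assume "a \<in> codes (Suc s)"
    then have "a = butlast a @ [last a]" "butlast a \<in> codes s" by (cases a; auto simp: codes_def)+
    then show "\<exists>b\<in>codes s. a = b @ [False] \<or> a = b @ [True]" by (cases "last a") metis+
  qed
  then show ?thesis by (auto simp: codes_def)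
qed

lemma prod_codes_Suc:
  "(\<Prod>a\<in>codes (Suc s). f a) = (\<Prod>a\<in>codes s. f (a @ [False])) * (\<Prod>a\<in>codes s. f (a @ [True]) :: real)"
  unfolding codes_Suc
  by (subst prod.union_disjoint) (auto simp: finite_codes prod.reindex inj_on_def)

text \<open>The hypergraph obtained from a single edge by \<open>s\<close> doublings: its edges have the codes of
  length \<open>s\<close>, and in the \<open>i\<close>th doubling the part of the vertices \<open>VB (i + 1)\<close> is shared by the
  two copies, while all other vertices are duplicated. The edge with code \<open>a\<close> can still be
  written as \<open>step_edge ks a\<close>, because removing a bit beyond the end of \<open>a\<close> leaves \<open>a\<close>
  unchanged. A step arises after \<open>length ks - 1\<close> doublings.\<close>

definition part_step :: "nat list \<Rightarrow> nat \<Rightarrow> step_vertex hypergraph" where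
  "part_step ks s = HGraph
     ({VA a z | a z. length a = s \<and> z \<in> {1..ks ! 0}} \<union>
      {VB j b z | j b z. j \<in> {2..length ks} \<and> length b = (if j \<le> s + 1 then s - 1 else s)
         \<and> z \<in> {1..ks ! (j - 1)}})
     (step_edge ks ` codes s)"

lemma VA_in_part_step [simp]:
  "VA a z \<in> verts (part_step ks s) \<longleftrightarrow> length a = s \<and> z \<in> {1..ks ! 0}"
  by (simp add: part_step_def)

lemma VB_in_part_step [simp]:
  "VB j b z \<in> verts (part_step ks s) \<longleftrightarrow>
     j \<in> {2..length ks} \<and> length b = (if j \<le> s + 1 then s - 1 else s) \<and> z \<in> {1..ks ! (j - 1)}"
  by (simp add: part_step_def)

lemma part_step_full:
  assumes "length ks \<ge> 2"
  shows "part_step ks (length ks - 1) = step ks"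
proof -
  have "verts (part_step ks (length ks - 1)) = verts (step ks)"
  proof (rule set_eqI)
    fix v show "v \<in> verts (part_step ks (length ks - 1)) \<longleftrightarrow> v \<in> verts (step ks)"
      using assms by (cases v) (auto simp: step_def numeral_2_eq_2)
  qed
  moreover have "edges (part_step ks (length ks - 1)) = edges (step ks)"
    by (simp add: part_step_def step_def codes_def)
  ultimately show ?thesis by (metis hgraph.collapse)
qed

text \<open>The embedding of a partial step as the copy with last bit \<open>c\<close> into the next one. It fixes
  the vertices of the part along which the copies are glued.\<close>

definition push :: "nat \<Rightarrow> bool \<Rightarrow> step_vertex \<Rightarrow> step_vertex" where
  "push s c v = (case v of VA a z \<Rightarrow> VA (a @ [c]) z
     | VB j b z \<Rightarrow> if j = s + 2 then v else VB j (b @ [c]) z)"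

lemma inj_push: "inj_on (push s c) X"
  unfolding inj_on_def push_def by (auto split: step_vertex.splits if_splits)

text \<open>The part along which the two copies are glued in the doubling number \<open>s + 1\<close>.\<close>

definition elim_verts :: "nat list \<Rightarrow> nat \<Rightarrow> step_vertex set" where
  "elim_verts ks s = (\<Union>b\<in>codes s. VB (s + 2) b ` {1..ks ! (s + 1)})"

lemma VA_in_elim_verts [simp]: "VA a z \<notin> elim_verts ks s"
  by (auto simp: elim_verts_def)

lemma VB_in_elim_verts [simp]:
  "VB j b z \<in> elim_verts ks s \<longleftrightarrow> j = s + 2 \<and> length b = s \<and> z \<in> {1..ks ! (s + 1)}"
  by (auto simp: elim_verts_def codes_def)

lemma finite_part_step: "finite (verts (part_step ks s))"
proof -
  have "verts (part_step ks s) \<subseteq> (\<lambda>(a, z). VA a z) ` (codes s \<times> {1..ks ! 0}) \<union>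
      (\<lambda>(j, b, z). VB j b z) ` (SIGMA j:{2..length ks}. (codes s \<union> codes (s - 1)) \<times> {1..ks ! (j -
          1)})"
    (is "_ \<subseteq> ?A \<union> ?B")
  proof
    fix v assume v: "v \<in> verts (part_step ks s)"
    show "v \<in> ?A \<union> ?B"
    proof (cases v)
      case (VA a z)
      then show ?thesis using v by (intro UnI1 image_eqI[of _ _ "(a, z)"]) (auto simp: codes_def)
    next
      case (VB j b z)
      then show ?thesis
        using v by (intro UnI2 image_eqI[of _ _ "(j, b, z)"]) (auto simp: codes_def split:
            if_splits)
    qed
  qed
  then show ?thesis by (rule finite_subset) (auto intro!: finite_codes)
qed

lemma elim_verts_subset: "s + 1 < length ks \<Longrightarrow> elim_verts ks s \<subseteq> verts (part_step ks s)"
proof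
  fix v assume "s + 1 < length ks" "v \<in> elim_verts ks s"
  then show "v \<in> verts (part_step ks s)" by (cases v) auto
qed

lemma push_elim_verts: "v \<in> elim_verts ks s \<Longrightarrow> push s c v = v"
  by (cases v) (auto simp: push_def)

lemma push_disjoint:
  "push s False ` (verts (part_step ks s) - elim_verts ks s)
     \<inter> push s True ` (verts (part_step ks s) - elim_verts ks s) = {}"
proof -
  have "push s False v \<noteq> push s True w" if "v \<in> verts (part_step ks s) - elim_verts ks s" for v w
    using that by (cases v; cases w) (auto simp: push_def)
  then show ?thesis by auto
qed

lemma push_verts:
  assumes "s + 1 < length ks"
  shows "push s False ` verts (part_step ks s) \<union> push s True ` verts (part_step ks s)
       = verts (part_step ks (Suc s))" (is "?L = ?R")
proof
  have "push s c v \<in> ?R" if "v \<in> verts (part_step ks s)" for v c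
    using that by (cases v) (auto simp: push_def)
  then show "?L \<subseteq> ?R" by auto
  have snoc: "\<exists>b c. a = b @ [c] \<and> length b = n" if "length a = Suc n" for a :: "bool list" and n
    using that by (cases a rule: rev_cases) auto
  show "?R \<subseteq> ?L"
  proof
    fix v assume "v \<in> ?R"
    then consider (A) a z where "v = VA a z" "length a = Suc s" "z \<in> {1..ks ! 0}"
      | (B) j b z where "v = VB j b z" "j \<in> {2..length ks}"
          "length b = (if j \<le> s + 2 then s else Suc s)" "z \<in> {1..ks ! (j - 1)}"
      by (cases v) auto
    then have "\<exists>c. v \<in> push s c ` verts (part_step ks s)"
    proof cases
      case A
      obtain b c where b: "a = b @ [c]" "length b = s" using snoc[OF A(2)] by auto
      then have "v = push s c (VA b z)" using A by (simp add: push_def)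
      moreover have "VA b z \<in> verts (part_step ks s)" using A b by simp
      ultimately show ?thesis by blast
    next
      case B
      show ?thesis
      proof (cases "j = s + 2")
        case True
        then have "v = push s False v" "v \<in> verts (part_step ks s)"
          using B by (auto simp: push_def)
        then show ?thesis by blast
      next
        case False
        define n where "n = (if j \<le> s + 1 then s - 1 else s)"
        have "length b = Suc n" using B False by (auto simp: n_def split: if_splits)
        from snoc[OF this] obtain b' c where b: "b = b' @ [c]" "length b' = n" by auto
        then have "v = push s c (VB j b' z)" using B False by (simp add: push_def)
        moreover have "VB j b' z \<in> verts (part_step ks s)"
          using B b by (simp add: n_def)
        ultimately show ?thesis by blast
      qed
    qed
    then show "v \<in> ?L" by (metis (full_types) UnI1 UnI2)
  qed
qed

lemma VA_in_step_edge [simp]: "VA b z \<in> step_edge ks a \<longleftrightarrow> b = a \<and> z \<in> {1..ks ! 0}"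
  by (auto simp: step_edge_def)

lemma VB_in_step_edge [simp]:
  "VB j b z \<in> step_edge ks a \<longleftrightarrow>
     j \<in> {2..length ks} \<and> b = remove_bit (j - 1) a \<and> z \<in> {1..ks ! (j - 1)}"
proof
  assume "j \<in> {2..length ks} \<and> b = remove_bit (j - 1) a \<and> z \<in> {1..ks ! (j - 1)}"
  then have "VB j b z = VB (j - 1 + 1) (remove_bit (j - 1) a) z" "j - 1 \<in> {1..length ks - 1}"
    "z \<in> {1..ks ! (j - 1)}" by auto
  then show "VB j b z \<in> step_edge ks a" unfolding step_edge_def by blast
qed (auto simp: step_edge_def)

lemma remove_bit_snoc:
  assumes "1 \<le> j"
  shows "remove_bit j (a @ [c]) = (if j = length a + 1 then a else remove_bit j a @ [c])"
  using assms by (cases "j \<le> length a") (auto simp: remove_bit_def)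

lemma step_edge_push:
  assumes "length a = s"
  shows "step_edge ks (a @ [c]) = push s c ` step_edge ks a" (is "?L = ?R")
proof
  have "push s c v \<in> ?L" if "v \<in> step_edge ks a" for v
    using that assms by (cases v) (auto simp: push_def remove_bit_snoc, auto simp: remove_bit_def)
  then show "?R \<subseteq> ?L" by auto
  show "?L \<subseteq> ?R"
  proof
    fix v assume v: "v \<in> ?L"
    show "v \<in> ?R"
    proof (cases v)
      case (VA b z)
      then show ?thesis using v by (intro image_eqI[of _ _ "VA a z"]) (auto simp: push_def)
    next
      case (VB j b z)
      then show ?thesis using v assms
        by (intro image_eqI[of _ _ "VB j (remove_bit (j - 1) a) z"])
           (auto simp: push_def remove_bit_snoc, auto simp: remove_bit_def)
    qed
  qed
qed

lemma step_edge_subset: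
  assumes "length a = s" "s < length ks"
  shows "step_edge ks a \<subseteq> verts (part_step ks s)"
proof
  fix v assume "v \<in> step_edge ks a"
  then show "v \<in> verts (part_step ks s)"
    using assms by (cases v) (auto simp: remove_bit_def)
qed

lemma finite_step_edge: "length a < length ks \<Longrightarrow> finite (step_edge ks a)"
  using finite_subset[OF step_edge_subset finite_part_step] by blast

lemma image_step_edge_snoc:
  assumes a: "length a = s" and s: "s < length ks"
  shows "image_mset \<phi> (mset_set (step_edge ks (a @ [c])))
       = image_mset (restrict (\<phi> \<circ> push s c) (verts (part_step ks s))) (mset_set (step_edge ks a))"
proof -
  have "image_mset \<phi> (mset_set (step_edge ks (a @ [c])))
      = image_mset (\<phi> \<circ> push s c) (mset_set (step_edge ks a))"
    unfolding step_edge_push[OF a]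
    by (subst image_mset_mset_set[OF inj_push, symmetric]) (simp add: multiset.map_comp)
  also have "\<dots> = image_mset (restrict (\<phi> \<circ> push s c) (verts (part_step ks s))) (mset_set
      (step_edge ks a))"
    using step_edge_subset[OF a s] finite_step_edge[of a ks] a s by (intro image_mset_cong) auto
  finally show ?thesis .
qed

text \<open>The contribution of the edge with code \<open>a\<close> to the weighted homomorphism sum of a partial
  step. The blocks of the parts \<open>0\<close> and \<open>j > s\<close>, which have not been used for a doubling, carry
  the test tensors \<open>w j\<close>.\<close>

definition edge_term ::
    "('v multiset \<Rightarrow> real) \<Rightarrow> nat list \<Rightarrow> (nat \<Rightarrow> 'v list \<Rightarrow> real) \<Rightarrow> nat \<Rightarrow> bool list \<Rightarrow>
      (step_vertex \<Rightarrow> 'v) \<Rightarrow> real" where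
  "edge_term g ks w s a \<phi> = g (image_mset \<phi> (mset_set (step_edge ks a)))
     * w 0 (block (VA a) (ks ! 0) \<phi>)
     * (\<Prod>j\<in>{s<..<length ks}. w j (block (VB (j + 1) a) (ks ! j) \<phi>))"

text \<open>The weighted homomorphism sum of a partial step.\<close>

definition part_sum ::
    "('v multiset \<Rightarrow> real) \<Rightarrow> nat list \<Rightarrow> (nat \<Rightarrow> 'v list \<Rightarrow> real) \<Rightarrow> 'v set \<Rightarrow> nat \<Rightarrow> real" where
  "part_sum g ks w V s = (\<Sum>\<phi>\<in>verts (part_step ks s) \<rightarrow>\<^sub>E V. \<Prod>a\<in>codes s. edge_term g ks w s a \<phi>)"

text \<open>With the sum over the part of index \<open>s + 1\<close> outermost, the Cauchy--Schwarz inequality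
  removes its unit tensor and doubles everything else.\<close>

lemma part_sum_Cauchy_Schwarz:
  fixes V :: "'v set"
  assumes V: "finite V" and s: "s + 1 < length ks"
    and unit: "(\<Sum>x\<in>tuples V (ks ! (s + 1)). (w (s + 1) x)\<^sup>2) = 1"
  shows "(part_sum g ks w V s)\<^sup>2 \<le> part_sum g ks w V (s + 1)"
proof -
  let ?I = "verts (part_step ks s)" and ?B = "elim_verts ks s" and ?t = "length ks"
  define rest where "rest a \<phi> = g (image_mset \<phi> (mset_set (step_edge ks a)))
     * w 0 (block (VA a) (ks ! 0) \<phi>)
     * (\<Prod>j\<in>{Suc s<..<?t}. w j (block (VB (j + 1) a) (ks ! j) \<phi>))" for a and \<phi> :: "step_vertex \<Rightarrow> 'v"
  define P where "P \<phi> = (\<Prod>a\<in>codes s. rest a \<phi>)" for \<phi> :: "step_vertex \<Rightarrow> 'v"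
  define u where "u \<beta> = (\<Prod>a\<in>codes s. w (s + 1) (block (VB (s + 2) a) (ks ! (s + 1)) \<beta>))"
    for \<beta> :: "step_vertex \<Rightarrow> 'v"
  have BI: "?B \<subseteq> ?I" using s by (rule elim_verts_subset)
  \<comment> \<open>\<open>u\<close> collects the tensors of part \<open>s + 1\<close>, and \<open>P\<close> all other factors\<close>
  have split: "edge_term g ks w s a \<phi> = w (s + 1) (block (VB (s + 2) a) (ks ! (s
      + 1)) \<phi>) * rest a \<phi>" for a \<phi>
  proof -
    have "{s<..<?t} = insert (s + 1) {Suc s<..<?t}" using s by auto
    then show ?thesis by (simp add: edge_term_def rest_def)
  qed
  have "part_sum g ks w V s = (\<Sum>\<phi>\<in>?I \<rightarrow>\<^sub>E V. u \<phi> * P \<phi>)"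
    by (simp add: part_sum_def split prod.distrib u_def P_def)
  also have "\<dots> = (\<Sum>\<phi>\<in>(?B \<union> (?I - ?B)) \<rightarrow>\<^sub>E V. u \<phi> * P \<phi>)"
    using BI by (simp add: Un_absorb1)
  also have "\<dots> = (\<Sum>\<beta>\<in>?B \<rightarrow>\<^sub>E V. \<Sum>\<psi>\<in>(?I - ?B) \<rightarrow>\<^sub>E V.
      u (merge ?B (?I - ?B) (\<beta>, \<psi>)) * P (merge ?B (?I - ?B) (\<beta>, \<psi>)))"
    by (rule sum_PiE_Un_disjoint) auto
  also have "\<dots> = (\<Sum>\<beta>\<in>?B \<rightarrow>\<^sub>E V. u \<beta> * (\<Sum>\<psi>\<in>(?I - ?B) \<rightarrow>\<^sub>E V. P (merge ?B (?I - ?B) (\<beta>, \<psi>))))"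
  proof -
    have "u (merge ?B (?I - ?B) (\<beta>, \<psi>)) = u \<beta>" for \<beta> \<psi>
      unfolding u_def
      by (intro prod.cong refl arg_cong[of _ _ "w _"] block_cong) (auto simp: merge_def codes_def)
    then show ?thesis by (simp add: sum_distrib_left)
  qed
  finally have "(part_sum g ks w V s)\<^sup>2 \<le> (\<Sum>\<beta>\<in>?B \<rightarrow>\<^sub>E V. (u \<beta>)\<^sup>2)
      * (\<Sum>\<beta>\<in>?B \<rightarrow>\<^sub>E V. (\<Sum>\<psi>\<in>(?I - ?B) \<rightarrow>\<^sub>E V. P (merge ?B (?I - ?B) (\<beta>, \<psi>)))\<^sup>2)"
    by (simp only: Cauchy_Schwarz_ineq_sum)
  also have "(\<Sum>\<beta>\<in>?B \<rightarrow>\<^sub>E V. (u \<beta>)\<^sup>2)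
      = (\<Sum>\<beta>\<in>?B \<rightarrow>\<^sub>E V. \<Prod>a\<in>codes s. (w (s + 1) (block (VB (s + 2) a) (ks ! (s + 1)) \<beta>))\<^sup>2)"
    by (simp add: u_def prod_power_distrib)
  also have "\<dots> = (\<Prod>a\<in>codes s. \<Sum>x\<in>tuples V (ks ! (s + 1)). (w (s + 1) x)\<^sup>2)"
    unfolding elim_verts_def
    by (rule sum_prod_blocks) (auto simp: finite_codes V inj_on_def disjoint_family_on_def)
  also have "\<dots> = 1" using unit by simp
  also have "(\<Sum>\<beta>\<in>?B \<rightarrow>\<^sub>E V. (\<Sum>\<psi>\<in>(?I - ?B) \<rightarrow>\<^sub>E V. P (merge ?B (?I - ?B) (\<beta>, \<psi>)))\<^sup>2)
      = (\<Sum>\<phi>\<in>(push s False ` ?I \<union> push s True ` ?I) \<rightarrow>\<^sub>E V.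
           P (restrict (\<phi> \<circ> push s False) ?I) * P (restrict (\<phi> \<circ> push s True) ?I))"
    unfolding power2_eq_square
    by (rule sum_glued_pair[symmetric]) (auto simp: BI inj_push push_elim_verts push_disjoint)
  also have "\<dots> = part_sum g ks w V (s + 1)"
  proof -
    have "edge_term g ks w (Suc s) (a @ [c]) \<phi> = rest a (restrict (\<phi> \<circ> push s c) ?I)"
      if a: "a \<in> codes s" for a c and \<phi> :: "step_vertex \<Rightarrow> 'v"
    proof -
      have la: "length a = s" using a by (simp add: codes_def)
      have "image_mset \<phi> (mset_set (step_edge ks (a @ [c])))
          = image_mset (restrict (\<phi> \<circ> push s c) ?I) (mset_set (step_edge ks a))"
        using s by (intro image_step_edge_snoc[OF la]) simp
      moreover have "block (VA (a @ [c])) (ks ! 0) \<phi> = block (VA a) (ks ! 0) (restrict (\<phi> \<circ> push s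
          c) ?I)"
        using la by (intro block_cong) (auto simp: push_def)
      moreover have "(\<Prod>j\<in>{Suc s<..<?t}. w j (block (VB (j + 1) (a @ [c])) (ks ! j) \<phi>))
          = (\<Prod>j\<in>{Suc s<..<?t}. w j (block (VB (j + 1) a) (ks ! j) (restrict (\<phi> \<circ> push s c) ?I)))"
        using la by (intro prod.cong refl arg_cong[of _ _ "w _"] block_cong) (auto simp: push_def)
      ultimately show ?thesis by (simp add: edge_term_def rest_def)
    qed
    then show ?thesis
      unfolding part_sum_def P_def push_verts[OF s] by (simp add: prod_codes_Suc)
  qed
  finally show ?thesis by simp
qed

section \<open>Tensor forms and the transfer matrix of a step\<close>

text \<open>The value at the tensors \<open>w 0, w 1, \<dots>\<close> of the multilinear form with the symmetric kernel
  \<open>g\<close>, regrouped along \<open>ks\<close>.\<close>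

definition tensor_form ::
    "('v multiset \<Rightarrow> real) \<Rightarrow> 'v set \<Rightarrow> nat list \<Rightarrow> (nat \<Rightarrow> 'v list \<Rightarrow> real) \<Rightarrow> real" where
  "tensor_form g V ks w = (\<Sum>Y\<in>Pi\<^sub>E {..<length ks} (\<lambda>j. tuples V (ks ! j)).
     (\<Prod>j<length ks. w j (Y j)) * g (\<Sum>j<length ks. mset (Y j)))"

lemma mset_block:
  assumes "inj_on f {1..m}"
  shows "mset (block f m \<phi>) = image_mset \<phi> (mset_set (f ` {1..m}))"
proof -
  have "{1..<Suc m} = {1..m}" by auto
  then show ?thesis
    unfolding image_mset_mset_set[OF assms, symmetric]
    by (simp add: block_def multiset.map_comp o_def del: upt_Suc)
qed

lemma part_sum_0:
  assumes V: "finite V" and t: "1 \<le> length ks"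
  shows "part_sum g ks w V 0 = tensor_form g V ks w"
proof -
  let ?t = "length ks"
  define f where "f j = (if j = 0 then VA [] else VB (j + 1) [])" for j
  have inj: "inj_on (f j) X" for j X by (auto simp: f_def inj_on_def)
  have dis: "disjoint_family_on (\<lambda>j. f j ` {1..ks ! j}) {..<?t}"
    by (auto simp: disjoint_family_on_def f_def)
  have mem: "v \<in> (\<Union>j<?t. f j ` {1..ks ! j}) \<longleftrightarrow> (\<exists>j z. v = f j z \<and> j < ?t \<and> z \<in> {1..ks ! j})" for v
    by blast
  have verts: "verts (part_step ks 0) = (\<Union>j<?t. f j ` {1..ks ! j})"
  proof (rule set_eqI)
    fix v show "v \<in> verts (part_step ks 0) \<longleftrightarrow> v \<in> (\<Union>j<?t. f j ` {1..ks ! j})"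
    proof (cases v)
      case (VA a z)
      then show ?thesis unfolding mem using t by (auto simp: f_def)
    next
      case (VB j b z)
      then show ?thesis unfolding mem
        by (auto simp: f_def intro!: exI[of _ "j - 1"])
    qed
  qed
  have edge: "step_edge ks [] = verts (part_step ks 0)"
  proof (rule set_eqI)
    fix v show "v \<in> step_edge ks [] \<longleftrightarrow> v \<in> verts (part_step ks 0)"
      by (cases v) (auto simp: remove_bit_def)
  qed
  have "edge_term g ks w 0 [] \<phi> = (\<Prod>j<?t. w j ((\<lambda>j\<in>{..<?t}. block (f j) (ks ! j) \<phi>) j))
      * g (\<Sum>j<?t. mset ((\<lambda>j\<in>{..<?t}. block (f j) (ks ! j) \<phi>) j))" for \<phi> :: "step_vertex \<Rightarrow> 'a"
  proof -
    have "image_mset \<phi> (mset_set (step_edge ks [])) = (\<Sum>j<?t. mset (block (f j) (ks ! j) \<phi>))"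
      unfolding edge verts mset_set_disjoint_family[OF finite_lessThan dis finite_imageI[OF
          finite_atLeastAtMost]]
        image_mset_sum mset_block[OF inj] ..
    moreover have "(\<Prod>j<?t. w j (block (f j) (ks ! j) \<phi>)) = w 0 (block (VA []) (ks ! 0) \<phi>)
        * (\<Prod>j\<in>{0<..<?t}. w j (block (VB (j + 1) []) (ks ! j) \<phi>))"
    proof -
      have "{..<?t} = insert 0 {0<..<?t}" using t by auto
      then show ?thesis by (simp add: f_def)
    qed
    ultimately show ?thesis by (simp add: edge_term_def)
  qed
  then have "part_sum g ks w V 0 = (\<Sum>\<phi>\<in>(\<Union>j<?t. f j ` {1..ks ! j}) \<rightarrow>\<^sub>E V.
      (\<lambda>Y. (\<Prod>j<?t. w j (Y j)) * g (\<Sum>j<?t. mset (Y j))) (\<lambda>j\<in>{..<?t}. block (f j) (ks ! j) \<phi>))"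
    by (simp add: part_sum_def verts codes_def)
  also have "\<dots> = tensor_form g V ks w"
    unfolding tensor_form_def by (rule sum_blocks_eq_PiE_tuples[OF _ V inj dis]) simp
  finally show ?thesis .
qed

text \<open>A partial step without doublings is a single edge, so \<open>s\<close> applications of the
  Cauchy--Schwarz inequality start from the tensor form itself.\<close>

lemma tensor_form_pow_le_part_sum:
  assumes V: "finite V" and s: "s < length ks"
    and unit: "\<And>j. j < length ks \<Longrightarrow> (\<Sum>x\<in>tuples V (ks ! j). (w j x)\<^sup>2) = 1"
  shows "\<bar>tensor_form g V ks w\<bar> ^ (2 ^ s) \<le> \<bar>part_sum g ks w V s\<bar>"
  using s
proof (induction s)
  case 0
  then have "1 \<le> length ks" by linarith
  then have "part_sum g ks w V 0 = tensor_form g V ks w" by (rule part_sum_0[OF V])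
  then show ?case by simp
next
  case (Suc s)
  have "\<bar>tensor_form g V ks w\<bar> ^ (2 ^ Suc s) = (\<bar>tensor_form g V ks w\<bar> ^ (2 ^ s))\<^sup>2"
    by (simp add: power_mult[symmetric] mult.commute)
  also have "\<dots> \<le> \<bar>part_sum g ks w V s\<bar>\<^sup>2" using Suc by (intro power_mono) auto
  also have "\<dots> \<le> part_sum g ks w V (s + 1)"
    unfolding power2_abs using Suc.prems unit by (intro part_sum_Cauchy_Schwarz V) auto
  finally show ?case by simp
qed

text \<open>The common index set of the two attach tuples of a step: a code without its last bit, and
  a position inside the block.\<close>

definition attach_index :: "nat list \<Rightarrow> (bool list \<times> nat) set" where
  "attach_index ks = codes (length ks - 2) \<times> {1..ks ! 0}"

text \<open>The values of \<open>\<phi>\<close> on the attach tuple with last bit \<open>c\<close>.\<close>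

definition attach_map :: "nat list \<Rightarrow> bool \<Rightarrow> (step_vertex \<Rightarrow> 'v) \<Rightarrow> bool list \<times> nat \<Rightarrow> 'v" where
  "attach_map ks c \<phi> = (\<lambda>(a, z)\<in>attach_index ks. \<phi> (VA (a @ [c]) z))"

text \<open>The matrix whose \<open>(X, Y)\<close> entry is the weighted number of maps of a step with values \<open>X\<close>
  and \<open>Y\<close> on its attach tuples.\<close>

definition step_matrix ::
    "('v multiset \<Rightarrow> real) \<Rightarrow> nat list \<Rightarrow> 'v set \<Rightarrow> (bool list \<times> nat \<Rightarrow> 'v) \<Rightarrow> (bool list \<times> nat \<Rightarrow> 'v) \<Rightarrow>
        real" where
  "step_matrix g ks V X Y = (\<Sum>\<phi> | \<phi> \<in> verts (step ks) \<rightarrow>\<^sub>E V \<and> attach_map ks False \<phi> = X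
     \<and> attach_map ks True \<phi> = Y. hom_weight g (step ks) \<phi>)"

lemma finite_attach_index: "finite (attach_index ks)"
  by (simp add: attach_index_def finite_codes)

lemma finite_step: "length ks \<ge> 2 \<Longrightarrow> finite (verts (step ks))"
  using finite_part_step[of ks "length ks - 1"] part_step_full[of ks] by metis

lemma VA_in_step: "length ks \<ge> 2 \<Longrightarrow>
    VA (a @ [c]) z \<in> verts (step ks) \<longleftrightarrow> (a, z) \<in> attach_index ks"
  by (auto simp: step_def attach_index_def codes_def)

lemma attach_map_PiE:
  assumes "length ks \<ge> 2" "\<phi> \<in> verts (step ks) \<rightarrow>\<^sub>E V"
  shows "attach_map ks c \<phi> \<in> attach_index ks \<rightarrow>\<^sub>E V"
  unfolding attach_map_def
proof (intro restrict_PiE_iff[THEN iffD2] ballI)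
  fix az assume "az \<in> attach_index ks"
  then show "(case az of (a, z) \<Rightarrow> \<phi> (VA (a @ [c]) z)) \<in> V"
    using PiE_mem[OF assms(2)] VA_in_step[OF assms(1)] by (cases az) auto
qed

lemma edges_step: "edges (step ks) = step_edge ks ` codes (length ks - 1)"
  by (simp add: step_def codes_def)

lemma inj_step_edge: "1 \<le> ks ! 0 \<Longrightarrow> inj_on (step_edge ks) X"
proof (rule inj_onI)
  fix a b assume k: "1 \<le> ks ! 0" and "step_edge ks a = step_edge ks b"
  then have "VA a 1 \<in> step_edge ks b" by (metis VA_in_step_edge atLeastAtMost_iff order_refl)
  then show "a = b" by simp
qed

lemma hom_weight_step:
  assumes "1 \<le> ks ! 0"
  shows "hom_weight g (step ks) \<phi>
       = (\<Prod>a\<in>codes (length ks - 1). g (image_mset \<phi> (mset_set (step_edge ks a))))"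
  unfolding hom_weight_def edges_step by (simp add: prod.reindex inj_step_edge[OF assms])

text \<open>A step consists of two copies of the preceding partial step, each of which contains one of
  the attach tuples. So the matrix is a Gram matrix.\<close>

lemma step_matrix_sym:
  assumes t: "length ks \<ge> 2" and k: "1 \<le> ks ! 0" and V: "finite V"
  shows "step_matrix g ks V X Y = step_matrix g ks V Y X"
proof -
  define s where "s = length ks - 2"
  have s: "s + 1 < length ks" "length ks - 1 = Suc s" using t by (auto simp: s_def)
  let ?I = "verts (part_step ks s)" and ?B = "elim_verts ks s"
  define P where "P X \<psi> = of_bool ((\<lambda>(a, z)\<in>attach_index ks. \<psi> (VA a z)) = X)
      * (\<Prod>a\<in>codes s. g (image_mset \<psi> (mset_set (step_edge ks a))))"
    for X and \<psi> :: "step_vertex \<Rightarrow> 'a"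
  let ?r = "\<lambda>\<phi> c. restrict (\<phi> \<circ> push s c) ?I"
  have J: "push s False ` ?I \<union> push s True ` ?I = verts (step ks)"
    using push_verts[OF s(1)] s(2) part_step_full[OF t] by simp
  have fin: "finite (verts (step ks) \<rightarrow>\<^sub>E V)" using V finite_step[OF t] by (intro finite_PiE) auto
  have at: "attach_map ks c \<phi> = (\<lambda>(a, z)\<in>attach_index ks. ?r \<phi> c (VA a z))" for c
      and \<phi> :: "step_vertex \<Rightarrow> 'a"
    unfolding attach_map_def
    by (intro restrict_ext) (auto simp: push_def attach_index_def codes_def s_def)
  have w: "hom_weight g (step ks) \<phi>
      = (\<Prod>a\<in>codes s. g (image_mset (?r \<phi> False) (mset_set (step_edge ks a))))
      * (\<Prod>a\<in>codes s. g (image_mset (?r \<phi> True) (mset_set (step_edge ks a))))"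
          for \<phi> :: "step_vertex \<Rightarrow> 'a"
  proof -
    have "image_mset \<phi> (mset_set (step_edge ks (a @ [c])))
        = image_mset (?r \<phi> c) (mset_set (step_edge ks a))" if a: "a \<in> codes s" for a c
      using a s by (intro image_step_edge_snoc) (simp_all add: codes_def)
    then show ?thesis unfolding hom_weight_step[OF k] s(2) by (simp add: prod_codes_Suc)
  qed
  have eq: "step_matrix g ks V X Y = (\<Sum>\<beta>\<in>?B \<rightarrow>\<^sub>E V.
      (\<Sum>\<psi>\<in>(?I - ?B) \<rightarrow>\<^sub>E V. P X (merge ?B (?I - ?B) (\<beta>, \<psi>)))
    * (\<Sum>\<psi>\<in>(?I - ?B) \<rightarrow>\<^sub>E V. P Y (merge ?B (?I - ?B) (\<beta>, \<psi>))))" for X Y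
  proof -
    have "step_matrix g ks V X Y = (\<Sum>\<phi>\<in>verts (step ks) \<rightarrow>\<^sub>E V.
        of_bool (attach_map ks False \<phi> = X \<and> attach_map ks True \<phi> = Y) * hom_weight g (step ks) \<phi>)"
      unfolding step_matrix_def using fin
      by (simp add: sum.inter_filter of_bool_def if_distrib[of "\<lambda>c. c * _"] cong: if_cong)
    also have "\<dots> = (\<Sum>\<phi>\<in>verts (step ks) \<rightarrow>\<^sub>E V. P X (?r \<phi> False) * P Y (?r \<phi> True))"
      unfolding w at P_def by (intro sum.cong refl) (simp add: of_bool_def)
    also have "\<dots> = (\<Sum>\<phi>\<in>(push s False ` ?I \<union> push s True ` ?I) \<rightarrow>\<^sub>E V. P X (?r \<phi> False)
        * P Y (?r \<phi> True))"
      by (simp only: J)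
    also have "\<dots> = (\<Sum>\<beta>\<in>?B \<rightarrow>\<^sub>E V.
      (\<Sum>\<psi>\<in>(?I - ?B) \<rightarrow>\<^sub>E V. P X (merge ?B (?I - ?B) (\<beta>, \<psi>)))
    * (\<Sum>\<psi>\<in>(?I - ?B) \<rightarrow>\<^sub>E V. P Y (merge ?B (?I - ?B) (\<beta>, \<psi>))))"
      by (rule sum_glued_pair) (auto simp: elim_verts_subset[OF s(1)] inj_push push_elim_verts
          push_disjoint)
    finally show ?thesis .
  qed
  show ?thesis unfolding eq by (simp add: mult.commute)
qed

lemma part_sum_eq_quadratic_form:
  assumes t: "length ks \<ge> 2" and k: "1 \<le> ks ! 0" and V: "finite V"
  shows "part_sum g ks w V (length ks - 1)
    = (\<Sum>X\<in>attach_index ks \<rightarrow>\<^sub>E V. \<Sum>Y\<in>attach_index ks \<rightarrow>\<^sub>E V. step_matrix g ks V X Y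
        * (\<Prod>a\<in>codes (length ks - 2). w 0 (block (Pair a) (ks ! 0) X))
        * (\<Prod>a\<in>codes (length ks - 2). w 0 (block (Pair a) (ks ! 0) Y)))"
proof -
  define s where "s = length ks - 2"
  have s: "length ks - 1 = Suc s" "length ks - 2 = s" using t by (auto simp: s_def)
  let ?D = "attach_index ks \<rightarrow>\<^sub>E V" and ?S = "verts (step ks) \<rightarrow>\<^sub>E V"
  define x where "x X = (\<Prod>a\<in>codes s. w 0 (block (Pair a) (ks ! 0) X))"
      for X :: "bool list \<times> nat \<Rightarrow> 'a"
  let ?at = "\<lambda>\<phi>. (attach_map ks False \<phi>, attach_map ks True \<phi>)"
  let ?h = "\<lambda>\<phi>. hom_weight g (step ks) \<phi> * x (attach_map ks False \<phi>) * x (attach_map ks True \<phi>)"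
  have fin: "finite ?S" "finite ?D"
    using V finite_step[OF t] finite_attach_index by (auto intro!: finite_PiE)
  have xa: "(\<Prod>a\<in>codes s. w 0 (block (VA (a @ [c])) (ks ! 0) \<phi>))
      = x (attach_map ks c \<phi>)" for c and \<phi> :: "step_vertex \<Rightarrow> 'a"
    unfolding x_def attach_map_def
    by (intro prod.cong refl arg_cong[of _ _ "w 0"] block_cong) (auto simp: attach_index_def s)
  have "part_sum g ks w V (length ks - 1) = (\<Sum>\<phi>\<in>?S. ?h \<phi>)"
    unfolding part_sum_def part_step_full[OF t]
  proof (rule sum.cong[OF refl])
    fix \<phi> :: "step_vertex \<Rightarrow> 'a"
    have "(\<Prod>a\<in>codes (length ks - 1). edge_term g ks w (length ks - 1) a \<phi>)
        = hom_weight g (step ks) \<phi> * (\<Prod>a\<in>codes (length ks - 1). w 0 (block (VA a) (ks ! 0) \<phi>))"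
      unfolding hom_weight_step[OF k] prod.distrib[symmetric]
    proof (rule prod.cong[OF refl])
      have "{length ks - 1<..<length ks} = {}" by auto
      then show "edge_term g ks w (length ks - 1) a \<phi> = g (image_mset \<phi> (mset_set (step_edge ks a)))
          * w 0 (block (VA a) (ks ! 0) \<phi>)" for a
        by (simp only: edge_term_def prod.empty mult_1_right)
    qed
    then show "(\<Prod>a\<in>codes (length ks - 1). edge_term g ks w (length ks - 1) a \<phi>) = ?h \<phi>"
      unfolding s(1) prod_codes_Suc xa by simp
  qed
  also have "\<dots> = (\<Sum>XY\<in>?D \<times> ?D. \<Sum>\<phi> | \<phi> \<in> ?S \<and> ?at \<phi> = XY. ?h \<phi>)"
    using fin attach_map_PiE[OF t, of _ V] by (intro sum.group[symmetric]) auto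
  also have "\<dots> = (\<Sum>X\<in>?D. \<Sum>Y\<in>?D. step_matrix g ks V X Y * x X * x Y)"
    unfolding sum.cartesian_product step_matrix_def
    by (intro sum.cong refl) (auto simp: sum_distrib_right intro!: sum.cong)
  finally show ?thesis by (simp add: x_def s)
qed

text \<open>The central inequality: \<open>length ks - 1\<close> applications of the Cauchy--Schwarz inequality
  turn the tensor form into a quadratic form of the transfer matrix at a unit vector, whose
  powers are bounded by traces.\<close>

lemma tensor_form_pow_le_trace:
  assumes t: "length ks \<ge> 2" and k: "1 \<le> ks ! 0" and V: "finite V"
    and unit: "\<And>j. j < length ks \<Longrightarrow> (\<Sum>x\<in>tuples V (ks ! j). (w j x)\<^sup>2) = 1"
  shows "\<bar>tensor_form g V ks w\<bar> ^ (2 ^ (length ks - 1) * (2 * m))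
       \<le> mat_trace_pow (step_matrix g ks V) (attach_index ks \<rightarrow>\<^sub>E V) (2 * m)"
proof -
  let ?D = "attach_index ks \<rightarrow>\<^sub>E V"
  let ?x = "\<lambda>X. \<Prod>a\<in>codes (length ks - 2). w 0 (block (Pair a) (ks ! 0) X)"
  have fin: "finite ?D" using V finite_attach_index by (auto intro!: finite_PiE)
  have A: "attach_index ks = (\<Union>a\<in>codes (length ks - 2). Pair a ` {1..ks ! 0})"
    by (auto simp: attach_index_def)
  have "(\<Sum>X\<in>?D. (?x X)\<^sup>2) = (\<Sum>X\<in>?D. \<Prod>a\<in>codes (length ks - 2). (w 0 (block (Pair a) (ks ! 0) X))\<^sup>2)"
    by (simp add: prod_power_distrib)
  also have "\<dots> = (\<Prod>a\<in>codes (length ks - 2). \<Sum>x\<in>tuples V (ks ! 0). (w 0 x)\<^sup>2)"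
    unfolding A by (rule sum_prod_blocks) (auto simp: finite_codes V inj_on_def
        disjoint_family_on_def)
  also have "\<dots> = 1"
  proof -
    have "0 < length ks" using t by linarith
    from unit[OF this] show ?thesis by simp
  qed
  finally have x: "(\<Sum>X\<in>?D. (?x X)\<^sup>2) = 1" .
  have "\<bar>tensor_form g V ks w\<bar> ^ (2 ^ (length ks - 1) * (2 * m))
      \<le> \<bar>part_sum g ks w V (length ks - 1)\<bar> ^ (2 * m)"
    unfolding power_mult[of _ "2 ^ _"] using t
    by (intro power_mono tensor_form_pow_le_part_sum V unit) auto
  also have "\<dots> = (part_sum g ks w V (length ks - 1)) ^ (2 * m)"
    by (simp add: power_even_abs)
  also have "\<dots> \<le> mat_trace_pow (step_matrix g ks V) ?D (2 * m)"
    unfolding part_sum_eq_quadratic_form[OF t k V]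
    by (rule quadratic_form_pow_le_trace[OF fin step_matrix_sym[OF t k V] x])
  finally show ?thesis .
qed

section \<open>Cycles as closed walks\<close>

lemma set_lex_codes: "set (lex_codes m) = codes m"
proof (induction m)
  case (Suc m)
  have "a \<in> codes (Suc m) \<longleftrightarrow> (\<exists>x b. a = x # b \<and> b \<in> codes m)" for a
    by (cases a) (auto simp: codes_def)
  then show ?case using Suc by (auto simp: image_iff) (metis (full_types))
qed (simp add: codes_def)

lemma filter_last_lex_codes:
  "filter (\<lambda>a. last a = u) (lex_codes (Suc m)) = map (\<lambda>a. a @ [u]) (lex_codes m)"
proof (induction m)
  case (Suc m)
  have "filter (\<lambda>a. last a = u) (map ((#) b) (lex_codes (Suc m)))
      = map ((#) b) (filter (\<lambda>a. last a = u) (lex_codes (Suc m)))" for b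
    unfolding filter_map o_def
    by (intro arg_cong[of _ _ "map _"] filter_cong refl) (auto simp: set_lex_codes codes_def simp
        del: lex_codes.simps)
  then show ?case unfolding lex_codes.simps(2)[of "Suc m"] filter_append Suc by simp
qed auto

text \<open>The common index set of the attach tuples in the order of their entries.\<close>

definition attach_list :: "nat list \<Rightarrow> (bool list \<times> nat) list" where
  "attach_list ks = List.product (lex_codes (length ks - 2)) [1..<ks ! 0 + 1]"

lemma set_attach_list: "set (attach_list ks) = attach_index ks"
  by (auto simp: attach_list_def attach_index_def set_lex_codes)

lemma attach_tuple_eq:
  assumes "length ks \<ge> 2"
  shows "attach_tuple ks u = map (\<lambda>(a, z). VA (a @ [u]) z) (attach_list ks)"
proof -
  have "length ks - 1 = Suc (length ks - 2)" using assms by simp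
  then show ?thesis
    unfolding attach_tuple_def attach_list_def product_concat_map map_concat
    by (simp add: filter_last_lex_codes o_def del: upt_Suc lex_codes.simps)
qed

lemma identify_map:
  assumes "inj_on f (set L)" "x \<in> set L"
  shows "identify (map f L) (map g L) (f x) = g x"
proof -
  have "map_of (zip (map f L) (map g L)) (f x) = Some (g x)"
    using assms
  proof (induction L)
    case (Cons y L)
    show ?case
    proof (cases "f x = f y")
      case True
      then have "x = y" using Cons.prems by (meson inj_onD list.set_intros(1))
      then show ?thesis by simp
    qed (use Cons in auto)
  qed simp
  then show ?thesis by (simp only: identify_def option.case)
qed

lemma identify_map_other:
  assumes "v \<notin> f ` set L"
  shows "identify (map f L) (map g L) v = v"
proof -
  have "map_of (zip (map f L) (map g L)) v = None"
    using assms by (induction L) auto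
  then show ?thesis by (simp only: identify_def option.case)
qed

text \<open>The composition of the identifications that form a cycle from \<open>r\<close> disjoint copies of a
  step.\<close>

definition cycle_quotient :: "nat list \<Rightarrow> nat \<Rightarrow> nat \<times> step_vertex \<Rightarrow> nat \<times> step_vertex" where
  "cycle_quotient ks r v = identify (copy_attach ks True r) (copy_attach ks False 1)
     (identify (concat (map (\<lambda>i. copy_attach ks False (i + 1)) [1..<r]))
               (concat (map (\<lambda>i. copy_attach ks True i) [1..<r])) v)"

context
  fixes ks :: "nat list" and r :: nat
  assumes t: "length ks \<ge> 2" and r: "r \<ge> 2"
begin

lemma copy_attach_eq: "copy_attach ks u i = map (\<lambda>(a, z). (i, VA (a @ [u]) z)) (attach_list ks)"
  by (simp add: copy_attach_def attach_tuple_eq[OF t] case_prod_beta)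

lemma inner_lists:
  "concat (map (\<lambda>i. copy_attach ks False (i + 1)) [1..<r])
     = map (\<lambda>(i, a, z). (i + 1, VA (a @ [False]) z)) (List.product [1..<r] (attach_list ks))"
  "concat (map (\<lambda>i. copy_attach ks True i) [1..<r])
     = map (\<lambda>(i, a, z). (i, VA (a @ [True]) z)) (List.product [1..<r] (attach_list ks))"
  unfolding product_concat_map map_concat copy_attach_eq
  by (simp_all add: o_def case_prod_beta')

lemma quotient_VB: "cycle_quotient ks r (i, VB j b z) = (i, VB j b z)"
proof -
  have "identify (map (\<lambda>(i, a, z). (i + 1, VA (a @ [False]) z)) (List.product [1..<r] (attach_list
      ks)))
      (map (\<lambda>(i, a, z). (i, VA (a @ [True]) z)) (List.product [1..<r] (attach_list ks))) (i, VB j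
          b z)
      = (i, VB j b z)"
    by (rule identify_map_other) auto
  moreover have "identify (copy_attach ks True r) (copy_attach ks False 1) (i, VB j b z)
      = (i, VB j b z)"
    unfolding copy_attach_eq by (rule identify_map_other) auto
  ultimately show ?thesis unfolding cycle_quotient_def inner_lists by simp
qed

lemma outer_identify:
  assumes "(a, z) \<in> attach_index ks"
  shows "identify (copy_attach ks True r) (copy_attach ks False 1) (i, VA (a @ [c]) z)
       = (if i = r \<and> c then (1, VA (a @ [False]) z) else (i, VA (a @ [c]) z))"
proof (cases "i = r \<and> c")
  case True
  have "identify (copy_attach ks True r) (copy_attach ks False 1)
      ((\<lambda>(a, z). (r, VA (a @ [True]) z)) (a, z)) = (\<lambda>(a, z). (1, VA (a @ [False]) z)) (a, z)"
    unfolding copy_attach_eq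
    by (rule identify_map) (use assms in \<open>auto simp: set_attach_list inj_on_def\<close>)
  then show ?thesis using True by simp
next
  case False
  then show ?thesis unfolding copy_attach_eq
    by (subst identify_map_other) auto
qed

lemma inner_identify:
  assumes "(a, z) \<in> attach_index ks" "i \<in> {1..r}"
  shows "identify (concat (map (\<lambda>i. copy_attach ks False (i + 1)) [1..<r]))
      (concat (map (\<lambda>i. copy_attach ks True i) [1..<r])) (i, VA (a @ [c]) z)
       = (if i \<noteq> 1 \<and> \<not> c then (i - 1, VA (a @ [True]) z) else (i, VA (a @ [c]) z))"
proof (cases "i \<noteq> 1 \<and> \<not> c")
  case True
  let ?f = "\<lambda>(i, a, z). (i + 1, VA (a @ [False]) z)" and ?g = "\<lambda>(i, a, z). (i, VA (a @ [True]) z)"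
  have "identify (map ?f (List.product [1..<r] (attach_list ks)))
      (map ?g (List.product [1..<r] (attach_list ks))) (?f (i - 1, a, z)) = ?g (i - 1, a, z)"
    by (rule identify_map) (use assms True in \<open>auto simp: set_attach_list inj_on_def\<close>)
  then show ?thesis unfolding inner_lists using True assms(2) by auto
next
  case False
  then show ?thesis unfolding inner_lists
    by (subst identify_map_other) auto
qed

lemma quotient_True:
  assumes "(a, z) \<in> attach_index ks" "i \<in> {1..r}"
  shows "cycle_quotient ks r (i, VA (a @ [True]) z)
       = (if i = r then (1, VA (a @ [False]) z) else (i, VA (a @ [True]) z))"
  unfolding cycle_quotient_def inner_identify[OF assms] using outer_identify[OF assms(1)] by simp

lemma quotient_False:
  assumes "(a, z) \<in> attach_index ks" "i \<in> {1..r}"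
  shows "cycle_quotient ks r (i, VA (a @ [False]) z)
       = (if i = 1 then (1, VA (a @ [False]) z) else (i - 1, VA (a @ [True]) z))"
  unfolding cycle_quotient_def inner_identify[OF assms] using outer_identify[OF assms(1)] assms(2)
  by auto

lemma cyc_next_in: "i \<in> {1..r} \<Longrightarrow> cyc_next r i \<in> {1..r}"
  using r by (auto simp: cyc_next_def)

lemma cyc_next_neq: "i \<in> {1..r} \<Longrightarrow> cyc_next r i \<noteq> i"
  using r by (auto simp: cyc_next_def)

lemma quotient_glue:
  assumes "(a, z) \<in> attach_index ks" "i \<in> {1..r}"
  shows "cycle_quotient ks r (cyc_next r i, VA (a @ [False]) z)
      = cycle_quotient ks r (i, VA (a @ [True]) z)"
  using quotient_True[OF assms] quotient_False[OF assms(1) cyc_next_in[OF assms(2)]] assms(2)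
  by (auto simp: cyc_next_def)

lemma step_vertex_cases:
  assumes "v \<in> verts (step ks)"
  obtains (A) a z c where "v = VA (a @ [c]) z" "(a, z) \<in> attach_index ks"
    | (B) j b z where "v = VB j b z"
proof (cases v)
  case (VA b z)
  then have "length b = Suc (length ks - 2)" using assms t by (auto simp: step_def)
  then obtain a c where b: "b = a @ [c]" by (cases b rule: rev_cases) auto
  then show ?thesis using A[of a c z] VA assms VA_in_step[OF t] by simp
qed (use B in blast)

text \<open>The only vertices that are identified are matching entries of the second attach tuple of a
  copy and the first attach tuple of the next copy.\<close>

lemma quotient_eqD:
  assumes "i \<in> {1..r}" "i' \<in> {1..r}" "v \<in> verts (step ks)" "v' \<in> verts (step ks)"
    and eq: "cycle_quotient ks r (i, v) = cycle_quotient ks r (i', v')"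
  shows "(i, v) = (i', v') \<or> (\<exists>a z. (a, z) \<in> attach_index ks \<and>
      (v = VA (a @ [True]) z \<and> v' = VA (a @ [False]) z \<and> i' = cyc_next r i \<or>
       v' = VA (a @ [True]) z \<and> v = VA (a @ [False]) z \<and> i = cyc_next r i'))"
  using assms(3)
proof (cases rule: step_vertex_cases)
  case A: (A a z c)
  show ?thesis
    using assms(4)
  proof (cases rule: step_vertex_cases)
    case A': (A a' z' c')
    \<comment> \<open>the copy and the last bit of the representative chosen by the quotient map\<close>
    define pos where "pos i c = (if c then if i = r then (1::nat, False) else (i, True)
        else if i = 1 then (1, False) else (i - 1, True))" for i c
    have q: "cycle_quotient ks r (i, VA (a @ [c]) z)
        = (case pos i c of (j, b) \<Rightarrow> (j, VA (a @ [b]) z))"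
      if "(a, z) \<in> attach_index ks" "i \<in> {1..r}" for i a z c
      using quotient_True[OF that] quotient_False[OF that] by (cases c) (simp_all add: pos_def)
    have "a = a'" "z = z'" "pos i c = pos i' c'"
      using eq unfolding A(1) A'(1) q[OF A(2) assms(1)] q[OF A'(2) assms(2)]
      by (simp_all add: case_prod_beta prod_eq_iff)
    then have "(i = i' \<and> c = c') \<or> (c \<and> \<not> c' \<and> i' = cyc_next r i) \<or> (c' \<and> \<not> c \<and> i = cyc_next r i')"
      using assms(1,2) r by (auto simp: pos_def cyc_next_def split: if_splits)
    then show ?thesis using A A' \<open>a = a'\<close> \<open>z = z'\<close> by (cases c; cases c') auto
  next
    case B: (B j b z')
    show ?thesis
      using eq quotient_True[OF A(2) assms(1)] quotient_False[OF A(2) assms(1)]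
      unfolding A(1) B quotient_VB by (cases c) (auto split: if_splits)
  qed
next
  case B: (B j b z)
  show ?thesis
    using assms(4)
  proof (cases rule: step_vertex_cases)
    case A: (A a z' c)
    show ?thesis
      using eq quotient_True[OF A(2) assms(2)] quotient_False[OF A(2) assms(2)]
      unfolding A(1) B quotient_VB by (cases c) (auto split: if_splits)
  next
    case B': (B j' b' z')
    then show ?thesis using eq B by (simp add: quotient_VB)
  qed
qed

lemma inj_on_quotient_copy:
  assumes "i \<in> {1..r}"
  shows "inj_on (cycle_quotient ks r) (Pair i ` verts (step ks))"
  using quotient_eqD[OF assms assms] cyc_next_neq[OF assms] by (force simp: inj_on_def)

text \<open>The image in the cycle of the edge with code \<open>a\<close> of the copy with index \<open>i\<close>.\<close>

definition cycle_edge :: "nat \<Rightarrow> bool list \<Rightarrow> (nat \<times> step_vertex) set" where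
  "cycle_edge i a = cycle_quotient ks r ` Pair i ` step_edge ks a"

lemma step_edge_subset_step: "a \<in> codes (length ks - 1) \<Longrightarrow> step_edge ks a \<subseteq> verts (step ks)"
  using step_edge_subset[of a "length ks - 1" ks] part_step_full[OF t] t by (simp add: codes_def)

lemma verts_cycle: "verts (step_cycle ks r) = cycle_quotient ks r ` ({1..r} \<times> verts (step ks))"
proof -
  have "(\<Union>i\<in>{1..r}. Pair i ` verts (step ks)) = {1..r} \<times> verts (step ks)" by auto
  then show ?thesis
    by (simp add: step_cycle_def step_path_def image_hypergraph_def copies_def image_image
        cycle_quotient_def)
qed

lemma edges_cycle: "edges (step_cycle ks r) = (\<lambda>(i, a). cycle_edge i a) ` ({1..r} \<times> codes (length
    ks - 1))"
proof -
  have "edges (step_cycle ks r) = (`) (cycle_quotient ks r) ` edges (copies ks r)"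
    by (simp add: step_cycle_def step_path_def image_hypergraph_def image_image cycle_quotient_def)
  also have "\<dots> = (\<lambda>(i, a). cycle_edge i a) ` ({1..r} \<times> codes (length ks - 1))"
    by (auto simp: copies_def edges_step cycle_edge_def image_UN image_image)
  finally show ?thesis .
qed

lemma VB_in_cycle_edge:
  "(i', VB j b z) \<in> cycle_edge i a \<longleftrightarrow> i' = i \<and> VB j b z \<in> step_edge ks a"
  if "i \<in> {1..r}" "a \<in> codes (length ks - 1)"
proof
  assume "(i', VB j b z) \<in> cycle_edge i a"
  then obtain v where v: "v \<in> step_edge ks a" "(i', VB j b z) = cycle_quotient ks r (i, v)"
    by (auto simp: cycle_edge_def)
  then have "v \<in> verts (step ks)" using step_edge_subset_step[OF that(2)] by auto
  then show "i' = i \<and> VB j b z \<in> step_edge ks a"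
  proof (cases rule: step_vertex_cases)
    case (A a z c)
    then show ?thesis
      using v quotient_True[OF A(2) that(1)] quotient_False[OF A(2) that(1)]
      by (cases c) (auto split: if_splits)
  next
    case (B j b z)
    then show ?thesis using v by (simp add: quotient_VB)
  qed
next
  assume "i' = i \<and> VB j b z \<in> step_edge ks a"
  then show "(i', VB j b z) \<in> cycle_edge i a"
    unfolding cycle_edge_def by (metis image_eqI quotient_VB)
qed

lemma VA_in_cycle_edge:
  assumes "i \<in> {1..r}" "i' \<in> {1..r}" "a \<in> codes (length ks - 1)" "(b, z) \<in> attach_index ks"
  shows "cycle_quotient ks r (i, VA (b @ [True]) z) \<in> cycle_edge i' a
    \<longleftrightarrow> (i' = i \<and> a = b @ [True]) \<or> (i' = cyc_next r i \<and> a = b @ [False])"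
proof
  assume "cycle_quotient ks r (i, VA (b @ [True]) z) \<in> cycle_edge i' a"
  then obtain v where v: "v \<in> step_edge ks a"
      "cycle_quotient ks r (i, VA (b @ [True]) z) = cycle_quotient ks r (i', v)"
    by (auto simp: cycle_edge_def)
  have "v \<in> verts (step ks)" using v step_edge_subset_step[OF assms(3)] by auto
  then show "(i' = i \<and> a = b @ [True]) \<or> (i' = cyc_next r i \<and> a = b @ [False])"
    using quotient_eqD[OF assms(1,2) _ _ v(2)] assms(4) VA_in_step[OF t] v(1) by auto
next
  have z: "z \<in> {1..ks ! 0}" using assms(4) by (auto simp: attach_index_def)
  assume "(i' = i \<and> a = b @ [True]) \<or> (i' = cyc_next r i \<and> a = b @ [False])"
  then show "cycle_quotient ks r (i, VA (b @ [True]) z) \<in> cycle_edge i' a"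
  proof
    assume "i' = i \<and> a = b @ [True]"
    then show ?thesis unfolding cycle_edge_def using z by auto
  next
    assume *: "i' = cyc_next r i \<and> a = b @ [False]"
    then have "VA (b @ [False]) z \<in> step_edge ks a" using z by auto
    then show ?thesis
      unfolding cycle_edge_def quotient_glue[OF assms(4,1), symmetric] using * by auto
  qed
qed

lemma inj_on_cycle_edge:
  assumes ks: "\<forall>x\<in>set ks. x \<ge> 1"
  shows "inj_on (\<lambda>(i, a). cycle_edge i a) ({1..r} \<times> codes (length ks - 1))"
proof (rule inj_onI)
  fix x y
  assume x: "x \<in> {1..r} \<times> codes (length ks - 1)" and y: "y \<in> {1..r} \<times> codes (length ks - 1)"
    and xy: "(case x of (i, a) \<Rightarrow> cycle_edge i a) = (case y of (i, a) \<Rightarrow> cycle_edge i a)"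
  obtain i a i' a' where [simp]: "x = (i, a)" "y = (i', a')" by (cases x, cases y) auto
  have i: "i \<in> {1..r}" and a: "a \<in> codes (length ks - 1)"
    and i': "i' \<in> {1..r}" and a': "a' \<in> codes (length ks - 1)"
    and eq: "cycle_edge i a = cycle_edge i' a'" using x y xy by auto
  have pos: "1 \<le> ks ! 0" "1 \<le> ks ! (length ks - 1)" using ks t nth_mem[of 0 ks] nth_mem[of "length
      ks - 1" ks] by fastforce+
  let ?b = "remove_bit (length ks - 1) a"
  have "VB (length ks) ?b 1 \<in> step_edge ks a" using t pos by simp
  then have "(i, VB (length ks) ?b 1) \<in> cycle_edge i' a'"
    using VB_in_cycle_edge[OF i a] eq by blast
  then have ii: "i' = i" using VB_in_cycle_edge[OF i' a'] by metis
  have "a = a'"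
  proof -
    have "VA a 1 \<in> step_edge ks a" using pos by simp
    then have "cycle_quotient ks r (i, VA a 1) \<in> cycle_edge i a"
      unfolding cycle_edge_def by (intro imageI)
    then have "cycle_quotient ks r (i, VA a 1) \<in> cycle_edge i a'" using eq ii by simp
    then obtain v where v: "v \<in> step_edge ks a'"
        "cycle_quotient ks r (i, VA a 1) = cycle_quotient ks r (i, v)"
      by (auto simp: cycle_edge_def)
    have "v \<in> verts (step ks)" "VA a 1 \<in> verts (step ks)"
      using v(1) \<open>VA a 1 \<in> step_edge ks a\<close> step_edge_subset_step[OF a] step_edge_subset_step[OF a']
      by blast+
    then have "v = VA a 1"
      using inj_on_quotient_copy[OF i] v(2) by (auto dest: inj_onD)
    then show ?thesis using v(1) by simp
  qed
  then show "x = y" using ii by simp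
qed

text \<open>A map of the cycle is a family of maps of the \<open>r\<close> steps that agree on the glued attach
  tuples, that is, a closed walk for the transfer matrix.\<close>

lemma hom_sum_cycle_eq_trace:
  assumes ks: "\<forall>x\<in>set ks. x \<ge> 1" and V: "finite V"
  shows "hom_sum g (step_cycle ks r) V
       = mat_trace_pow (step_matrix g ks V) (attach_index ks \<rightarrow>\<^sub>E V) r"
proof -
  let ?S = "verts (step ks)" and ?D = "attach_index ks \<rightarrow>\<^sub>E V"
  let ?X = "{1..r} \<times> ?S" and ?q = "cycle_quotient ks r"
  have k: "1 \<le> ks ! 0" using ks t by (cases ks) auto
  have finS: "finite (?S \<rightarrow>\<^sub>E V)" using V finite_step[OF t] by (intro finite_PiE) auto
  have finD: "finite ?D" using V finite_attach_index by (intro finite_PiE) auto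
  define W where "W \<phi> = (\<Prod>i\<in>{1..r}. hom_weight g (step ks) (\<lambda>v. \<phi> (i, v)))"
      for \<phi> :: "nat \<times> step_vertex \<Rightarrow> 'a"
  have wcong: "hom_weight g (step ks) \<phi> = hom_weight g (step ks) \<psi>"
    if "\<And>v. v \<in> ?S \<Longrightarrow> \<phi> v = \<psi> v" for \<phi> \<psi> :: "step_vertex \<Rightarrow> 'a"
    unfolding hom_weight_step[OF k]
  proof (intro prod.cong refl arg_cong[of _ _ g] image_mset_cong)
    fix a v assume a: "a \<in> codes (length ks - 1)" and "v \<in># mset_set (step_edge ks a)"
    then have "v \<in> step_edge ks a" by (metis elem_mset_set empty_iff infinite_set_mset_mset_set)
    then show "\<phi> v = \<psi> v" using that step_edge_subset_step[OF a] by auto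
  qed
  have weight: "hom_weight g (step_cycle ks r) \<Phi> = W (restrict (\<Phi> \<circ> ?q) ?X)"
      for \<Phi> :: "nat \<times> step_vertex \<Rightarrow> 'a"
  proof -
    have "hom_weight g (step_cycle ks r) \<Phi>
        = (\<Prod>(i, a)\<in>{1..r} \<times> codes (length ks - 1). g (image_mset \<Phi> (mset_set (cycle_edge i a))))"
      unfolding hom_weight_def edges_cycle
      by (subst prod.reindex[OF inj_on_cycle_edge[OF ks]]) (simp add: case_prod_beta o_def)
    also have "\<dots> = (\<Prod>i\<in>{1..r}. \<Prod>a\<in>codes (length ks - 1). g (image_mset \<Phi> (mset_set (cycle_edge i
        a))))"
      by (simp add: prod.cartesian_product)
    also have "\<dots> = (\<Prod>i\<in>{1..r}. hom_weight g (step ks) (\<lambda>v. (\<Phi> \<circ> ?q) (i, v)))"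
      unfolding hom_weight_step[OF k]
    proof (intro prod.cong refl arg_cong[of _ _ g])
      fix i a assume i: "i \<in> {1..r}" and a: "a \<in> codes (length ks - 1)"
      have "inj_on (\<lambda>v. ?q (i, v)) (step_edge ks a)"
        using inj_on_quotient_copy[OF i] step_edge_subset_step[OF a]
        by (auto simp: inj_on_def)
      then have "mset_set (cycle_edge i a) = image_mset (\<lambda>v. ?q (i, v)) (mset_set (step_edge ks a))"
        by (simp add: cycle_edge_def image_image image_mset_mset_set)
      then show "image_mset \<Phi> (mset_set (cycle_edge i a))
          = image_mset (\<lambda>v. (\<Phi> \<circ> ?q) (i, v)) (mset_set (step_edge ks a))"
        by (simp add: multiset.map_comp o_def)
    qed
    also have "\<dots> = W (restrict (\<Phi> \<circ> ?q) ?X)"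
      unfolding W_def by (intro prod.cong refl wcong) auto
    finally show ?thesis .
  qed
  let ?compat = "\<lambda>\<Psi>. \<forall>i\<in>{1..r}. attach_map ks True (\<Psi> i) = attach_map ks False (\<Psi> (cyc_next r i))"
  have resp: "(\<forall>u\<in>?X. \<forall>v\<in>?X. ?q u = ?q v \<longrightarrow> \<phi> u = \<phi> v) \<longleftrightarrow> ?compat (\<lambda>i v. \<phi> (i, v))"
    for \<phi> :: "nat \<times> step_vertex \<Rightarrow> 'a"
  proof
    assume L: "\<forall>u\<in>?X. \<forall>v\<in>?X. ?q u = ?q v \<longrightarrow> \<phi> u = \<phi> v"
    show "?compat (\<lambda>i v. \<phi> (i, v))"
    proof
      fix i assume i: "i \<in> {1..r}"
      have "\<phi> (i, VA (a @ [True]) z) = \<phi> (cyc_next r i, VA (a @ [False]) z)"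
        if az: "(a, z) \<in> attach_index ks" for a z
        using L[rule_format, of "(i, VA (a @ [True]) z)" "(cyc_next r i, VA (a @ [False]) z)"]
          quotient_glue[OF az i] i cyc_next_in[OF i] az VA_in_step[OF t] by auto
      then show "attach_map ks True (\<lambda>v. \<phi> (i, v)) = attach_map ks False (\<lambda>v. \<phi> (cyc_next r i, v))"
        by (auto simp: attach_map_def)
    qed
  next
    assume R: "?compat (\<lambda>i v. \<phi> (i, v))"
    have R': "\<phi> (i, VA (a @ [True]) z) = \<phi> (cyc_next r i, VA (a @ [False]) z)"
      if "i \<in> {1..r}" "(a, z) \<in> attach_index ks" for i a z
      using fun_cong[OF bspec[OF R that(1)], of "(a, z)"] that(2) by (simp add: attach_map_def)
    show "\<forall>u\<in>?X. \<forall>v\<in>?X. ?q u = ?q v \<longrightarrow> \<phi> u = \<phi> v"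
    proof (intro ballI impI)
      fix u v assume u: "u \<in> ?X" and v: "v \<in> ?X" and eq: "?q u = ?q v"
      obtain i x j y where uv: "u = (i, x)" "v = (j, y)" by (cases u, cases v) auto
      have "i \<in> {1..r}" "j \<in> {1..r}" "x \<in> ?S" "y \<in> ?S" using u v uv by auto
      from quotient_eqD[OF this] eq uv R' \<open>i \<in> _\<close> \<open>j \<in> _\<close>
      show "\<phi> u = \<phi> v" by auto
    qed
  qed
  have "hom_sum g (step_cycle ks r) V = (\<Sum>\<Phi>\<in>?q ` ?X \<rightarrow>\<^sub>E V. W (restrict (\<Phi> \<circ> ?q) ?X))"
    unfolding hom_sum_def verts_cycle weight ..
  also have "\<dots> = (\<Sum>\<phi> | \<phi> \<in> ?X \<rightarrow>\<^sub>E V \<and> ?compat (\<lambda>i v. \<phi> (i, v)). W \<phi>)"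
    unfolding sum_maps_on_image resp ..
  also have "\<dots> = (\<Sum>\<Psi> | \<Psi> \<in> {1..r} \<rightarrow>\<^sub>E (?S \<rightarrow>\<^sub>E V) \<and> ?compat \<Psi>. \<Prod>i\<in>{1..r}. hom_weight g (step ks) (\<Psi>
      i))"
  proof (rule sum.reindex_bij_witness
      [where i = "\<lambda>\<Psi>. \<lambda>(i, v)\<in>?X. \<Psi> i v" and j = "\<lambda>\<phi>. \<lambda>i\<in>{1..r}. \<lambda>v\<in>?S. \<phi> (i, v)"])
    have atc: "attach_map ks c (\<lambda>v\<in>?S. \<psi> v) = attach_map ks c \<psi>" for c and \<psi> :: "step_vertex \<Rightarrow> 'a"
      by (auto simp: attach_map_def VA_in_step[OF t] intro!: restrict_ext)
    fix \<phi> :: "nat \<times> step_vertex \<Rightarrow> 'a"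
    assume p: "\<phi> \<in> {\<phi>. \<phi> \<in> ?X \<rightarrow>\<^sub>E V \<and> ?compat (\<lambda>i v. \<phi> (i, v))}"
    then have pP: "\<phi> \<in> ?X \<rightarrow>\<^sub>E V" by simp
    show "(\<lambda>(i, v)\<in>?X. (\<lambda>i\<in>{1..r}. \<lambda>v\<in>?S. \<phi> (i, v)) i v) = \<phi>"
    proof
      fix iv
      show "(\<lambda>(i, v)\<in>?X. (\<lambda>i\<in>{1..r}. \<lambda>v\<in>?S. \<phi> (i, v)) i v) iv = \<phi> iv"
      proof (cases "iv \<in> ?X")
        case False
        then have "\<phi> iv = undefined" using pP by (metis PiE_arb)
        then show ?thesis using False by simp
      qed auto
    qed
    have "\<phi> (i, v) \<in> V" if "i \<in> {1..r}" "v \<in> ?S" for i v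
      using PiE_mem[OF pP, of "(i, v)"] that by simp
    moreover have "?compat (\<lambda>i\<in>{1..r}. \<lambda>v\<in>?S. \<phi> (i, v))"
      using p cyc_next_in by (auto simp: atc)
    ultimately show "(\<lambda>i\<in>{1..r}. \<lambda>v\<in>?S. \<phi> (i, v)) \<in> {\<Psi>. \<Psi> \<in> {1..r} \<rightarrow>\<^sub>E (?S \<rightarrow>\<^sub>E V) \<and> ?compat \<Psi>}"
      by auto
    show "(\<Prod>i\<in>{1..r}. hom_weight g (step ks) ((\<lambda>i\<in>{1..r}. \<lambda>v\<in>?S. \<phi> (i, v)) i)) = W \<phi>"
      unfolding W_def by (intro prod.cong refl wcong) auto
  next
    fix \<Psi> :: "nat \<Rightarrow> step_vertex \<Rightarrow> 'a"
    assume P: "\<Psi> \<in> {\<Psi>. \<Psi> \<in> {1..r} \<rightarrow>\<^sub>E (?S \<rightarrow>\<^sub>E V) \<and> ?compat \<Psi>}"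
    then have PP: "\<Psi> \<in> {1..r} \<rightarrow>\<^sub>E (?S \<rightarrow>\<^sub>E V)" by simp
    show "(\<lambda>i\<in>{1..r}. \<lambda>v\<in>?S. (\<lambda>(i, v)\<in>?X. \<Psi> i v) (i, v)) = \<Psi>"
    proof (intro ext)
      fix i v
      show "(\<lambda>i\<in>{1..r}. \<lambda>v\<in>?S. (\<lambda>(i, v)\<in>?X. \<Psi> i v) (i, v)) i v = \<Psi> i v"
      proof (cases "i \<in> {1..r}")
        case True
        then have "\<Psi> i \<in> ?S \<rightarrow>\<^sub>E V" using PP by auto
        then show ?thesis using True by (cases "v \<in> ?S") (auto simp: PiE_def extensional_def)
      next
        case False
        then have "\<Psi> i = undefined" using PP by (simp add: PiE_def extensional_def)
        moreover have "(\<lambda>i\<in>{1..r}. \<lambda>v\<in>?S. (\<lambda>(i, v)\<in>?X. \<Psi> i v) (i, v)) i = undefined"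
          by (simp only: restrict_def False if_False)
        ultimately show ?thesis by (simp only:)
      qed
    qed
    have mem: "\<Psi> i v \<in> V" if "i \<in> {1..r}" "v \<in> ?S" for i v
      using PiE_mem[OF PiE_mem[OF PP that(1)] that(2)] .
    have "attach_map ks c (\<lambda>v. (\<lambda>(i, v)\<in>?X. \<Psi> i v) (i, v)) = attach_map ks c (\<Psi> i)"
      if "i \<in> {1..r}" for c i
      using that by (auto simp: attach_map_def VA_in_step[OF t] intro!: restrict_ext)
    then have "?compat (\<lambda>i v. (\<lambda>(i, v)\<in>?X. \<Psi> i v) (i, v))"
      using P cyc_next_in by auto
    then show "(\<lambda>(i, v)\<in>?X. \<Psi> i v) \<in> {\<phi>. \<phi> \<in> ?X \<rightarrow>\<^sub>E V \<and> ?compat (\<lambda>i v. \<phi> (i, v))}"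
      using mem by auto
  qed
  also have "\<dots> = (\<Sum>X\<in>{1..r} \<rightarrow>\<^sub>E ?D. \<Sum>\<Psi> | \<Psi> \<in> {\<Psi>. \<Psi> \<in> {1..r} \<rightarrow>\<^sub>E (?S \<rightarrow>\<^sub>E V) \<and> ?compat \<Psi>} \<and>
      (\<lambda>i\<in>{1..r}. attach_map ks False (\<Psi> i)) = X. \<Prod>i\<in>{1..r}. hom_weight g (step ks) (\<Psi> i))"
  proof (rule sum.group[symmetric])
    show "finite {\<Psi>. \<Psi> \<in> {1..r} \<rightarrow>\<^sub>E (?S \<rightarrow>\<^sub>E V) \<and> ?compat \<Psi>}"
    proof (rule finite_subset)
      show "finite ({1..r} \<rightarrow>\<^sub>E (?S \<rightarrow>\<^sub>E V))" by (intro finite_PiE finite_atLeastAtMost finS)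
    qed auto
    show "finite ({1..r} \<rightarrow>\<^sub>E ?D)" by (intro finite_PiE finite_atLeastAtMost finD)
    show "(\<lambda>\<Psi>. \<lambda>i\<in>{1..r}. attach_map ks False (\<Psi> i)) ` {\<Psi>. \<Psi> \<in> {1..r} \<rightarrow>\<^sub>E (?S \<rightarrow>\<^sub>E V) \<and> ?compat \<Psi>}
        \<subseteq> {1..r} \<rightarrow>\<^sub>E ?D"
    proof (intro image_subsetI restrict_PiE_iff[THEN iffD2] ballI)
      fix \<Psi> i assume "\<Psi> \<in> {\<Psi>. \<Psi> \<in> {1..r} \<rightarrow>\<^sub>E (?S \<rightarrow>\<^sub>E V) \<and> ?compat \<Psi>}" "i \<in> {1..r}"
      then have "\<Psi> i \<in> ?S \<rightarrow>\<^sub>E V" by auto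
      then show "attach_map ks False (\<Psi> i) \<in> ?D" by (rule attach_map_PiE[OF t])
    qed
  qed
  also have "\<dots> = (\<Sum>X\<in>{1..r} \<rightarrow>\<^sub>E ?D. \<Prod>i\<in>{1..r}. step_matrix g ks V (X i) (X (cyc_next r i)))"
  proof (rule sum.cong[OF refl])
    fix X assume X: "X \<in> {1..r} \<rightarrow>\<^sub>E ?D"
    let ?F = "\<lambda>i. {\<phi>. \<phi> \<in> ?S \<rightarrow>\<^sub>E V \<and> attach_map ks False \<phi> = X i \<and> attach_map ks True \<phi>
        = X (cyc_next r i)}"
    have "{\<Psi>. \<Psi> \<in> {\<Psi>. \<Psi> \<in> {1..r} \<rightarrow>\<^sub>E (?S \<rightarrow>\<^sub>E V) \<and> ?compat \<Psi>} \<and>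
      (\<lambda>i\<in>{1..r}. attach_map ks False (\<Psi> i)) = X} = Pi\<^sub>E {1..r} ?F"
    proof (intro set_eqI iffI)
      fix \<Psi> assume P: "\<Psi> \<in> {\<Psi>. \<Psi> \<in> {\<Psi>. \<Psi> \<in> {1..r} \<rightarrow>\<^sub>E (?S \<rightarrow>\<^sub>E V) \<and> ?compat \<Psi>} \<and>
        (\<lambda>i\<in>{1..r}. attach_map ks False (\<Psi> i)) = X}"
      then have "X i = attach_map ks False (\<Psi> i)" if "i \<in> {1..r}" for i using that by auto
      then show "\<Psi> \<in> Pi\<^sub>E {1..r} ?F" using P cyc_next_in by (auto simp: PiE_iff)
    next
      fix \<Psi> assume P: "\<Psi> \<in> Pi\<^sub>E {1..r} ?F"
      then have "(\<lambda>i\<in>{1..r}. attach_map ks False (\<Psi> i)) = X"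
        using X by (intro PiE_ext[of _ "{1..r}" "\<lambda>_. UNIV" X]) (auto simp: PiE_iff)
      moreover have "?compat \<Psi>" using P cyc_next_in by (auto simp: PiE_iff)
      moreover have "\<Psi> \<in> {1..r} \<rightarrow>\<^sub>E (?S \<rightarrow>\<^sub>E V)" using P by (auto simp: PiE_iff)
      ultimately show "\<Psi> \<in> {\<Psi>. \<Psi> \<in> {\<Psi>. \<Psi> \<in> {1..r} \<rightarrow>\<^sub>E (?S \<rightarrow>\<^sub>E V) \<and> ?compat \<Psi>} \<and>
        (\<lambda>i\<in>{1..r}. attach_map ks False (\<Psi> i)) = X}" by simp
    qed
    moreover have "(\<Sum>\<Psi>\<in>Pi\<^sub>E {1..r} ?F. \<Prod>i\<in>{1..r}. hom_weight g (step ks) (\<Psi> i))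
        = (\<Prod>i\<in>{1..r}. step_matrix g ks V (X i) (X (cyc_next r i)))"
      unfolding step_matrix_def using finS by (subst prod_sum_PiE) auto
    ultimately show "(\<Sum>\<Psi> | \<Psi> \<in> {\<Psi>. \<Psi> \<in> {1..r} \<rightarrow>\<^sub>E (?S \<rightarrow>\<^sub>E V) \<and> ?compat \<Psi>} \<and>
      (\<lambda>i\<in>{1..r}. attach_map ks False (\<Psi> i)) = X. \<Prod>i\<in>{1..r}. hom_weight g (step ks) (\<Psi> i))
      = (\<Prod>i\<in>{1..r}. step_matrix g ks V (X i) (X (cyc_next r i)))" by simp
  qed
  also have "\<dots> = mat_trace_pow (step_matrix g ks V) ?D r"
    using r by (intro sum_closed_walks finD) simp
  finally show ?thesis .
qed

end

section \<open>Structure of the cycle\<close>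

text \<open>The block of the edge with code \<open>a\<close> in the part with index \<open>j\<close>, counting from 0.\<close>

definition step_block :: "nat list \<Rightarrow> bool list \<Rightarrow> nat \<Rightarrow> step_vertex set" where
  "step_block ks a j = (if j = 0 then VA a else VB (j + 1) (remove_bit j a)) ` {1..ks ! j}"

lemma step_edge_eq_blocks: "ks \<noteq> [] \<Longrightarrow> step_edge ks a = (\<Union>j<length ks. step_block ks a j)"
proof (rule set_eqI)
  fix v assume "ks \<noteq> []"
  show "v \<in> step_edge ks a \<longleftrightarrow> v \<in> (\<Union>j<length ks. step_block ks a j)"
  proof (cases v)
    case (VA b z)
    then show ?thesis using \<open>ks \<noteq> []\<close> by (auto simp: step_block_def split: if_splits)
  next
    case (VB j b z)
    have mem: "v \<in> step_block ks a i \<longleftrightarrow> 1 \<le> i \<and> j = i + 1 \<and> b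
        = remove_bit i a \<and> z \<in> {1..ks ! i}" for i
      using VB by (auto simp: step_block_def)
    have "v \<in> (\<Union>j<length ks. step_block ks a j) \<longleftrightarrow> (\<exists>i<length ks. v \<in> step_block ks a i)" by blast
    also have "\<dots> \<longleftrightarrow> j \<in> {2..length ks} \<and> b = remove_bit (j - 1) a \<and> z \<in> {1..ks ! (j - 1)}"
      unfolding mem
    proof
      assume "j \<in> {2..length ks} \<and> b = remove_bit (j - 1) a \<and> z \<in> {1..ks ! (j - 1)}"
      then show "\<exists>i<length ks. 1 \<le> i \<and> j = i + 1 \<and> b = remove_bit i a \<and> z \<in> {1..ks ! i}"
        by (intro exI[of _ "j - 1"]) auto
    qed auto
    also have "\<dots> \<longleftrightarrow> v \<in> step_edge ks a" using VB by simp
    finally show ?thesis by blast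
  qed
qed

lemma disjoint_step_blocks: "disjoint_family_on (step_block ks a) T"
  by (auto simp: disjoint_family_on_def step_block_def split: if_splits)

lemma card_step_block: "card (step_block ks a j) = ks ! j"
  by (auto simp: step_block_def card_image inj_on_def)

lemma finite_step_block: "finite (step_block ks a j)"
  by (auto simp: step_block_def)

lemma card_step_edge: "ks \<noteq> [] \<Longrightarrow> card (step_edge ks a) = sum_list ks"
  unfolding step_edge_eq_blocks
  by (subst card_UN_disjoint)
     (use disjoint_step_blocks[of ks a UNIV] in
       \<open>auto simp: finite_step_block card_step_block sum_list_sum_nth atLeast0LessThan
           disjoint_family_on_def\<close>)

lemma remove_bit_eq_iff:
  assumes "length a = m" "length a' = m" "1 \<le> j" "j \<le> m"
  shows "remove_bit j a = remove_bit j a' \<longleftrightarrow> (\<forall>x<m. x \<noteq> j - 1 \<longrightarrow> a ! x = a' ! x)"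
proof -
  have "remove_bit j a = remove_bit j a'
      \<longleftrightarrow> take (j - 1) a = take (j - 1) a' \<and> drop j a = drop j a'"
    unfolding remove_bit_def using assms by (intro append_eq_append_conv) auto
  also have "\<dots> \<longleftrightarrow> (\<forall>x<j - 1. a ! x = a' ! x) \<and> (\<forall>x. j + x < m \<longrightarrow> a ! (j + x) = a' ! (j + x))"
    using assms by (auto simp: list_eq_iff_nth_eq)
  also have "\<dots> \<longleftrightarrow> (\<forall>x<m. x \<noteq> j - 1 \<longrightarrow> a ! x = a' ! x)"
  proof (rule iffI)
    assume *: "(\<forall>x<j - 1. a ! x = a' ! x) \<and> (\<forall>x. j + x < m \<longrightarrow> a ! (j + x) = a' ! (j + x))"
    show "\<forall>x<m. x \<noteq> j - 1 \<longrightarrow> a ! x = a' ! x"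
    proof (intro allI impI)
      fix x assume x: "x < m" "x \<noteq> j - 1"
      show "a ! x = a' ! x"
      proof (cases "x < j - 1")
        case False
        then have "j + (x - j) = x" using x(2) by simp
        then show ?thesis using conjunct2[OF *, rule_format, of "x - j"] x(1) by simp
      qed (use * in auto)
    qed
  next
    assume *: "\<forall>x<m. x \<noteq> j - 1 \<longrightarrow> a ! x = a' ! x"
    show "(\<forall>x<j - 1. a ! x = a' ! x) \<and> (\<forall>x. j + x < m \<longrightarrow> a ! (j + x) = a' ! (j + x))"
    proof (intro conjI allI impI)
      fix x assume "x < j - 1"
      then show "a ! x = a' ! x" using *[rule_format, of x] assms(3,4) by auto
    next
      fix x assume "j + x < m"
      then show "a ! (j + x) = a' ! (j + x)" using *[rule_format, of "j + x"] assms(3) by auto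
    qed
  qed
  finally show ?thesis .
qed

text \<open>Two distinct codes agree after removing a bit for at most one position of this bit.\<close>

lemma remove_bit_inj_index:
  assumes "length a = m" "length a' = m" "a \<noteq> a'" "1 \<le> j" "j \<le> m" "1 \<le> j'" "j' \<le> m"
    and "remove_bit j a = remove_bit j a'" "remove_bit j' a = remove_bit j' a'"
  shows "j = j'"
proof (rule ccontr)
  assume "j \<noteq> j'"
  have "a ! x = a' ! x" if "x < m" for x
    using assms(8,9) that \<open>j \<noteq> j'\<close> assms(4-7)
    unfolding remove_bit_eq_iff[OF assms(1,2,4,5)] remove_bit_eq_iff[OF assms(1,2,6,7)]
    by (metis diff_Suc_1 le_add_diff_inverse2 add_diff_cancel_right' One_nat_def)
  then show False using assms(1-3) by (auto simp: list_eq_iff_nth_eq)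
qed

text \<open>The Boolean cube is connected.\<close>

lemma bit_invariant_imp_constant:
  assumes inv: "\<And>xs ys. length xs + length ys + 1 = m \<Longrightarrow> R (xs @ False # ys) \<longleftrightarrow> R (xs @ True # ys)"
    and a: "length a = m"
  shows "R a \<longleftrightarrow> R (replicate m False)"
proof -
  have "R (replicate n False @ drop n a) \<longleftrightarrow> R a" if "n \<le> m" for n
    using that
  proof (induction n)
    case (Suc n)
    then have "drop n a = a ! n # drop (Suc n) a" using a by (simp add: Cons_nth_drop_Suc)
    moreover have "R (replicate n False @ a ! n # drop (Suc n) a)
        \<longleftrightarrow> R (replicate n False @ False # drop (Suc n) a)"
      using inv[of "replicate n False" "drop (Suc n) a"] Suc.prems a by (cases "a ! n") auto
    ultimately show ?case using Suc by (simp add: replicate_append_same[symmetric])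
  qed simp
  from this[of m] show ?thesis using a by simp
qed

context
  fixes ks :: "nat list" and k r :: nat
  assumes pp: "proper_partition k ks" and r: "r \<ge> 2"
begin

lemma parts_ge_2: "length ks \<ge> 2" and parts_positive: "\<forall>x\<in>set ks. x \<ge> 1"
    and sum_parts: "sum_list ks = k"
  using pp by (auto simp: proper_partition_def)

lemma part_positive: "j < length ks \<Longrightarrow> 1 \<le> ks ! j"
  using parts_positive nth_mem by blast

lemma cycle_edge_alt: "cycle_edge ks r i a = (\<lambda>v. cycle_quotient ks r (i, v)) ` step_edge ks a"
  by (simp add: cycle_edge_def[OF parts_ge_2 r] image_image)

lemma inj_on_copy: "i \<in> {1..r} \<Longrightarrow> inj_on (\<lambda>v. cycle_quotient ks r (i, v)) (verts (step ks))"
  using inj_on_quotient_copy[OF parts_ge_2 r] by (auto simp: inj_on_def)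

lemma card_cycle_edge:
  assumes "i \<in> {1..r}" "a \<in> codes (length ks - 1)"
  shows "card (cycle_edge ks r i a) = k"
proof -
  have "ks \<noteq> []" using parts_ge_2 by auto
  then show ?thesis
    unfolding cycle_edge_alt
      card_image[OF inj_on_subset[OF inj_on_copy[OF assms(1)] step_edge_subset_step[OF parts_ge_2
          r assms(2)]]]
    using card_step_edge sum_parts by simp
qed

lemma cycle_edge_subset:
  assumes "i \<in> {1..r}" "a \<in> codes (length ks - 1)"
  shows "cycle_edge ks r i a \<subseteq> verts (step_cycle ks r)"
  unfolding cycle_edge_alt verts_cycle[OF parts_ge_2 r]
  using assms step_edge_subset_step[OF parts_ge_2 r assms(2)] by auto

lemma uniform_step_cycle: "uniform_hypergraph k (step_cycle ks r)"
  unfolding uniform_hypergraph_def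
proof
  show "finite (verts (step_cycle ks r))"
    unfolding verts_cycle[OF parts_ge_2 r] using finite_step[OF parts_ge_2] by auto
  show "\<forall>e\<in>edges (step_cycle ks r). e \<subseteq> verts (step_cycle ks r) \<and> card e = k"
    unfolding edges_cycle[OF parts_ge_2 r] using card_cycle_edge cycle_edge_subset by auto
qed

lemma card_edges_cycle: "card (edges (step_cycle ks r)) = r * 2 ^ (length ks - 1)"
  unfolding edges_cycle[OF parts_ge_2 r] card_image[OF inj_on_cycle_edge[OF parts_ge_2 r
      parts_positive]]
  by (simp add: card_cartesian_product card_codes)

text \<open>Edges of the same copy meet only in the part given by the single bit in which their codes
  differ, edges of distinct copies only in the part of the attach tuples. Consequently every
  ordering of the edges witnesses linearity.\<close>

lemma cycle_edges_meet_in_block: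
  assumes i: "i \<in> {1..r}" and a: "a \<in> codes (length ks - 1)"
    and i': "i' \<in> {1..r}" and a': "a' \<in> codes (length ks - 1)"
    and ne: "(i, a) \<noteq> (i', a')"
  shows "\<exists>s<length ks. cycle_edge ks r i' a' \<inter> cycle_edge ks r i a
      \<subseteq> (\<lambda>v. cycle_quotient ks r (i, v)) ` step_block ks a s"
proof (cases "i = i'")
  case False
  have "cycle_edge ks r i' a' \<inter> cycle_edge ks r i a
      \<subseteq> (\<lambda>v. cycle_quotient ks r (i, v)) ` step_block ks a 0"
  proof
    fix y assume y: "y \<in> cycle_edge ks r i' a' \<inter> cycle_edge ks r i a"
    then obtain v where v: "v \<in> step_edge ks a" "y = cycle_quotient ks r (i, v)"
      by (auto simp: cycle_edge_alt)
    show "y \<in> (\<lambda>v. cycle_quotient ks r (i, v)) ` step_block ks a 0"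
    proof (cases v)
      case (VA b z)
      then have "v \<in> step_block ks a 0" using v(1) by (simp add: step_block_def)
      then show ?thesis using v(2) by blast
    next
      case (VB j b z)
      then have "y = (i, VB j b z)" using v(2) quotient_VB[OF parts_ge_2 r] by simp
      then show ?thesis using y False VB_in_cycle_edge[OF parts_ge_2 r i' a'] by auto
    qed
  qed
  then show ?thesis using parts_ge_2 by (intro exI[of _ 0]) auto
next
  case True
  then have aa: "a \<noteq> a'" using ne by simp
  have common: "\<exists>j b z. y = (i, VB j b z) \<and> VB j b z \<in> step_edge ks a \<and> VB j b z \<in> step_edge ks a'"
    if y: "y \<in> cycle_edge ks r i' a' \<inter> cycle_edge ks r i a" for y
  proof -
    obtain v v' where v: "v \<in> step_edge ks a" "y = cycle_quotient ks r (i, v)"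
        "v' \<in> step_edge ks a'" "y = cycle_quotient ks r (i, v')"
      using y True by (auto simp: cycle_edge_alt)
    moreover have "v \<in> verts (step ks)" "v' \<in> verts (step ks)"
      using v(1,3) step_edge_subset_step[OF parts_ge_2 r a] step_edge_subset_step[OF parts_ge_2 r
          a'] by auto
    ultimately have "v = v'" using inj_onD[OF inj_on_copy[OF i]] by metis
    show ?thesis
    proof (cases v)
      case (VA b z)
      then show ?thesis using v(1,3) \<open>v = v'\<close> aa by simp
    next
      case (VB j b z)
      then show ?thesis using v \<open>v = v'\<close> quotient_VB[OF parts_ge_2 r] by metis
    qed
  qed
  show ?thesis
  proof (cases "cycle_edge ks r i' a' \<inter> cycle_edge ks r i a = {}")
    case True
    then show ?thesis using parts_ge_2 by (intro exI[of _ 0]) auto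
  next
    case False
    then obtain y0 where "y0 \<in> cycle_edge ks r i' a' \<inter> cycle_edge ks r i a" by blast
    from common[OF this] obtain j b z where jb: "VB j b z \<in> step_edge ks a" "VB j b z \<in> step_edge
        ks a'"
      by blast
    have "cycle_edge ks r i' a' \<inter> cycle_edge ks r i a
        \<subseteq> (\<lambda>v. cycle_quotient ks r (i, v)) ` step_block ks a (j - 1)"
    proof
      fix y assume "y \<in> cycle_edge ks r i' a' \<inter> cycle_edge ks r i a"
      from common[OF this] obtain j' b' z' where y: "y = (i, VB j' b' z')"
          "VB j' b' z' \<in> step_edge ks a" "VB j' b' z' \<in> step_edge ks a'" by blast
      have "j - 1 = j' - 1"
        by (rule remove_bit_inj_index[of a "length ks - 1" a'])
           (use jb y(2,3) a a' aa in \<open>auto simp: codes_def\<close>)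
      then have "VB j' b' z' \<in> step_block ks a (j - 1)"
        using y(2) by (auto simp: step_block_def)
      then show "y \<in> (\<lambda>v. cycle_quotient ks r (i, v)) ` step_block ks a (j - 1)"
        using y(1) quotient_VB[OF parts_ge_2 r] by (intro image_eqI[of _ _ "VB j' b' z'"]) simp_all
    qed
    moreover have "j - 1 < length ks" using jb(1) by auto
    ultimately show ?thesis by blast
  qed
qed

lemma pi_linear_step_cycle: "pi_linear ks (step_cycle ks r)"
proof -
  obtain es where es: "set es = edges (step_cycle ks r)" "distinct es"
    using finite_distinct_list[OF finite_edges_uniform[OF uniform_step_cycle]] by blast
  have "\<exists>A. disjoint_family_on A {..<length ks} \<and> (\<Union>s<length ks. A s) = es ! m \<and>
      (\<forall>s<length ks. card (A s) = ks ! s) \<and> (\<forall>j<m. \<exists>s<length ks. es ! j \<inter> es ! m \<subseteq> A s)"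
    if m: "m < length es" for m
  proof -
    have "es ! m \<in> edges (step_cycle ks r)" using m es(1) nth_mem by blast
    then obtain i a where ia: "i \<in> {1..r}" "a \<in> codes (length ks - 1)" "es ! m
        = cycle_edge ks r i a"
      unfolding edges_cycle[OF parts_ge_2 r] by auto
    let ?q = "\<lambda>v. cycle_quotient ks r (i, v)"
    let ?A = "\<lambda>s. ?q ` step_block ks a s"
    have "ks \<noteq> []" using parts_ge_2 by auto
    have sub: "step_block ks a s \<subseteq> verts (step ks)" if "s < length ks" for s
      using step_edge_subset_step[OF parts_ge_2 r ia(2)] step_edge_eq_blocks[OF \<open>ks \<noteq> []\<close>, of a]
          that by auto
    have inj: "inj_on ?q (\<Union>s<length ks. step_block ks a s)"
      using sub by (intro inj_on_subset[OF inj_on_copy[OF ia(1)]]) auto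
    have "disjoint_family_on ?A {..<length ks}"
      unfolding disjoint_family_on_def
    proof (intro ballI impI)
      fix s s' assume "s \<in> {..<length ks}" "s' \<in> {..<length ks}" "s \<noteq> s'"
      then show "?A s \<inter> ?A s' = {}"
        using inj_on_image_Int[OF inj, of "step_block ks a s" "step_block ks a s'"]
          disjoint_step_blocks[of ks a "{..<length ks}"]
        by (auto simp: disjoint_family_on_def)
    qed
    moreover have "(\<Union>s<length ks. ?A s) = es ! m"
      using ia(3) step_edge_eq_blocks[OF \<open>ks \<noteq> []\<close>, of a] by (simp add: cycle_edge_alt image_UN)
    moreover have "\<forall>s<length ks. card (?A s) = ks ! s"
      using inj_on_subset[OF inj_on_copy[OF ia(1)] sub] by (simp add: card_image card_step_block)
    moreover have "\<forall>j<m. \<exists>s<length ks. es ! j \<inter> es ! m \<subseteq> ?A s"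
    proof (intro allI impI)
      fix j assume j: "j < m"
      then have "es ! j \<in> edges (step_cycle ks r)" using m es(1) nth_mem[of j es] by auto
      then obtain i' a' where ia': "i' \<in> {1..r}" "a' \<in> codes (length ks - 1)" "es ! j
          = cycle_edge ks r i' a'"
        unfolding edges_cycle[OF parts_ge_2 r] by auto
      have "es ! j \<noteq> es ! m" using j m es(2) by (simp add: nth_eq_iff_index_eq)
      then have "(i, a) \<noteq> (i', a')" using ia ia' by auto
      from cycle_edges_meet_in_block[OF ia(1,2) ia'(1,2) this]
      show "\<exists>s<length ks. es ! j \<inter> es ! m \<subseteq> ?A s" using ia ia' by simp
    qed
    ultimately show ?thesis by (intro exI[of _ ?A]) blast
  qed
  then show ?thesis unfolding pi_linear_def using es by blast
qed

text \<open>The index set of the edges of the cycle.\<close>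

definition cycle_index :: "(nat \<times> bool list) set" where
  "cycle_index = {1..r} \<times> codes (length ks - 1)"

text \<open>The indices of the edges through \<open>y\<close>; on a vertex of the cycle there are always two of
  them.\<close>

definition edges_at :: "nat \<times> step_vertex \<Rightarrow> (nat \<times> bool list) set" where
  "edges_at y = {x \<in> cycle_index. y \<in> cycle_edge ks r (fst x) (snd x)}"

lemma edges_at_VB:
  assumes i: "i \<in> {1..r}" and j: "1 \<le> j" "j < length ks" and xs: "length xs = j - 1"
    and ys: "length xs + length ys = length ks - 2" and z: "z \<in> {1..ks ! j}"
  shows "edges_at (i, VB (j + 1) (xs @ ys) z) = {(i, xs @ False # ys), (i, xs @ True # ys)}"
proof -
  have "x \<in> edges_at (i, VB (j + 1) (xs @ ys) z) \<longleftrightarrow> x \<in> {(i, xs @ False # ys), (i, xs @ True #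
      ys)}" for x
  proof -
    obtain i' a where x: "x = (i', a)" by (cases x)
    have "x \<in> edges_at (i, VB (j + 1) (xs @ ys) z)
        \<longleftrightarrow> i' = i \<and> a \<in> codes (length ks - 1) \<and> xs @ ys = remove_bit j a"
      using VB_in_cycle_edge[OF parts_ge_2 r, of i' a i "j + 1" "xs @ ys" z] i j z x
      by (auto simp: edges_at_def cycle_index_def)
    also have "\<dots> \<longleftrightarrow> i' = i \<and> (\<exists>c. a = xs @ c # ys)"
    proof -
      have "a \<in> codes (length ks - 1) \<and> xs @ ys = remove_bit j a \<longleftrightarrow> (\<exists>c. a = xs @ c # ys)"
      proof
        assume a: "a \<in> codes (length ks - 1) \<and> xs @ ys = remove_bit j a"
        then have la: "j - 1 < length a" using j by (auto simp: codes_def)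
        have "xs = take (j - 1) a \<and> ys = drop j a"
          using a xs la unfolding remove_bit_def by (subst append_eq_append_conv[symmetric]) auto
        then have "a = xs @ a ! (j - 1) # ys" using id_take_nth_drop[OF la] j by simp
        then show "\<exists>c. a = xs @ c # ys" by blast
      next
        assume "\<exists>c. a = xs @ c # ys"
        then show "a \<in> codes (length ks - 1) \<and> xs @ ys = remove_bit j a"
          using xs ys j by (auto simp: codes_def remove_bit_def)
      qed
      then show ?thesis by blast
    qed
    also have "\<dots> \<longleftrightarrow> x \<in> {(i, xs @ False # ys), (i, xs @ True # ys)}"
      unfolding x by (simp add: ex_bool_eq) blast
    finally show ?thesis .
  qed
  then show ?thesis by blast
qed

lemma edges_at_VA:
  assumes i: "i \<in> {1..r}" and b: "(b, z) \<in> attach_index ks"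
  shows "edges_at (cycle_quotient ks r (i, VA (b @ [True]) z))
       = {(i, b @ [True]), (cyc_next r i, b @ [False])}"
proof -
  have "b @ [c] \<in> codes (length ks - 1)" for c
    using b parts_ge_2 by (auto simp: attach_index_def codes_def)
  then show ?thesis
    using VA_in_cycle_edge[OF parts_ge_2 r i _ _ b] i cyc_next_in[OF parts_ge_2 r i]
    by (auto simp: edges_at_def cycle_index_def)
qed

lemma cycle_verts_cases:
  assumes "y \<in> verts (step_cycle ks r)"
  obtains (B) i j xs ys z where "y = (i, VB (j + 1) (xs @ ys) z)" "i \<in> {1..r}" "1
      \<le> j" "j < length ks"
      "length xs = j - 1" "length xs + length ys = length ks - 2" "z \<in> {1..ks ! j}"
    | (A) i b z where "y = cycle_quotient ks r (i, VA (b @ [True]) z)" "i \<in> {1..r}" "(b, z) \<in>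
        attach_index ks"
proof -
  obtain i v where y: "y = cycle_quotient ks r (i, v)" "i \<in> {1..r}" "v \<in> verts (step ks)"
    using assms unfolding verts_cycle[OF parts_ge_2 r] by auto
  from y(3) show ?thesis
  proof (cases rule: step_vertex_cases[OF parts_ge_2 r, consumes 1])
    case A': (1 a z c)
    show ?thesis
    proof (cases c)
      case True
      then show ?thesis using A y A' by simp
    next
      case False
      define i' where "i' = (if i = 1 then r else i - 1)"
      have "i' \<in> {1..r}" "cyc_next r i' = i" using y(2) r by (auto simp: i'_def cyc_next_def)
      then show ?thesis using A[of i' a z] y A' False quotient_glue[OF parts_ge_2 r A'(2), of i']
          by simp
    qed
  next
    case B': (2 j b z)
    then have j: "j \<in> {2..length ks}" "length b = length ks - 2" "z \<in> {1..ks ! (j - 1)}"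
      using y(3) by (auto simp: step_def)
    show ?thesis
      by (rule B[of i "j - 1" "take (j - 2) b" "drop (j - 2) b" z])
         (use y B' j quotient_VB[OF parts_ge_2 r] in auto)
  qed
qed

lemma edges_at_pair:
  assumes "y \<in> verts (step_cycle ks r)"
  shows "\<exists>u v. u \<noteq> v \<and> edges_at y = {u, v}"
  using assms
proof (cases rule: cycle_verts_cases)
  case (B i j xs ys z)
  show ?thesis unfolding B(1) edges_at_VB[OF B(2-7)]
    by (rule exI[of _ "(i, xs @ False # ys)"], rule exI[of _ "(i, xs @ True # ys)"]) simp
next
  case (A i b z)
  show ?thesis unfolding A(1) edges_at_VA[OF A(2,3)]
    by (rule exI[of _ "(i, b @ [True])"], rule exI[of _ "(cyc_next r i, b @ [False])"]) simp
qed

lemma edges_through_vertex: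
  assumes "Q \<subseteq> edges (step_cycle ks r)"
  shows "card {e \<in> Q. y \<in> e} = card {x \<in> edges_at y. cycle_edge ks r (fst x) (snd x) \<in> Q}"
proof -
  let ?e = "\<lambda>x. cycle_edge ks r (fst x) (snd x)"
  have inj: "inj_on ?e cycle_index"
    using inj_on_cycle_edge[OF parts_ge_2 r parts_positive] unfolding cycle_index_def
        case_prod_beta .
  have "{e \<in> Q. y \<in> e} = ?e ` {x \<in> edges_at y. ?e x \<in> Q}"
  proof
    show "{e \<in> Q. y \<in> e} \<subseteq> ?e ` {x \<in> edges_at y. ?e x \<in> Q}"
    proof
      fix e assume e: "e \<in> {e \<in> Q. y \<in> e}"
      then have "e \<in> edges (step_cycle ks r)" using assms by auto
      then obtain x where "x \<in> cycle_index" "e = ?e x"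
        unfolding edges_cycle[OF parts_ge_2 r] cycle_index_def by auto
      then show "e \<in> ?e ` {x \<in> edges_at y. ?e x \<in> Q}" using e by (auto simp: edges_at_def)
    qed
  qed (auto simp: edges_at_def)
  then show ?thesis
    using card_image[OF inj_on_subset[OF inj]] by (auto simp: edges_at_def)
qed

lemma cycle_degree:
  assumes "y \<in> verts (step_cycle ks r)"
  shows "card {e \<in> edges (step_cycle ks r). y \<in> e} = 2"
proof -
  obtain u v where uv: "u \<noteq> v" "edges_at y = {u, v}" using edges_at_pair[OF assms] by blast
  have "{x \<in> edges_at y. cycle_edge ks r (fst x) (snd x) \<in> edges (step_cycle ks r)} = edges_at y"
    unfolding edges_cycle[OF parts_ge_2 r] by (auto simp: edges_at_def cycle_index_def)
  then show ?thesis using edges_through_vertex[OF order_refl, of y] uv by simp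
qed

lemma card_verts_cycle: "2 * card (verts (step_cycle ks r)) = k * r * 2 ^ (length ks - 1)"
proof -
  let ?C = "step_cycle ks r"
  have fin: "finite (verts ?C)" "finite (edges ?C)"
    using uniform_step_cycle finite_edges_uniform by (auto simp: uniform_hypergraph_def)
  have "2 * card (verts ?C) = (\<Sum>e\<in>edges ?C. card {y \<in> verts ?C. y \<in> e})"
    using cycle_degree by (intro sum_multicount[symmetric] fin) auto
  also have "\<dots> = (\<Sum>e\<in>edges ?C. k)"
  proof (rule sum.cong[OF refl])
    fix e assume "e \<in> edges ?C"
    then have "e \<subseteq> verts ?C" "card e = k" using uniform_step_cycle
        by (auto simp: uniform_hypergraph_def)
    then have "{y \<in> verts ?C. y \<in> e} = e" by auto
    then show "card {y \<in> verts ?C. y \<in> e} = k" using \<open>card e = k\<close> by simp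
  qed
  finally show ?thesis by (simp add: card_edges_cycle mult_ac)
qed

text \<open>A set of edges of the cycle in which no vertex has degree one is empty or everything: both
  edges at a vertex belong to it or neither does, and the cycle is connected.\<close>

lemma cycle_edge_set_no_leaf:
  assumes Q: "Q \<subseteq> edges (step_cycle ks r)"
    and no_leaf: "\<And>y. y \<in> verts (step_cycle ks r) \<Longrightarrow> card {e \<in> Q. y \<in> e} \<noteq> 1"
  shows "Q = {} \<or> Q = edges (step_cycle ks r)"
proof -
  define R where "R i a \<longleftrightarrow> cycle_edge ks r i a \<in> Q" for i a
  have both: "R (fst u) (snd u) \<longleftrightarrow> R (fst v) (snd v)"
    if y: "y \<in> verts (step_cycle ks r)" and uv: "edges_at y = {u, v}" for u v y
  proof (rule ccontr)
    assume "\<not> ?thesis"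
    then have "{x \<in> edges_at y. cycle_edge ks r (fst x) (snd x) \<in> Q} = {u} \<or>
        {x \<in> edges_at y. cycle_edge ks r (fst x) (snd x) \<in> Q} = {v}"
      unfolding uv R_def by (cases "cycle_edge ks r (fst u) (snd u) \<in> Q") auto
    then have "card {e \<in> Q. y \<in> e} = 1" unfolding edges_through_vertex[OF Q] by auto
    then show False using no_leaf[OF y] by simp
  qed
  have flip: "R i (xs @ False # ys) \<longleftrightarrow> R i (xs @ True # ys)"
    if i: "i \<in> {1..r}" and l: "length xs + length ys + 1 = length ks - 1" for i xs ys
  proof -
    define j where "j = length xs + 1"
    have j: "1 \<le> j" "j < length ks" "length xs = j - 1" "length xs + length ys = length ks - 2"
      using l by (auto simp: j_def)
    have z: "1 \<in> {1..ks ! j}" using part_positive[OF j(2)] by simp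
    have "VB (j + 1) (xs @ ys) 1 \<in> verts (step ks)" using j z by (auto simp: step_def)
    then have "(i, VB (j + 1) (xs @ ys) 1) \<in> verts (step_cycle ks r)"
      unfolding verts_cycle[OF parts_ge_2 r] using i quotient_VB[OF parts_ge_2 r, of i]
          by (metis SigmaI image_eqI)
    from both[OF this edges_at_VB[OF i j z]] show ?thesis by simp
  qed
  let ?o = "replicate (length ks - 1) False"
  have const: "R i a \<longleftrightarrow> R i ?o" if "i \<in> {1..r}" "a \<in> codes (length ks - 1)" for i a
    using flip[OF that(1)] that(2) by (intro bit_invariant_imp_constant) (auto simp: codes_def)
  have nxt: "R i ?o \<longleftrightarrow> R (cyc_next r i) ?o" if i: "i \<in> {1..r}" for i
  proof -
    let ?b = "replicate (length ks - 2) False"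
    have k0: "1 \<le> ks ! 0" using part_positive[of 0] parts_ge_2 by (metis less_le_trans pos2)
    have b: "(?b, 1) \<in> attach_index ks" using k0 by (simp add: attach_index_def codes_def)
    have "cycle_quotient ks r (i, VA (?b @ [True]) 1) \<in> verts (step_cycle ks r)"
      unfolding verts_cycle[OF parts_ge_2 r] using i b VA_in_step[OF parts_ge_2] by blast
    from both[OF this edges_at_VA[OF i b]]
    have "R i (?b @ [True]) \<longleftrightarrow> R (cyc_next r i) (?b @ [False])" by simp
    moreover have "?b @ [c] \<in> codes (length ks - 1)" for c using parts_ge_2 by (simp add: codes_def)
    ultimately show ?thesis using const i cyc_next_in[OF parts_ge_2 r i] by metis
  qed
  have "R i ?o \<longleftrightarrow> R 1 ?o" if "i \<in> {1..r}" for i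
  proof -
    have "1 \<le> i" "i \<le> r" using that by auto
    then show ?thesis
    proof (induction i rule: dec_induct)
      case (step n)
      then show ?case using nxt[of n] by (auto simp: cyc_next_def)
    qed simp
  qed
  then have all: "R i a \<longleftrightarrow> R 1 ?o" if "i \<in> {1..r}" "a \<in> codes (length ks - 1)" for i a
    using const[OF that] that(1) by blast
  show ?thesis
  proof (cases "R 1 ?o")
    case True
    then have "edges (step_cycle ks r) \<subseteq> Q"
      unfolding edges_cycle[OF parts_ge_2 r] using all by (auto simp: R_def)
    then show ?thesis using Q by blast
  next
    case False
    have "Q = {}"
    proof (rule ccontr)
      assume "Q \<noteq> {}"
      then obtain e where e: "e \<in> Q" by blast
      then have "e \<in> edges (step_cycle ks r)" using Q by auto
      then obtain i a where "i \<in> {1..r}" "a \<in> codes (length ks - 1)" "e = cycle_edge ks r i a"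
        unfolding edges_cycle[OF parts_ge_2 r] by auto
      then show False using all[of i a] e False by (simp add: R_def)
    qed
    then show ?thesis by blast
  qed
qed

end

section \<open>Separating the mean from a cycle sum\<close>

text \<open>If all one-point marginals of \<open>g\<close> vanish, a product over edges sums to zero as soon as
  some vertex lies in exactly one of them.\<close>

lemma sum_zero_of_leaf:
  fixes g :: "'v multiset \<Rightarrow> real"
  assumes I: "finite I" and y: "y \<in> I" and Q: "finite Q" "\<And>e. e \<in> Q \<Longrightarrow> e \<subseteq> I \<and> card e = k"
    and leaf: "card {e \<in> Q. y \<in> e} = 1"
    and marg: "\<And>S. set_mset S \<subseteq> V \<Longrightarrow> size S = k - 1 \<Longrightarrow> (\<Sum>x\<in>V. g (add_mset x S)) = 0"
  shows "(\<Sum>\<phi>\<in>I \<rightarrow>\<^sub>E V. \<Prod>e\<in>Q. g (image_mset \<phi> (mset_set e))) = 0"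
proof -
  obtain e0 where e0: "{e \<in> Q. y \<in> e} = {e0}" using leaf by (auto simp: card_1_singleton_iff)
  then have e0Q: "e0 \<in> Q" "y \<in> e0" by blast+
  have fe0: "finite e0" using Q(2)[OF e0Q(1)] I finite_subset by blast
  let ?w = "\<lambda>e \<phi>. g (image_mset \<phi> (mset_set e))"
  have ins: "I = insert y (I - {y})" using y by auto
  have "(\<Sum>\<phi>\<in>I \<rightarrow>\<^sub>E V. \<Prod>e\<in>Q. ?w e \<phi>)
      = (\<Sum>x\<in>V. \<Sum>\<phi>\<in>(I - {y}) \<rightarrow>\<^sub>E V. \<Prod>e\<in>Q. ?w e (\<phi>(y := x)))"
    by (subst ins, subst sum_PiE_insert) auto
  also have "\<dots> = (\<Sum>\<phi>\<in>(I - {y}) \<rightarrow>\<^sub>E V. \<Sum>x\<in>V. \<Prod>e\<in>Q. ?w e (\<phi>(y := x)))" by (rule sum.swap)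
  also have "\<dots> = (\<Sum>\<phi>\<in>(I - {y}) \<rightarrow>\<^sub>E V. 0)"
  proof (rule sum.cong[OF refl])
    fix \<phi> assume p: "\<phi> \<in> (I - {y}) \<rightarrow>\<^sub>E V"
    let ?S = "image_mset \<phi> (mset_set (e0 - {y}))"
    have "?w e (\<phi>(y := x)) = ?w e \<phi>" if "e \<in> Q - {e0}" for e x
    proof -
      have "y \<notin> e" using that e0 by auto
      then show ?thesis by (intro arg_cong[of _ _ g] image_mset_cong)
          (metis elem_mset_set empty_iff fun_upd_other infinite_set_mset_mset_set)
    qed
    then have rest: "(\<Prod>e\<in>Q - {e0}. ?w e (\<phi>(y := x))) = (\<Prod>e\<in>Q - {e0}. ?w e \<phi>)" for x
      by (intro prod.cong) auto
    have "image_mset (\<phi>(y := x)) (mset_set e0) = add_mset x ?S" for x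
    proof -
      have "mset_set e0 = add_mset y (mset_set (e0 - {y}))"
        using e0Q(2) fe0 by (simp add: mset_set.remove)
      moreover have "image_mset (\<phi>(y := x)) (mset_set (e0 - {y})) = ?S"
        using fe0 by (intro image_mset_cong) auto
      ultimately show ?thesis by simp
    qed
    then have "(\<Sum>x\<in>V. \<Prod>e\<in>Q. ?w e (\<phi>(y := x))) = (\<Sum>x\<in>V. g (add_mset x ?S) * (\<Prod>e\<in>Q - {e0}. ?w e \<phi>))"
      using Q(1) e0Q(1) rest by (simp add: prod.remove)
    also have "\<dots> = 0"
    proof -
      have "set_mset ?S \<subseteq> V" using p Q(2)[OF e0Q(1)] fe0 by (auto dest: PiE_mem)
      moreover have "size ?S = k - 1" using Q(2)[OF e0Q(1)] e0Q(2) fe0 by simp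
      ultimately show ?thesis using marg by (simp add: sum_distrib_right[symmetric])
    qed
    finally show "(\<Sum>x\<in>V. \<Prod>e\<in>Q. ?w e (\<phi>(y := x))) = 0" .
  qed
  finally show ?thesis by simp
qed

text \<open>Expanding the product over the edges gives one summand for every set \<open>Q\<close> of edges that
  carry the weight \<open>g\<close>. Unless \<open>Q\<close> is empty or contains all edges, some vertex lies in exactly
  one edge of \<open>Q\<close>, and the summand vanishes.\<close>

lemma hom_sum_cycle_add_const:
  fixes g :: "'v multiset \<Rightarrow> real"
  assumes pp: "proper_partition k ks" and r: "r \<ge> 2" and V: "finite V"
    and marg: "\<And>S. set_mset S \<subseteq> V \<Longrightarrow> size S = k - 1 \<Longrightarrow> (\<Sum>x\<in>V. g (add_mset x S)) = 0"
  shows "hom_sum (\<lambda>e. g e + c) (step_cycle ks r) V = hom_sum g (step_cycle ks r) V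
       + c ^ card (edges (step_cycle ks r)) * real (card V) ^ card (verts (step_cycle ks r))"
proof -
  let ?C = "step_cycle ks r"
  let ?I = "verts ?C" and ?E = "edges ?C"
  have u: "uniform_hypergraph k ?C" using uniform_step_cycle[OF pp r] .
  have fin: "finite ?I" "finite ?E"
    using u finite_edges_uniform by (auto simp: uniform_hypergraph_def)
  let ?T = "\<lambda>Q. (\<Sum>\<phi>\<in>?I \<rightarrow>\<^sub>E V. \<Prod>e\<in>Q. g (image_mset \<phi> (mset_set e))) * c ^ card (?E - Q)"
  have "?E \<noteq> {}" using card_edges_cycle[OF pp r] r by auto
  have "hom_sum (\<lambda>e. g e + c) ?C V
      = (\<Sum>\<phi>\<in>?I \<rightarrow>\<^sub>E V. \<Sum>Q\<in>Pow ?E. (\<Prod>e\<in>Q. g (image_mset \<phi> (mset_set e))) * c ^ card (?E - Q))"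
    unfolding hom_sum_def hom_weight_def by (simp add: prod_add[OF fin(2)])
  also have "\<dots> = (\<Sum>Q\<in>Pow ?E. ?T Q)"
    by (subst sum.swap) (simp add: sum_distrib_right)
  also have "\<dots> = (\<Sum>Q\<in>{{}, ?E}. ?T Q)"
  proof (rule sum.mono_neutral_right)
    show "\<forall>Q\<in>Pow ?E - {{}, ?E}. ?T Q = 0"
    proof
      fix Q assume Q: "Q \<in> Pow ?E - {{}, ?E}"
      then obtain y where y: "y \<in> ?I" "card {e \<in> Q. y \<in> e} = 1"
        using cycle_edge_set_no_leaf[OF pp r, of Q] by blast
      have "(\<Sum>\<phi>\<in>?I \<rightarrow>\<^sub>E V. \<Prod>e\<in>Q. g (image_mset \<phi> (mset_set e))) = 0"
      proof (rule sum_zero_of_leaf[OF fin(1) y(1) _ _ y(2) marg])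
        show "finite Q" using Q fin(2) finite_subset by auto
        show "e \<subseteq> ?I \<and> card e = k" if "e \<in> Q" for e
          using u Q that by (auto simp: uniform_hypergraph_def)
      qed
      then show "?T Q = 0" by simp
    qed
  qed (use fin in auto)
  also have "\<dots> = ?T {} + ?T ?E" using \<open>?E \<noteq> {}\<close> by simp
  finally show ?thesis
    using fin by (simp add: hom_sum_def hom_weight_def card_PiE mult.commute)
qed

section \<open>Spectral norms of tensor forms\<close>

lemma card_tuples: "finite V \<Longrightarrow> card (tuples V m) = card V ^ m"
  using card_lists_length_eq[of V m] by (simp add: tuples_def)

lemma sum_tuples_Suc:
  fixes h :: "'v list \<Rightarrow> real"
  shows "(\<Sum>vs\<in>tuples V (Suc m). h vs) = (\<Sum>x\<in>V. \<Sum>ys\<in>tuples V m. h (x # ys))"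
  unfolding sum.cartesian_product
  by (rule sum.reindex_bij_witness[where i = "\<lambda>(x, ys). x # ys" and j = "\<lambda>vs. (hd vs, tl vs)"])
     (auto simp: tuples_def length_Suc_conv)

lemma sum_tuples_add:
  fixes h :: "'v list \<Rightarrow> real"
  shows "(\<Sum>vs\<in>tuples V (m + l). h vs) = (\<Sum>x\<in>tuples V m. \<Sum>y\<in>tuples V l. h (x @ y))"
proof (induction m arbitrary: h)
  case 0
  have "tuples V 0 = {[]}" by (auto simp: tuples_def)
  then show ?case by simp
next
  case (Suc m)
  then show ?case by (simp add: sum_tuples_Suc)
qed

lemma sum_listset_concat:
  fixes h :: "'v list \<Rightarrow> real"
  shows "(\<Sum>bs\<in>listset (map (tuples V) ks). h (concat bs)) = (\<Sum>vs\<in>tuples V (sum_list ks). h vs)"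
proof (induction ks arbitrary: h)
  case Nil
  have "tuples V 0 = {[]}" by (auto simp: tuples_def)
  then show ?case by simp
next
  case (Cons m ks)
  have "(\<Sum>bs\<in>listset (map (tuples V) (m # ks)). h (concat bs))
      = (\<Sum>x\<in>tuples V m. \<Sum>bs\<in>listset (map (tuples V) ks). h (x @ concat bs))"
    unfolding sum.cartesian_product
    by (rule sum.reindex_bij_witness[where i = "\<lambda>(x, ys). x # ys" and j = "\<lambda>vs. (hd vs, tl vs)"])
       (auto simp: set_Cons_def)
  also have "\<dots> = (\<Sum>x\<in>tuples V m. \<Sum>y\<in>tuples V (sum_list ks). h (x @ y))"
    by (intro sum.cong refl Cons.IH)
  finally show ?case by (simp add: sum_tuples_add)
qed

lemma sum_listset_tuples:
  fixes h :: "'v list list \<Rightarrow> real"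
  shows "(\<Sum>bs\<in>listset (map (tuples V) ks). h bs)
       = (\<Sum>Y\<in>Pi\<^sub>E {..<length ks} (\<lambda>j. tuples V (ks ! j)). h (map Y [0..<length ks]))"
proof -
  have "map (tuples V) ks = map (\<lambda>j. tuples V (ks ! j)) [0..<length ks]"
    by (rule nth_equalityI) auto
  then show ?thesis by (simp only: sum_listset_eq_PiE)
qed

lemma mset_concat_blocks: "mset (concat (map Y [0..<t])) = (\<Sum>j<t. mset (Y j))"
  by (simp add: mset_concat interv_sum_list_conv_sum_set_nat atLeast0LessThan o_def)

lemma tensor_form_eq_listset:
  "tensor_form g V ks w = (\<Sum>bs\<in>listset (map (tuples V) ks).
     (\<Prod>i<length ks. w i (bs ! i)) * g (mset (concat bs)))"
  unfolding sum_listset_tuples tensor_form_def mset_concat_blocks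
  by (intro sum.cong refl arg_cong2[of _ _ _ _ "(*)"] prod.cong) auto

lemma regroup_eq_tensor_form:
  assumes "\<And>b. b \<in> tuples V (sum_list ks) \<Longrightarrow> \<sigma> (map std_basis b) = g (mset b)"
  shows "regroup V ks \<sigma> xs = tensor_form g V ks (\<lambda>i. xs ! i)"
  unfolding regroup_def tensor_form_eq_listset
proof (intro sum.cong refl arg_cong2[of _ _ _ _ "(*)"])
  fix bs assume "bs \<in> listset (map (tuples V) ks)"
  then have bs: "length bs = length ks" "\<forall>i<length ks. bs ! i \<in> tuples V (ks ! i)"
    by (auto simp: in_listset_iff)
  have "length (concat bs) = sum_list ks"
  proof -
    have "map length bs = ks" using bs by (intro nth_equalityI) (auto simp: tuples_def)
    then show ?thesis by (simp add: length_concat)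
  qed
  moreover have "set (concat bs) \<subseteq> V"
    using bs by (fastforce simp: tuples_def in_set_conv_nth)
  ultimately show "\<sigma> (map std_basis (concat bs)) = g (mset (concat bs))"
    by (intro assms) (simp add: tuples_def)
qed

lemma sum_std_basis:
  fixes h :: "'v list \<Rightarrow> real"
  assumes "finite V" "b \<in> tuples V m"
  shows "(\<Sum>vs\<in>tuples V m. (\<Prod>i<m. std_basis (b ! i) (vs ! i)) * h vs) = h b"
proof -
  have "(\<Prod>i<m. std_basis (b ! i) (vs ! i)) = of_bool (vs = b)" if "vs \<in> tuples V m" for vs
  proof (cases "vs = b")
    case False
    moreover have "length vs = m" "length b = m" using that assms(2) by (auto simp: tuples_def)
    ultimately obtain i where "i < m" "vs ! i \<noteq> b ! i" by (metis nth_equalityI)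
    then have "(\<Prod>i<m. std_basis (b ! i) (vs ! i)) = 0"
      by (intro prod_zero) (auto simp: std_basis_def indicator_def)
    then show ?thesis using False by simp
  qed (simp add: std_basis_def)
  then have "(\<Sum>vs\<in>tuples V m. (\<Prod>i<m. std_basis (b ! i) (vs ! i)) * h vs)
      = (\<Sum>vs\<in>tuples V m. of_bool (vs = b) * h vs)" by (intro sum.cong) auto
  also have "\<dots> = h b"
    using assms finite_tuples[of V m] by (simp add: of_bool_def if_distrib[of "\<lambda>c. c
        * _"] cong: if_cong)
  finally show ?thesis .
qed

lemma adjacency_map_basis:
  assumes "finite (verts H)" "b \<in> tuples (verts H) m"
  shows "adjacency_map H (map std_basis b) = edge_ind H (mset b)"
proof -
  have "length b = m" using assms(2) by (simp add: tuples_def)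
  then show ?thesis
    using sum_std_basis[OF assms, of "\<lambda>vs. of_bool (mset vs \<in> edges H)"]
    by (simp add: adjacency_map_def edge_ind_def)
qed

lemma all_ones_map_basis:
  assumes "finite V" "b \<in> tuples V m"
  shows "all_ones_map V (map std_basis b) = 1"
proof -
  have "length b = m" using assms(2) by (simp add: tuples_def)
  then show ?thesis
    using sum_std_basis[OF assms, of "\<lambda>_. 1"] by (simp add: all_ones_map_def)
qed

lemma tensor_form_diff:
  "tensor_form g V ks w - c * tensor_form h V ks w = tensor_form (\<lambda>e. g e - c * h e) V ks w"
  unfolding tensor_form_def sum_distrib_left sum_subtractf[symmetric]
  by (intro sum.cong) (auto simp: algebra_simps)

lemma tensor_form_scale:
  "tensor_form g V ks (\<lambda>j x. c j * w j x) = (\<Prod>j<length ks. c j) * tensor_form g V ks w"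
  by (simp add: tensor_form_def prod.distrib sum_distrib_left mult.assoc)

text \<open>The tuples of unit tensors over which the spectral norm is a supremum.\<close>

definition unit_tensors :: "'v set \<Rightarrow> nat list \<Rightarrow> ('v list \<Rightarrow> real) list set" where
  "unit_tensors V ks = {xs. list_all2 (\<lambda>x m. L2_set x (tuples V m) = 1) xs ks}"

lemma unit_tensors_iff:
  "xs \<in> unit_tensors V ks \<longleftrightarrow> length xs = length ks \<and>
     (\<forall>j<length ks. (\<Sum>x\<in>tuples V (ks ! j). ((xs ! j) x)\<^sup>2) = 1)"
  by (auto simp: unit_tensors_def list_all2_conv_all_nth L2_set_def)

lemma unit_tensors_nonempty:
  assumes V: "finite V" "V \<noteq> {}"
  shows "map (\<lambda>m _. 1 / sqrt (real (card V) ^ m)) ks \<in> unit_tensors V ks"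
  using assms by (auto simp: unit_tensors_iff card_tuples power_divide)

lemma prod_sqrt_powers:
  "(\<Prod>j<length ks. sqrt (real n ^ (ks ! j))) = sqrt (real n ^ sum_list ks)"
  by (simp add: real_sqrt_power power_sum[symmetric] sum_list_sum_nth atLeast0LessThan)

lemma tensor_form_bound:
  assumes V: "finite V" and g: "\<And>e. \<bar>g e\<bar> \<le> C"
    and unit: "\<And>j. j < length ks \<Longrightarrow> (\<Sum>x\<in>tuples V (ks ! j). (w j x)\<^sup>2) = 1"
  shows "\<bar>tensor_form g V ks w\<bar> \<le> C * sqrt (real (card V) ^ sum_list ks)"
proof -
  let ?t = "length ks"
  have C: "0 \<le> C" using g[of "{#}"] by linarith
  have "\<bar>tensor_form g V ks w\<bar> \<le> (\<Sum>Y\<in>Pi\<^sub>E {..<?t} (\<lambda>j. tuples V (ks ! j)). (\<Prod>j<?t. \<bar>w j (Y j)\<bar>)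
      * C)"
    unfolding tensor_form_def using g
    by (intro order_trans[OF sum_abs] sum_mono) (auto simp: abs_mult abs_prod intro!:
        mult_left_mono prod_nonneg)
  also have "\<dots> = C * (\<Prod>j<?t. \<Sum>x\<in>tuples V (ks ! j). \<bar>w j x\<bar>)"
    unfolding sum_distrib_right[symmetric] using finite_tuples[OF V] by (subst prod_sum_PiE) auto
  also have "\<dots> \<le> C * (\<Prod>j<?t. sqrt (real (card V) ^ (ks ! j)))"
  proof (intro mult_left_mono prod_mono C conjI sum_nonneg abs_ge_zero)
    fix j assume "j \<in> {..<?t}"
    then have j: "j < ?t" by simp
    have "(\<Sum>x\<in>tuples V (ks ! j). \<bar>w j x\<bar> * 1)\<^sup>2
        \<le> (\<Sum>x\<in>tuples V (ks ! j). \<bar>w j x\<bar>\<^sup>2) * (\<Sum>x\<in>tuples V (ks ! j). 1\<^sup>2)"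
      by (rule Cauchy_Schwarz_ineq_sum)
    then have "(\<Sum>x\<in>tuples V (ks ! j). \<bar>w j x\<bar>)\<^sup>2 \<le> real (card V) ^ (ks ! j)"
      using unit[OF j] by (simp add: card_tuples[OF V])
    then show "(\<Sum>x\<in>tuples V (ks ! j). \<bar>w j x\<bar>) \<le> sqrt (real (card V) ^ (ks ! j))"
      by (rule real_le_rsqrt)
  qed
  also have "(\<Prod>j<?t. sqrt (real (card V) ^ (ks ! j))) = sqrt (real (card V) ^ sum_list ks)"
    by (rule prod_sqrt_powers)
  finally show ?thesis .
qed

lemma spectral_norm_cong:
  assumes "\<And>xs. xs \<in> unit_tensors V ks \<Longrightarrow> \<phi> xs = \<psi> xs"
  shows "spectral_norm V ks \<phi> = spectral_norm V ks \<psi>"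
  unfolding spectral_norm_def unit_tensors_def[symmetric] using assms by (intro SUP_cong) auto

text \<open>The spectral norm of a tensor form.\<close>

definition form_norm :: "('v multiset \<Rightarrow> real) \<Rightarrow> 'v set \<Rightarrow> nat list \<Rightarrow> real" where
  "form_norm g V ks = spectral_norm V ks (\<lambda>xs. tensor_form g V ks (\<lambda>i. xs ! i))"

lemma lambda1_eq:
  assumes "finite (verts H)"
  shows "lambda1 ks H = form_norm (edge_ind H) (verts H) ks"
  unfolding lambda1_def form_norm_def
  using adjacency_map_basis[OF assms] by (intro spectral_norm_cong regroup_eq_tensor_form)

lemma lambda2_eq:
  assumes "finite (verts H)"
  shows "lambda2 ks H = form_norm (\<lambda>e. edge_ind H e
     - fact (sum_list ks) * real (card (edges H)) / real (card (verts H)) ^ sum_list ks) (verts H)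
         ks"
proof -
  have 1: "regroup (verts H) ks (adjacency_map H) xs = tensor_form (edge_ind H) (verts H) ks (\<lambda>i.
      xs ! i)" for xs
    using adjacency_map_basis[OF assms] by (intro regroup_eq_tensor_form)
  have 2: "regroup (verts H) ks (all_ones_map (verts H)) xs
      = tensor_form (\<lambda>_. 1) (verts H) ks (\<lambda>i. xs ! i)" for xs
    using all_ones_map_basis[OF assms] by (intro regroup_eq_tensor_form)
  show ?thesis unfolding lambda2_def form_norm_def 1 2 tensor_form_diff by simp
qed

lemma form_norm_upper:
  assumes V: "finite V" and g: "\<And>e. \<bar>g e\<bar> \<le> C"
    and unit: "\<And>j. j < length ks \<Longrightarrow> (\<Sum>x\<in>tuples V (ks ! j). (w j x)\<^sup>2) = 1"
  shows "\<bar>tensor_form g V ks w\<bar> \<le> form_norm g V ks"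
proof -
  let ?xs = "map w [0..<length ks]"
  have "?xs \<in> unit_tensors V ks" using unit by (simp add: unit_tensors_iff)
  moreover have "bdd_above ((\<lambda>xs. \<bar>tensor_form g V ks (\<lambda>i. xs ! i)\<bar>) ` unit_tensors V ks)"
    by (intro bdd_aboveI2[where M = "C * sqrt (real (card V) ^ sum_list ks)"] tensor_form_bound[OF
        V g])
       (auto simp: unit_tensors_iff)
  ultimately have "\<bar>tensor_form g V ks (\<lambda>i. ?xs ! i)\<bar> \<le> form_norm g V ks"
    unfolding form_norm_def spectral_norm_def unit_tensors_def[symmetric] by (intro cSUP_upper)
  moreover have "tensor_form g V ks (\<lambda>i. ?xs ! i) = tensor_form g V ks w"
    unfolding tensor_form_def by (intro sum.cong refl arg_cong2[of _ _ _ _ "(*)"] prod.cong) auto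
  ultimately show ?thesis by simp
qed

lemma form_norm_least:
  assumes V: "finite V" "V \<noteq> {}"
    and bound: "\<And>w. (\<And>j. j < length ks \<Longrightarrow> (\<Sum>x\<in>tuples V (ks ! j). (w j x)\<^sup>2) = 1)
      \<Longrightarrow> \<bar>tensor_form g V ks w\<bar> \<le> B"
  shows "form_norm g V ks \<le> B"
  unfolding form_norm_def spectral_norm_def unit_tensors_def[symmetric]
proof (rule cSUP_least)
  show "unit_tensors V ks \<noteq> {}" using unit_tensors_nonempty[OF V] by blast
  show "\<bar>tensor_form g V ks (\<lambda>i. xs ! i)\<bar> \<le> B" if "xs \<in> unit_tensors V ks" for xs
    using that by (intro bound) (auto simp: unit_tensors_iff)
qed

text \<open>A list of the elements of a finite set in some order. Taking one tuple for each set turns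
  the indicator of a family of sets into a tensor with squared norm the size of the family.\<close>

definition enum_set :: "'v set \<Rightarrow> 'v list" where
  "enum_set s = (SOME xs. mset xs = mset_set s)"

lemma mset_enum_set: "mset (enum_set s) = mset_set s"
  unfolding enum_set_def by (rule someI_ex) (rule ex_mset)

lemma inj_on_enum_set: "inj_on enum_set {s. finite s}"
  by (intro inj_onI) (metis finite_set_mset_mset_set mem_Collect_eq mset_enum_set)

lemma enum_set_tuples: "finite V \<Longrightarrow> s \<subseteq> V \<Longrightarrow> card s = m \<Longrightarrow> enum_set s \<in> tuples V m"
proof -
  assume a: "finite V" "s \<subseteq> V" "card s = m"
  then have "finite s" by (auto intro: finite_subset)
  then have "set (enum_set s) = s" by (metis finite_set_mset_mset_set mset_enum_set set_mset_mset)
  moreover have "length (enum_set s) = m" by (metis a(3) mset_enum_set size_mset size_mset_set)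
  ultimately show ?thesis using a by (simp add: tuples_def)
qed

lemma expand_deviation_le_form_norm:
  assumes V: "finite (verts H)" "verts H \<noteq> {}" and q: "\<bar>q\<bar> \<le> C"
    and S: "\<And>j. j < length ks \<Longrightarrow> S j \<subseteq> {s. s \<subseteq> verts H \<and> card s = ks ! j}"
  shows "\<bar>real (expand_count H (map S [0..<length ks]))
       - q * (\<Prod>X\<leftarrow>map S [0..<length ks]. real (card X))\<bar>
     \<le> sqrt (real (card (verts H)) ^ sum_list ks) * form_norm (\<lambda>e. edge_ind H e - q) (verts H) ks"
proof -
  let ?V = "verts H" and ?t = "length ks" and ?g = "\<lambda>e. edge_ind H e - q"
  have fS: "finite (S j)" if "j < ?t" for j
  proof (rule finite_subset)
    show "S j \<subseteq> Pow ?V" using S[OF that] by auto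
  qed (use V in auto)
  have inj: "inj_on enum_set (S j)" if "j < ?t" for j
    using S[OF that] finite_subset[OF _ V(1)] by (intro inj_on_subset[OF inj_on_enum_set]) blast
  have sub: "enum_set ` S j \<subseteq> tuples ?V (ks ! j)" if "j < ?t" for j
    using S[OF that] enum_set_tuples[OF V(1)] by auto
  have cS: "real (card (S j)) \<le> real (card ?V) ^ (ks ! j)" if "j < ?t" for j
    using card_inj_on_le[OF inj[OF that] sub[OF that] finite_tuples[OF V(1)]] card_tuples[OF V(1),
        of "ks ! j"]
    by (metis of_nat_le_iff of_nat_power)
  define w where "w j x = (of_bool (x \<in> enum_set ` S j) :: real)" for j x
  have "real (expand_count H (map S [0..<?t])) - q * (\<Prod>X\<leftarrow>map S [0..<?t]. real (card X))
      = (\<Sum>Y\<in>Pi\<^sub>E {..<?t} S. ?g (\<Sum>j<?t. mset_set (Y j)))"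
    by (rule expand_count_deviation[OF V(1) S])
  also have "\<dots> = (\<Sum>Y\<in>Pi\<^sub>E {..<?t} S. (\<lambda>Z. ?g (\<Sum>j<?t. mset (Z j))) (\<lambda>j\<in>{..<?t}. enum_set (Y j)))"
    by (simp add: mset_enum_set)
  also have "\<dots> = (\<Sum>Z\<in>Pi\<^sub>E {..<?t} (\<lambda>j. enum_set ` S j). ?g (\<Sum>j<?t. mset (Z j)))"
    by (rule sum_PiE_bij) (use fS inj in \<open>auto intro: inj_on_imp_bij_betw\<close>)
  also have "\<dots> = tensor_form ?g ?V ks w"
    unfolding tensor_form_def
  proof (rule sum.mono_neutral_cong_left)
    show "finite (Pi\<^sub>E {..<?t} (\<lambda>j. tuples ?V (ks ! j)))"
      using finite_tuples[OF V(1)] by (intro finite_PiE) auto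
    show "Pi\<^sub>E {..<?t} (\<lambda>j. enum_set ` S j) \<subseteq> Pi\<^sub>E {..<?t} (\<lambda>j. tuples ?V (ks ! j))"
      using sub by (intro PiE_mono) auto
    show "\<forall>Z\<in>Pi\<^sub>E {..<?t} (\<lambda>j. tuples ?V (ks ! j)) - Pi\<^sub>E {..<?t} (\<lambda>j. enum_set ` S j).
        (\<Prod>j<?t. w j (Z j)) * ?g (\<Sum>j<?t. mset (Z j)) = 0"
    proof
      fix Z assume "Z \<in> Pi\<^sub>E {..<?t} (\<lambda>j. tuples ?V (ks ! j)) - Pi\<^sub>E {..<?t} (\<lambda>j. enum_set ` S j)"
      then obtain j where "j < ?t" "Z j \<notin> enum_set ` S j" by (auto simp: PiE_iff)
      then have "(\<Prod>j<?t. w j (Z j)) = 0" by (intro prod_zero) (auto simp: w_def)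
      then show "(\<Prod>j<?t. w j (Z j)) * ?g (\<Sum>j<?t. mset (Z j)) = 0" by simp
    qed
    show "?g (\<Sum>j<?t. mset (Z j)) = (\<Prod>j<?t. w j (Z j)) * ?g (\<Sum>j<?t. mset (Z j))"
      if "Z \<in> Pi\<^sub>E {..<?t} (\<lambda>j. enum_set ` S j)" for Z
    proof -
      have "(\<Prod>j<?t. w j (Z j)) = 1" using PiE_mem[OF that]
          by (intro prod.neutral) (auto simp: w_def)
      then show ?thesis by simp
    qed
  qed
  also have "\<bar>\<dots>\<bar> \<le> sqrt (real (card ?V) ^ sum_list ks) * form_norm ?g ?V ks"
  proof -
    have g: "\<bar>?g e\<bar> \<le> 1 + C" for e using edge_ind_bounds[of H e] q by linarith
    have fn: "0 \<le> form_norm ?g ?V ks"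
    proof -
      have "\<bar>tensor_form ?g ?V ks (\<lambda>j _. 1 / sqrt (real (card ?V) ^ (ks ! j)))\<bar>
          \<le> form_norm ?g ?V ks"
        by (rule form_norm_upper[OF V(1) g]) (use V in \<open>auto simp: card_tuples power_divide\<close>)
      then show ?thesis by linarith
    qed
    show ?thesis
    proof (cases "\<exists>j<?t. S j = {}")
      case True
      then obtain j where j: "j < ?t" "S j = {}" by blast
      have "tensor_form ?g ?V ks w = 0"
        unfolding tensor_form_def
        using j by (intro sum.neutral ballI) (auto simp: w_def intro!: prod_zero)
      moreover have "0 \<le> sqrt (real (card ?V) ^ sum_list ks) * form_norm ?g ?V ks"
        using fn by simp
      ultimately show ?thesis by simp
    next
      case False
      define v where "v j x = w j x / sqrt (real (card (S j)))" for j x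
      have pos: "0 < card (S j)" if "j < ?t" for j using False fS that by (auto simp: card_gt_0_iff)
      have "(\<Sum>x\<in>tuples ?V (ks ! j). (v j x)\<^sup>2) = 1" if j: "j < ?t" for j
      proof -
        have "(\<Sum>x\<in>tuples ?V (ks ! j). (w j x)\<^sup>2) = (\<Sum>x\<in>enum_set ` S j. 1)"
          using sub[OF j] finite_tuples[OF V(1)] by (intro sum.mono_neutral_cong_right) (auto
              simp: w_def)
        also have "\<dots> = real (card (S j))" using card_image[OF inj[OF j]] by simp
        finally show ?thesis
          using pos[OF j] by (simp add: v_def power_divide sum_divide_distrib[symmetric])
      qed
      then have le: "\<bar>tensor_form ?g ?V ks v\<bar> \<le> form_norm ?g ?V ks"
          by (rule form_norm_upper[OF V(1) g])
      have "tensor_form ?g ?V ks w = tensor_form ?g ?V ks (\<lambda>j x. sqrt (real (card (S j))) * v j x)"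
        unfolding tensor_form_def using pos
        by (intro sum.cong refl arg_cong2[of _ _ _ _ "(*)"] prod.cong) (auto simp: v_def)
      also have "\<dots> = (\<Prod>j<?t. sqrt (real (card (S j)))) * tensor_form ?g ?V ks v"
        by (rule tensor_form_scale)
      finally have "\<bar>tensor_form ?g ?V ks w\<bar> = (\<Prod>j<?t. sqrt (real (card (S j))))
          * \<bar>tensor_form ?g ?V ks v\<bar>"
        by (simp add: abs_mult abs_prod)
      also have "\<dots> \<le> (\<Prod>j<?t. sqrt (real (card ?V) ^ (ks ! j))) * form_norm ?g ?V ks"
        using cS le by (intro mult_mono prod_mono prod_nonneg) auto
      also have "(\<Prod>j<?t. sqrt (real (card ?V) ^ (ks ! j))) = sqrt (real (card ?V) ^ sum_list ks)"
        by (rule prod_sqrt_powers)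
      finally show ?thesis .
    qed
  qed
  finally show ?thesis .
qed

section \<open>Edge counts and coregularity\<close>

text \<open>The number of \<open>k\<close>-tuples of vertices that form an edge.\<close>

definition edge_tuples :: "'v loop_hypergraph \<Rightarrow> nat \<Rightarrow> real" where
  "edge_tuples H k = (\<Sum>vs\<in>tuples (verts H) k. edge_ind H (mset vs))"

lemma tensor_form_ones: "tensor_form (edge_ind H) (verts H) ks (\<lambda>_ _. 1)
    = edge_tuples H (sum_list ks)"
  unfolding tensor_form_eq_listset edge_tuples_def
  by (simp add: sum_listset_concat[where h = "\<lambda>vs. edge_ind H (mset vs)"])

lemma card_nondistinct_tuples:
  assumes "finite V"
  shows "card {vs \<in> tuples V k. \<not> distinct vs} \<le> k\<^sup>2 * card V ^ (k - 1)"
proof -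
  have bij: "bij_betw (block (\<lambda>z. z) k) ((\<lambda>z. z) ` {1..k} \<rightarrow>\<^sub>E V) (tuples V k)"
    by (rule bij_betw_block) simp
  have "{vs \<in> tuples V k. \<not> distinct vs} \<subseteq> block (\<lambda>z. z) k ` {\<phi> \<in> {1..k} \<rightarrow>\<^sub>E V. \<not> inj_on \<phi> {1..k}}"
  proof
    fix vs assume vs: "vs \<in> {vs \<in> tuples V k. \<not> distinct vs}"
    then obtain \<phi> where p: "\<phi> \<in> {1..k} \<rightarrow>\<^sub>E V" "vs = block (\<lambda>z. z) k \<phi>"
      using bij by (auto simp: bij_betw_def)
    have "\<not> inj_on \<phi> {1..k}"
    proof
      assume "inj_on \<phi> {1..k}"
      moreover have "set [1..<k + 1] = {1..k}" by auto
      ultimately have "distinct vs" unfolding p(2) block_def distinct_map by (metis distinct_upt)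
      then show False using vs by simp
    qed
    then show "vs \<in> block (\<lambda>z. z) k ` {\<phi> \<in> {1..k} \<rightarrow>\<^sub>E V. \<not> inj_on \<phi> {1..k}}" using p by blast
  qed
  then have "card {vs \<in> tuples V k. \<not> distinct vs} \<le> card {\<phi> \<in> {1..k} \<rightarrow>\<^sub>E V. \<not> inj_on \<phi> {1..k}}"
    using assms by (intro surj_card_le) (auto intro!: finite_PiE intro: finite_subset[of _ "{1..k}
        \<rightarrow>\<^sub>E V"])
  also have "\<dots> \<le> k\<^sup>2 * card V ^ (k - 1)"
    using card_not_inj_maps_le[of "{1..k}" V] assms by simp
  finally show ?thesis .
qed

text \<open>An edge without repeated vertices is formed by \<open>fact k\<close> tuples. The other edges are the
  images of tuples with repeated entries, of which there are \<open>O(n ^ (k - 1))\<close>.\<close>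

lemma edge_tuples_vs_card_edges:
  assumes u: "uniform_loop_hypergraph k H"
  shows "\<bar>fact k * real (card (edges H)) - edge_tuples H k\<bar>
     \<le> fact k * real (k\<^sup>2) * real (card (verts H)) ^ (k - 1)"
proof -
  let ?V = "verts H" and ?E = "edges H"
  have V: "finite ?V" using u by (simp add: uniform_loop_hypergraph_def)
  let ?L = "\<lambda>e. {vs \<in> tuples ?V k. mset vs = e}"
  have L: "?L e = permutations_of_multiset e" if "e \<in> ?E" for e
    using u that by (auto simp: permutations_of_multiset_def tuples_def uniform_loop_hypergraph_def
        simp flip: set_mset_mset size_mset)
  have finE: "finite ?E"
  proof -
    have "?E \<subseteq> mset ` tuples ?V k"
    proof
      fix e assume e: "e \<in> ?E"
      obtain vs where "mset vs = e" using ex_mset by blast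
      then show "e \<in> mset ` tuples ?V k"
        using u e by (auto simp: tuples_def uniform_loop_hypergraph_def image_iff
            simp flip: set_mset_mset size_mset intro!: exI[of _ vs])
    qed
    then show ?thesis using finite_tuples[OF V] finite_surj by blast
  qed
  have N: "edge_tuples H k = (\<Sum>e\<in>?E. real (card (?L e)))"
  proof -
    have "edge_tuples H k = (\<Sum>vs | vs \<in> tuples ?V k \<and> mset vs \<in> ?E. 1)"
      unfolding edge_tuples_def edge_ind_def of_bool_def using finite_tuples[OF V]
      by (simp add: sum.inter_filter[symmetric])
    also have "\<dots> = (\<Sum>e\<in>?E. \<Sum>vs | vs \<in> {vs. vs \<in> tuples ?V k \<and> mset vs \<in> ?E} \<and> mset vs = e. 1)"
      using finite_tuples[OF V] finE by (intro sum.group[symmetric]) auto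
    also have "\<dots> = (\<Sum>e\<in>?E. real (card (?L e)))"
    proof (rule sum.cong[OF refl])
      fix e assume "e \<in> ?E"
      then have "{vs. vs \<in> {vs. vs \<in> tuples ?V k \<and> mset vs \<in> ?E} \<and> mset vs = e} = ?L e" by auto
      then show "(\<Sum>vs | vs \<in> {vs. vs \<in> tuples ?V k \<and> mset vs \<in> ?E} \<and> mset vs = e. 1)
          = real (card (?L e))"
        by simp
    qed
    finally show ?thesis .
  qed
  \<comment> \<open>the edges with a repeated vertex\<close>
  let ?B = "{e \<in> ?E. \<exists>vs\<in>?L e. \<not> distinct vs}"
  have le: "card (?L e) \<le> fact k" if "e \<in> ?E" for e
  proof -
    have "card (permutations_of_multiset e) \<le> fact (size e)"
      unfolding card_permutations_of_multiset(1) by (rule div_le_dividend)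
    then show ?thesis using L[OF that] u that by (simp add: uniform_loop_hypergraph_def)
  qed
  have eq: "card (?L e) = fact k" if "e \<in> ?E - ?B" for e
  proof -
    obtain vs where vs: "mset vs = e" using ex_mset by blast
    then have "vs \<in> ?L e" using L[of e] that by (auto simp: permutations_of_multiset_def)
    then have "distinct vs" using that by blast
    then have "e = mset_set (set vs)" using vs by (simp add: mset_set_set)
    then have "card (?L e) = fact (card (set vs))"
      using L[of e] that permutations_of_set_altdef[of "set vs"] card_permutations_of_set[of "set
          vs"]
      by simp
    also have "card (set vs) = k"
      using \<open>distinct vs\<close> \<open>vs \<in> ?L e\<close> by (simp add: distinct_card tuples_def)
    finally show ?thesis .
  qed
  have "card ?B \<le> card {vs \<in> tuples ?V k. \<not> distinct vs}"
  proof (rule surj_card_le)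
    show "?B \<subseteq> mset ` {vs \<in> tuples ?V k. \<not> distinct vs}" by blast
  qed (use finite_tuples[OF V] in auto)
  also have "\<dots> \<le> k\<^sup>2 * card ?V ^ (k - 1)" by (rule card_nondistinct_tuples[OF V])
  finally have "real (card ?B) \<le> real (k\<^sup>2 * card ?V ^ (k - 1))" by (rule of_nat_mono)
  then have B: "real (card ?B) \<le> real (k\<^sup>2) * real (card ?V) ^ (k - 1)" by simp
  have "fact k * real (card ?E) - edge_tuples H k = (\<Sum>e\<in>?E. fact k - real (card (?L e)))"
    unfolding N by (simp add: sum_subtractf)
  also have "\<dots> = (\<Sum>e\<in>?B. fact k - real (card (?L e)))"
  proof (rule sum.mono_neutral_right)
    show "\<forall>e\<in>?E - ?B. fact k - real (card (?L e)) = 0" using eq by simp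
  qed (use finE in auto)
  also have "\<bar>\<dots>\<bar> \<le> (\<Sum>e\<in>?B. fact k)"
  proof (rule order_trans[OF sum_abs sum_mono])
    fix e assume "e \<in> ?B"
    then have "real (card (?L e)) \<le> real (fact k)" using le by (intro of_nat_mono) auto
    then show "\<bar>fact k - real (card (?L e))\<bar> \<le> fact k" by simp
  qed
  also have "\<dots> \<le> fact k * (real (k\<^sup>2) * real (card ?V) ^ (k - 1))"
    using mult_left_mono[OF B, of "fact k"] by (simp add: mult.commute)
  finally show ?thesis by (simp add: mult.assoc)
qed

lemma coregular_marginal:
  assumes u: "uniform_loop_hypergraph k H" and c: "coregular k d H" and k: "1 \<le> k"
    and S: "set_mset S \<subseteq> verts H" "size S = k - 1"
  shows "(\<Sum>x\<in>verts H. edge_ind H (add_mset x S)) = real d"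
proof -
  have V: "finite (verts H)" using u by (simp add: uniform_loop_hypergraph_def)
  have "{e \<in> edges H. S \<subseteq># e} = (\<lambda>x. add_mset x S) ` {x \<in> verts H. add_mset x S \<in> edges H}"
  proof
    show "{e \<in> edges H. S \<subseteq># e} \<subseteq> (\<lambda>x. add_mset x S) ` {x \<in> verts H. add_mset x S \<in> edges H}"
    proof
      fix e assume e: "e \<in> {e \<in> edges H. S \<subseteq># e}"
      then have "size (e - S) = 1"
        using u S(2) k by (auto simp: uniform_loop_hypergraph_def size_Diff_submset)
      then obtain x where x: "e - S = {#x#}" using size_1_singleton_mset by blast
      then have ex: "e = add_mset x S" using e by (metis add_mset_add_single mem_Collect_eq
          subset_mset.diff_add add.commute)
      moreover have "x \<in> verts H" using u e ex by (auto simp: uniform_loop_hypergraph_def)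
      ultimately show "e \<in> (\<lambda>x. add_mset x S) ` {x \<in> verts H. add_mset x S \<in> edges H}"
          using e by auto
    qed
  qed auto
  then have "card {e \<in> edges H. S \<subseteq># e} = card {x \<in> verts H. add_mset x S \<in> edges H}"
    by (simp add: card_image inj_on_def)
  moreover have "card {e \<in> edges H. S \<subseteq># e} = d" using c S by (auto simp: coregular_def)
  ultimately show ?thesis
    using V by (simp add: edge_ind_def of_bool_def sum.inter_filter[symmetric])
qed

lemma edge_tuples_coregular:
  assumes u: "uniform_loop_hypergraph k H" and c: "coregular k d H" and k: "1 \<le> k"
  shows "edge_tuples H k = real (card (verts H)) ^ (k - 1) * real d"
proof -
  have V: "finite (verts H)" using u by (simp add: uniform_loop_hypergraph_def)
  have "edge_tuples H (Suc (k - 1))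
      = (\<Sum>ys\<in>tuples (verts H) (k - 1). \<Sum>x\<in>verts H. edge_ind H (add_mset x (mset ys)))"
    unfolding edge_tuples_def sum_tuples_Suc by (subst sum.swap) simp
  also have "\<dots> = (\<Sum>ys\<in>tuples (verts H) (k - 1). real d)"
    by (intro sum.cong refl coregular_marginal[OF u c k]) (auto simp: tuples_def)
  finally show ?thesis using k by (simp add: card_tuples[OF V])
qed

section \<open>Eigenvalues, expansion and counts of linear hypergraphs\<close>

lemma powr_half_eq_sqrt: "1 \<le> k \<Longrightarrow> real n powr (real k / 2) = sqrt (real n ^ k)"
  by (cases "n = 0") (simp_all add: powr_realpow[symmetric] powr_half_sqrt[symmetric] powr_powr)

lemma smallo_iff_quotient_tendsto_0:
  fixes f g :: "nat \<Rightarrow> real"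
  assumes "\<And>n. n \<ge> 1 \<Longrightarrow> g n \<noteq> 0"
  shows "f \<in> o(g) \<longleftrightarrow> (\<lambda>n. f n / g n) \<longlonglongrightarrow> 0"
proof -
  have "eventually (\<lambda>n. g n \<noteq> 0) sequentially"
    using assms by (auto simp: eventually_at_top_linorder)
  then show ?thesis using smalloI_tendsto smalloD_tendsto by blast
qed

lemma const_over_n_tendsto_0: "(\<lambda>n. C / real n) \<longlonglongrightarrow> 0"
  using tendsto_mult[OF tendsto_const[of C] lim_inverse_n] by (simp add: divide_inverse)

lemma pow_pred_over_pow:
  assumes "1 \<le> v" "1 \<le> n"
  shows "real n ^ (v - 1) / real n ^ v = 1 / real n"
proof -
  have "real n ^ v = real n ^ (v - 1) * real n" using assms(1) by (cases v) simp_all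
  then show ?thesis using assms(2) by simp
qed

lemma binomial_over_power_tendsto: "(\<lambda>n. fact k * real (n choose k) / real n ^ k) \<longlonglongrightarrow> 1"
proof -
  have "(\<lambda>n. \<Prod>i = 0..<k. 1 - real i / real n) \<longlonglongrightarrow> (\<Prod>i = 0..<k. 1 - 0)"
    by (intro tendsto_prod tendsto_diff tendsto_const const_over_n_tendsto_0)
  then have "(\<lambda>n. \<Prod>i = 0..<k. 1 - real i / real n) \<longlonglongrightarrow> 1" by simp
  moreover have "eventually (\<lambda>n. (\<Prod>i = 0..<k. 1 - real i / real n)
      = fact k * real (n choose k) / real n ^ k) sequentially"
    using eventually_ge_at_top[of 1]
  proof eventually_elim
    case (elim n)
    have "fact k * real (n choose k) = (\<Prod>i = 0..<k. real n - real i)"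
      unfolding binomial_gbinomial gbinomial_mult_fact ..
    also have "\<dots> / real n ^ k = (\<Prod>i = 0..<k. (real n - real i) / real n)"
      by (simp add: prod_dividef)
    also have "\<dots> = (\<Prod>i = 0..<k. 1 - real i / real n)"
      using elim by (intro prod.cong) (auto simp: diff_divide_distrib)
    finally show ?case by simp
  qed
  ultimately show ?thesis by (rule Lim_transform_eventually)
qed

text \<open>A sequence of hypergraphs with loops, a partition of the uniformity and a density.\<close>

locale hypergraph_sequence =
  fixes H :: "nat \<Rightarrow> 'v loop_hypergraph" and ks :: "nat list" and k :: nat and p :: real
  assumes uniform: "\<And>n. uniform_loop_hypergraph k (H n)"
    and card_H: "\<And>n. card (verts (H n)) = n"
    and partition: "proper_partition k ks"
    and p: "0 < p" "p < 1"
begin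

lemma finite_verts_H: "finite (verts (H n))"
  using uniform by (simp add: uniform_loop_hypergraph_def)

lemma verts_H_nonempty: "n \<ge> 1 \<Longrightarrow> verts (H n) \<noteq> {}"
  using card_H[of n] by auto

lemma parts_ge_2: "length ks \<ge> 2" and parts_positive: "\<forall>x\<in>set ks. x \<ge> 1"
    and sum_parts: "sum_list ks = k"
  using partition by (auto simp: proper_partition_def)

lemma k_ge_1: "1 \<le> k"
proof -
  have "0 < length ks" using parts_ge_2 by linarith
  then have "ks ! 0 \<in> set ks" by simp
  then show ?thesis using parts_positive member_le_sum_list[of "ks ! 0" ks] sum_parts by fastforce
qed

lemma first_part_positive: "1 \<le> ks ! 0"
proof -
  have "0 < length ks" using parts_ge_2 by linarith
  then show ?thesis using parts_positive by simp
qed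

text \<open>The norm of the form \<open>J\<close>, that is, \<open>n\<close> to the power \<open>k / 2\<close>.\<close>

definition R :: "nat \<Rightarrow> real" where "R n = sqrt (real n ^ k)"

text \<open>The edge density, as it occurs in the second eigenvalue.\<close>

definition q :: "nat \<Rightarrow> real" where "q n = fact k * real (card (edges (H n))) / real n ^ k"

lemma R_pos: "n \<ge> 1 \<Longrightarrow> R n > 0" by (simp add: R_def)

lemma R_square: "R n * R n = real n ^ k" by (simp add: R_def)

lemma lambda2_q: "lambda2 ks (H n) = form_norm (\<lambda>e. edge_ind (H n) e - q n) (verts (H n)) ks"
  unfolding lambda2_eq[OF finite_verts_H] by (simp add: q_def card_H sum_parts)

lemma Eig_iff_tendsto:
  "Eig p ks H \<longleftrightarrow> (\<lambda>n. lambda1 ks (H n) / R n) \<longlonglongrightarrow> p \<and> (\<lambda>n. lambda2 ks (H n) / R n) \<longlonglongrightarrow> 0"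
proof -
  have R: "real n powr (real (sum_list ks) / 2) = R n" for n
    unfolding R_def sum_parts by (rule powr_half_eq_sqrt[OF k_ge_1])
  have Rne: "n \<ge> 1 \<Longrightarrow> R n \<noteq> 0" for n using R_pos[of n] by simp
  have "(\<lambda>n. (lambda1 ks (H n) - p * R n) / R n) \<longlonglongrightarrow> 0 \<longleftrightarrow> (\<lambda>n. lambda1 ks (H n) / R n) \<longlonglongrightarrow> p"
  proof -
    have "eventually (\<lambda>n. (lambda1 ks (H n) - p * R n) / R n
        = lambda1 ks (H n) / R n - p) sequentially"
      using eventually_ge_at_top[of 1] by eventually_elim (use Rne in \<open>auto simp:
          diff_divide_distrib\<close>)
    then have "(\<lambda>n. (lambda1 ks (H n) - p * R n) / R n) \<longlonglongrightarrow> 0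
        \<longleftrightarrow> (\<lambda>n. lambda1 ks (H n) / R n - p) \<longlonglongrightarrow> 0" by (rule tendsto_cong)
    then show ?thesis by (simp add: LIM_zero_iff)
  qed
  moreover have "f \<in> o(R) \<longleftrightarrow> (\<lambda>n. f n / R n) \<longlonglongrightarrow> 0" for f :: "nat \<Rightarrow> real"
    by (rule smallo_iff_quotient_tendsto_0[OF Rne])
  ultimately show ?thesis
    unfolding Eig_def R by simp
qed

lemma density_close: "(\<lambda>n. q n - edge_tuples (H n) k / real n ^ k) \<longlonglongrightarrow> 0"
proof (rule Lim_null_comparison[OF _ const_over_n_tendsto_0])
  show "\<forall>\<^sub>F n in sequentially. norm (q n - edge_tuples (H n) k / real n ^ k)
      \<le> fact k * real (k\<^sup>2) / real n"
    using eventually_ge_at_top[of 1]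
  proof eventually_elim
    case (elim n)
    have "norm (q n - edge_tuples (H n) k / real n ^ k)
        = \<bar>fact k * real (card (edges (H n))) - edge_tuples (H n) k\<bar> / real n ^ k"
      by (simp add: q_def diff_divide_distrib[symmetric])
    also have "\<dots> \<le> (fact k * real (k\<^sup>2) * real n ^ (k - 1)) / real n ^ k"
      using edge_tuples_vs_card_edges[OF uniform, of n]
          by (intro divide_right_mono) (auto simp: card_H)
    also have "\<dots> = fact k * real (k\<^sup>2) * (real n ^ (k - 1) / real n ^ k)" by simp
    also have "\<dots> = fact k * real (k\<^sup>2) / real n" using pow_pred_over_pow[OF k_ge_1 elim] by simp
    finally show ?case .
  qed
qed

lemma ones_le_form_norm:
  assumes "n \<ge> 1"
  shows "edge_tuples (H n) k / R n \<le> lambda1 ks (H n)"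
proof -
  let ?V = "verts (H n)"
  have "tensor_form (edge_ind (H n)) ?V ks (\<lambda>j x. 1 / sqrt (real n ^ (ks ! j)) * 1)
      = (\<Prod>j<length ks. 1 / sqrt (real n ^ (ks ! j))) * edge_tuples (H n) k"
    unfolding tensor_form_scale tensor_form_ones sum_parts ..
  also have "(\<Prod>j<length ks. 1 / sqrt (real n ^ (ks ! j))) = 1 / R n"
    by (simp add: prod_dividef prod_sqrt_powers R_def sum_parts)
  finally have "1 / R n * edge_tuples (H n) k
      \<le> \<bar>tensor_form (edge_ind (H n)) ?V ks (\<lambda>j x. 1 / sqrt (real n ^ (ks ! j)) * 1)\<bar>"
    by (metis abs_ge_self)
  also have "\<dots> \<le> form_norm (edge_ind (H n)) ?V ks"
  proof (rule form_norm_upper[OF finite_verts_H])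
    show "\<bar>edge_ind (H n) e\<bar> \<le> 1" for e by (simp add: edge_ind_bounds)
  qed (use assms finite_verts_H in \<open>auto simp: card_tuples card_H power_divide\<close>)
  finally show ?thesis unfolding lambda1_eq[OF finite_verts_H] by simp
qed

text \<open>The density hypothesis bounds \<open>q\<close> from below, and evaluating the first form at normalised
  all-ones tensors bounds it from above by the first eigenvalue.\<close>

lemma density_tendsto:
  assumes dense: "edge_dense p k H" and l1: "(\<lambda>n. lambda1 ks (H n) / R n) \<longlonglongrightarrow> p"
  shows "q \<longlonglongrightarrow> p"
proof -
  obtain err where err: "err \<in> o(\<lambda>n. real n ^ k)"
      "\<And>n. real (card (edges (H n))) \<ge> p * real (n choose k) + err n"
    using dense by (auto simp: edge_dense_def)
  have e0: "(\<lambda>n. err n / real n ^ k) \<longlonglongrightarrow> 0"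
    using smallo_iff_quotient_tendsto_0[of "\<lambda>n. real n ^ k" err] err(1) by simp
  have lower: "(\<lambda>n. p * (fact k * real (n choose k) / real n ^ k)
      + fact k * (err n / real n ^ k)) \<longlonglongrightarrow> p"
    using tendsto_add[OF tendsto_mult[OF tendsto_const[of p] binomial_over_power_tendsto[of k]]
        tendsto_mult[OF tendsto_const[of "fact k"] e0]] by simp
  have upper: "(\<lambda>n. lambda1 ks (H n) / R n + (q n - edge_tuples (H n) k / real n ^ k)) \<longlonglongrightarrow> p"
    using tendsto_add[OF l1 density_close] by simp
  show ?thesis
  proof (rule tendsto_sandwich[OF _ _ lower upper])
    show "\<forall>\<^sub>F n in sequentially. p * (fact k * real (n choose k) / real n ^ k)
        + fact k * (err n / real n ^ k) \<le> q n"
    proof (rule always_eventually, rule allI)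
      fix n
      have "fact k * (p * real (n choose k) + err n) / real n ^ k
          \<le> fact k * real (card (edges (H n))) / real n ^ k"
        using err(2)[of n] by (intro divide_right_mono mult_left_mono) auto
      then show "p * (fact k * real (n choose k) / real n ^ k) + fact k * (err n / real n ^ k)
          \<le> q n"
        by (simp add: q_def algebra_simps add_divide_distrib)
    qed
    show "\<forall>\<^sub>F n in sequentially. q n \<le> lambda1 ks (H n) / R n
        + (q n - edge_tuples (H n) k / real n ^ k)"
      using eventually_ge_at_top[of 1]
    proof eventually_elim
      case (elim n)
      have "edge_tuples (H n) k / R n / R n \<le> lambda1 ks (H n) / R n"
        using ones_le_form_norm[OF elim] R_pos[OF elim] by (intro divide_right_mono) auto
      then show ?case by (simp add: R_square)
    qed
  qed
qed

lemma Eig_imp_Expand: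
  assumes dense: "edge_dense p k H" and eig: "Eig p ks H"
  shows "Expand p ks H"
proof -
  have l1: "(\<lambda>n. lambda1 ks (H n) / R n) \<longlonglongrightarrow> p" and l2: "(\<lambda>n. lambda2 ks (H n) / R n) \<longlonglongrightarrow> 0"
    using eig unfolding Eig_iff_tendsto by auto
  have q: "q \<longlonglongrightarrow> p" using density_tendsto[OF dense l1] .
  define r where "r n = R n * \<bar>lambda2 ks (H n)\<bar> + \<bar>q n - p\<bar> * real n ^ k" for n
  have "(\<lambda>n. r n / real n ^ k) \<longlonglongrightarrow> 0"
  proof -
    have "(\<lambda>n. \<bar>lambda2 ks (H n) / R n\<bar> + \<bar>q n - p\<bar>) \<longlonglongrightarrow> 0"
      using tendsto_add[OF tendsto_rabs[OF l2] tendsto_rabs[OF tendsto_diff[OF q tendsto_const[of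
          p]]]] by simp
    moreover have "eventually (\<lambda>n. \<bar>lambda2 ks (H n) / R n\<bar> + \<bar>q n - p\<bar>
        = r n / real n ^ k) sequentially"
      using eventually_ge_at_top[of 1]
    proof eventually_elim
      case (elim n)
      have "R n > 0" using R_pos[OF elim] .
      then show ?case
        unfolding r_def R_square[symmetric] by (simp add: abs_divide add_divide_distrib)
    qed
    ultimately show ?thesis by (rule Lim_transform_eventually)
  qed
  then have "r \<in> o(\<lambda>n. real n ^ sum_list ks)"
    unfolding sum_parts by (subst smallo_iff_quotient_tendsto_0) auto
  moreover have "\<bar>real (expand_count (H n) Ss) - p * (\<Prod>S\<leftarrow>Ss. real (card S))\<bar> \<le> r n"
    if Ss: "list_all2 (\<lambda>S m. S \<subseteq> {s. s \<subseteq> verts (H n) \<and> card s = m}) Ss ks" for n Ss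
  proof -
    let ?V = "verts (H n)" and ?t = "length ks"
    define S where "S j = Ss ! j" for j
    have Ss_eq: "Ss = map S [0..<?t]"
      using list_all2_lengthD[OF Ss] by (intro nth_equalityI) (auto simp: S_def)
    have S: "S j \<subseteq> {s. s \<subseteq> ?V \<and> card s = ks ! j}" if "j < ?t" for j
      using list_all2_nthD2[OF Ss that] by (simp add: S_def)
    have r0: "0 \<le> r n" by (auto simp: r_def R_def)
    show ?thesis
    proof (cases "n = 0")
      case True
      \<comment> \<open>blocks are nonempty, so there are no sets to consider\<close>
      then have "?V = {}" using card_H[of n] finite_verts_H[of n] by simp
      moreover have "1 \<le> ks ! j" if "j < ?t" for j using parts_positive that nth_mem by blast
      ultimately have "S j = {}" if "j < ?t" for j using S[OF that] that by fastforce
      moreover have "0 < ?t" using parts_ge_2 by linarith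
      ultimately have "Pi\<^sub>E {..<?t} S = {}" by (auto simp: PiE_eq_empty_iff)
      moreover have "real (expand_count (H n) (map S [0..<?t])) - p
          * (\<Prod>X\<leftarrow>map S [0..<?t]. real (card X))
          = (\<Sum>Y\<in>Pi\<^sub>E {..<?t} S. edge_ind (H n) (\<Sum>j<?t. mset_set (Y j)) - p)"
        by (rule expand_count_deviation[OF finite_verts_H S])
      ultimately show ?thesis unfolding Ss_eq using r0 by (simp only: sum.empty abs_zero)
    next
      case False
      then have n: "n \<ge> 1" by simp
      let ?P = "\<Prod>X\<leftarrow>map S [0..<?t]. real (card X)"
      have "\<bar>real (expand_count (H n) (map S [0..<?t])) - q n * ?P\<bar>
          \<le> sqrt (real (card ?V) ^ sum_list ks) * form_norm (\<lambda>e. edge_ind (H n) e - q n) ?V ks"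
        by (rule expand_deviation_le_form_norm[OF finite_verts_H verts_H_nonempty[OF n] order_refl
            S])
      also have "\<dots> = R n * lambda2 ks (H n)" by (simp add: lambda2_q card_H sum_parts R_def)
      also have "\<dots> \<le> R n * \<bar>lambda2 ks (H n)\<bar>" using R_pos[OF n] by (intro mult_left_mono) auto
      finally have 1: "\<bar>real (expand_count (H n) (map S [0..<?t])) - q n * ?P\<bar>
          \<le> R n * \<bar>lambda2 ks (H n)\<bar>" .
      have P: "0 \<le> ?P" "?P \<le> real n ^ k"
      proof -
        have eq: "?P = (\<Prod>j<?t. real (card (S j)))"
          by (simp add: prod.list_conv_set_nth o_def atLeast0LessThan)
        show "0 \<le> ?P" unfolding eq by (intro prod_nonneg) auto
        have "?P \<le> (\<Prod>j<?t. real n ^ (ks ! j))"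
          unfolding eq
        proof (intro prod_mono conjI)
          fix j assume "j \<in> {..<?t}"
          then have j: "j < ?t" by simp
          have "finite s" if "s \<in> S j" for s using S[OF j] that finite_verts_H finite_subset
              by blast
          then have "inj_on enum_set (S j)" by (intro inj_on_subset[OF inj_on_enum_set]) auto
          moreover have "enum_set ` S j \<subseteq> tuples ?V (ks ! j)"
              using S[OF j] enum_set_tuples[OF finite_verts_H] by auto
          ultimately have "card (S j) \<le> card (tuples ?V (ks ! j))"
            by (rule card_inj_on_le[OF _ _ finite_tuples[OF finite_verts_H]])
          then have "real (card (S j)) \<le> real (card ?V ^ (ks ! j))"
            unfolding card_tuples[OF finite_verts_H] by (rule of_nat_mono)
          then show "real (card (S j)) \<le> real n ^ (ks ! j)" by (simp add: card_H)
        qed auto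
        also have "\<dots> = real n ^ k"
          by (simp add: power_sum[symmetric] sum_parts[symmetric] sum_list_sum_nth atLeast0LessThan)
        finally show "?P \<le> real n ^ k" .
      qed
      have "\<bar>q n * ?P - p * ?P\<bar> \<le> \<bar>q n - p\<bar> * real n ^ k"
        unfolding left_diff_distrib[symmetric] abs_mult using P by (intro mult_left_mono) auto
      then show ?thesis unfolding Ss_eq r_def using 1 by linarith
    qed
  qed
  ultimately show ?thesis unfolding Expand_def by blast
qed

lemma Expand_imp_Count:
  assumes "Expand p ks H"
  shows "Count_linear p ks H"
  unfolding Count_linear_def
proof (intro allI impI)
  fix F :: "nat hypergraph"
  assume F: "uniform_hypergraph (sum_list ks) F \<and> pi_linear ks F"
  then have u: "uniform_hypergraph k F" and lin: "pi_linear ks F" by (auto simp: sum_parts)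
  obtain r where r: "r \<in> o(\<lambda>n. real n ^ k)"
    and dev: "\<And>n Ss. list_all2 (\<lambda>S m. S \<subseteq> {s. s \<subseteq> verts (H n) \<and> card s = m}) Ss ks \<Longrightarrow>
        \<bar>real (expand_count (H n) Ss) - p * (\<Prod>S\<leftarrow>Ss. real (card S))\<bar> \<le> r n"
    using assms unfolding Expand_def sum_parts by blast
  have r0: "(\<lambda>n. r n / real n ^ k) \<longlonglongrightarrow> 0"
    using smallo_iff_quotient_tendsto_0[of "\<lambda>n. real n ^ k" r] r by simp
  define f where "f = card (verts F)"
  define m where "m = card (edges F)"
  define K where "K = real (k ^ k) ^ length ks"
  let ?X = "\<lambda>n. real (card (labeled_copies F (H n))) - p ^ m * real n ^ f"
  have bound: "\<bar>?X n\<bar> \<le> real m * (K * r n * real n ^ (f - k) + real (f\<^sup>2) * real n ^ (f - 1))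
      + real (f\<^sup>2) * real n ^ (f - 1)" for n
  proof -
    have "\<bar>hom_sum (edge_ind (H n)) F (verts (H n)) - p ^ m * real n ^ f\<bar>
        \<le> real m * (K * r n * real n ^ (f - k) + real (f\<^sup>2) * real n ^ (f - 1))"
      using linear_hom_sum_bound[OF finite_verts_H u lin partition _ _ dev, of n] p
      by (simp add: f_def m_def K_def card_H)
    moreover have "\<bar>real (card (labeled_copies F (H n))) - hom_sum (edge_ind (H n)) F (verts (H n))\<bar>
        \<le> real (f\<^sup>2) * real n ^ (f - 1)"
      using labeled_copies_vs_hom_sum[OF u finite_verts_H, of n] by (simp add: f_def card_H)
    ultimately show ?thesis by linarith
  qed
  have "(\<lambda>n. ?X n / real n ^ f) \<longlonglongrightarrow> 0"
  proof (cases "m = 0 \<and> f = 0")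
    case True
    then have "?X n = 0" for n using bound[of n] by simp
    then show ?thesis by simp
  next
    case False
    have fk: "f \<ge> k" if "m \<noteq> 0"
    proof -
      have "edges F \<noteq> {}" using \<open>m \<noteq> 0\<close> by (auto simp: m_def)
      then obtain e where "e \<in> edges F" by blast
      then have "e \<subseteq> verts F" "card e = k" "finite (verts F)"
          using u by (auto simp: uniform_hypergraph_def)
      then show ?thesis unfolding f_def using card_mono by metis
    qed
    have f1: "f \<ge> 1" using False fk k_ge_1 by (cases "m = 0") auto
    let ?Y = "\<lambda>n. real m * (K * (r n / real n ^ k) + real (f\<^sup>2) / real n) + real (f\<^sup>2) / real n"
    have Y: "?Y \<longlonglongrightarrow> real m * (K * 0 + 0) + 0"
      by (intro tendsto_add tendsto_mult tendsto_const r0 const_over_n_tendsto_0)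
    show ?thesis
    proof (rule Lim_null_comparison[where g = ?Y])
      show "?Y \<longlonglongrightarrow> 0" using Y by simp
      show "\<forall>\<^sub>F n in sequentially. norm (?X n / real n ^ f) \<le> ?Y n"
        using eventually_ge_at_top[of 1]
      proof eventually_elim
        case (elim n)
        have a: "real m * (real n ^ (f - k) / real n ^ f) = real m * (1 / real n ^ k)"
        proof (cases "m = 0")
          case False
          have "real n ^ f = real n ^ (f - k) * real n ^ k"
            using fk[OF False] by (simp add: power_add[symmetric])
          then show ?thesis using elim by simp
        qed simp
        have b: "real n ^ (f - 1) / real n ^ f = 1 / real n" using pow_pred_over_pow[OF f1 elim] .
        have "norm (?X n / real n ^ f) \<le> (real m * (K * r n * real n ^ (f - k)
            + real (f\<^sup>2) * real n ^ (f - 1))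
            + real (f\<^sup>2) * real n ^ (f - 1)) / real n ^ f"
          unfolding norm_divide using bound[of n] by (simp add: divide_right_mono)
        also have "\<dots> = K * r n * (real m * (real n ^ (f - k) / real n ^ f))
            + (real m * real (f\<^sup>2) + real (f\<^sup>2)) * (real n ^ (f - 1) / real n ^ f)"
          by (simp add: add_divide_distrib algebra_simps)
        also have "\<dots> = ?Y n" unfolding a b by (simp add: add_divide_distrib algebra_simps)
        finally show ?case .
      qed
    qed
  qed
  then show "(\<lambda>n. real (card (labeled_copies F (H n))) - p ^ card (edges F)
      * real n ^ card (verts F))
      \<in> o(\<lambda>n. real n ^ card (verts F))"
    unfolding f_def m_def by (subst smallo_iff_quotient_tendsto_0) auto
qed

end

section \<open>Transport of linear hypergraphs along injections\<close>

lemma pi_linear_image: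
  assumes u: "uniform_hypergraph k F" and lin: "pi_linear ks F" and h: "inj_on h (verts F)"
  shows "pi_linear ks (image_hypergraph h F)"
proof -
  obtain es where es: "distinct es" "set es = edges F"
    and A: "\<And>i. i < length es \<Longrightarrow> \<exists>A. disjoint_family_on A {..<length ks} \<and>
      (\<Union>s<length ks. A s) = es ! i \<and> (\<forall>s<length ks. card (A s) = ks ! s) \<and>
      (\<forall>j<i. \<exists>s<length ks. es ! j \<inter> es ! i \<subseteq> A s)"
    using lin unfolding pi_linear_def by blast
  have sub: "e \<subseteq> verts F" if "e \<in> set es" for e
    using u that es by (auto simp: uniform_hypergraph_def)
  have inj: "inj_on ((`) h) (edges F)"
    using sub es(2) by (intro inj_onI) (metis h inj_on_image_eq_iff)
  show ?thesis
    unfolding pi_linear_def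
  proof (intro exI[of _ "map ((`) h) es"] conjI allI impI)
    show "distinct (map ((`) h) es)" using es inj by (simp add: distinct_map)
    show "set (map ((`) h) es) = edges (image_hypergraph h F)"
      using es by (simp add: image_hypergraph_def)
    fix i assume "i < length (map ((`) h) es)"
    then have i: "i < length es" by simp
    obtain B where B: "disjoint_family_on B {..<length ks}" "(\<Union>s<length ks. B s) = es ! i"
        "\<And>s. s < length ks \<Longrightarrow> card (B s) = ks ! s"
        "\<And>j. j < i \<Longrightarrow> \<exists>s<length ks. es ! j \<inter> es ! i \<subseteq> B s"
      using A[OF i] by metis
    have ei: "es ! i \<subseteq> verts F" using sub i by simp
    have Bs: "B s \<subseteq> verts F" if "s < length ks" for s using B(2) ei that by auto
    have "disjoint_family_on (\<lambda>s. h ` B s) {..<length ks}"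
      unfolding disjoint_family_on_def
    proof (intro ballI impI)
      fix s s' assume s: "s \<in> {..<length ks}" "s' \<in> {..<length ks}" "s \<noteq> s'"
      then have "h ` B s \<inter> h ` B s' = h ` (B s \<inter> B s')"
        using inj_on_image_Int[OF h Bs Bs] by simp
      also have "\<dots> = {}" using B(1) s by (auto simp: disjoint_family_on_def)
      finally show "h ` B s \<inter> h ` B s' = {}" .
    qed
    moreover have "(\<Union>s<length ks. h ` B s) = map ((`) h) es ! i"
      using B(2) i by (simp flip: image_UN)
    moreover have "\<forall>s<length ks. card (h ` B s) = ks ! s"
      using B(3) Bs by (metis card_image inj_on_subset h)
    moreover have "\<forall>j<i. \<exists>s<length ks. map ((`) h) es ! j \<inter> map ((`) h) es ! i \<subseteq> h ` B s"
    proof (intro allI impI)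
      fix j assume j: "j < i"
      then obtain s where s: "s < length ks" "es ! j \<inter> es ! i \<subseteq> B s" using B(4) by blast
      have "h ` (es ! j) \<inter> h ` (es ! i) = h ` (es ! j \<inter> es ! i)"
        using inj_on_image_Int[OF h, of "es ! j" "es ! i"] sub i j by simp
      then show "\<exists>s<length ks. map ((`) h) es ! j \<inter> map ((`) h) es ! i \<subseteq> h ` B s"
        using s i j by (intro exI[of _ s]) auto
    qed
    ultimately show "\<exists>A. disjoint_family_on A {..<length ks} \<and>
        (\<Union>s<length ks. A s) = map ((`) h) es ! i \<and> (\<forall>s<length ks. card (A s) = ks ! s) \<and>
        (\<forall>j<i. \<exists>s<length ks. map ((`) h) es ! j \<inter> map ((`) h) es ! i \<subseteq> A s)"
      by (intro exI[of _ "\<lambda>s. h ` B s"]) blast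
  qed
qed

lemma uniform_image:
  assumes u: "uniform_hypergraph k F" and h: "inj_on h (verts F)"
  shows "uniform_hypergraph k (image_hypergraph h F)"
  using u inj_on_subset[OF h] by (auto simp: uniform_hypergraph_def image_hypergraph_def card_image)

lemma card_image_hypergraph:
  assumes u: "uniform_hypergraph k F" and h: "inj_on h (verts F)"
  shows "card (verts (image_hypergraph h F)) = card (verts F)"
    and "card (edges (image_hypergraph h F)) = card (edges F)"
proof -
  show "card (verts (image_hypergraph h F)) = card (verts F)"
    using h by (simp add: image_hypergraph_def card_image)
  have "inj_on ((`) h) (edges F)"
    using u by (intro inj_onI) (metis h inj_on_image_eq_iff uniform_hypergraph_def)
  then show "card (edges (image_hypergraph h F)) = card (edges F)"
    by (simp add: image_hypergraph_def card_image)
qed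

lemma card_labeled_copies_image:
  assumes u: "uniform_hypergraph k F" and h: "inj_on h (verts F)" and V: "finite (verts H)"
  shows "card (labeled_copies F H) \<le> card (labeled_copies (image_hypergraph h F) H)"
proof (rule card_inj_on_le)
  let ?h' = "inv_into (verts F) h"
  let ?T = "\<lambda>\<phi>. \<lambda>y\<in>h ` verts F. \<phi> (?h' y)"
  have h': "?h' (h x) = x" if "x \<in> verts F" for x using inv_into_f_f[OF h that] .
  show "inj_on ?T (labeled_copies F H)"
  proof (rule inj_onI)
    fix \<phi> \<psi> assume a: "\<phi> \<in> labeled_copies F H" "\<psi> \<in> labeled_copies F H" "?T \<phi> = ?T \<psi>"
    show "\<phi> = \<psi>"
    proof (rule PiE_ext[of _ "verts F" "\<lambda>_. verts H"])
      fix x assume x: "x \<in> verts F"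
      then show "\<phi> x = \<psi> x" using fun_cong[OF a(3), of "h x"] h'[OF x] by simp
    qed (use a in \<open>auto simp: labeled_copies_def\<close>)
  qed
  show "?T ` labeled_copies F H \<subseteq> labeled_copies (image_hypergraph h F) H"
  proof (rule image_subsetI)
    fix \<phi> assume p: "\<phi> \<in> labeled_copies F H"
    have "?T \<phi> \<in> h ` verts F \<rightarrow>\<^sub>E verts H"
      using p h' by (auto simp: labeled_copies_def PiE_iff)
    moreover have "inj_on (?T \<phi>) (h ` verts F)"
    proof (rule inj_onI)
      fix y y' assume y: "y \<in> h ` verts F" "y' \<in> h ` verts F" and eq: "?T \<phi> y = ?T \<phi> y'"
      obtain x x' where x: "x \<in> verts F" "x' \<in> verts F" "y = h x" "y' = h x'" using y by blast
      have "\<phi> x = \<phi> x'" using eq x h'[OF x(1)] h'[OF x(2)] by simp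
      moreover have "inj_on \<phi> (verts F)" using p by (simp add: labeled_copies_def)
      ultimately have "x = x'" using x(1,2) by (auto dest: inj_onD)
      then show "y = y'" using x by simp
    qed
    moreover have "image_mset (?T \<phi>) (mset_set (h ` e)) \<in> edges H" if e: "e \<in> edges F" for e
    proof -
      have sub: "e \<subseteq> verts F" and fe: "finite e"
        using u e by (auto simp: uniform_hypergraph_def intro: finite_subset)
      have "image_mset (?T \<phi>) (mset_set (h ` e)) = image_mset (?T \<phi> \<circ> h) (mset_set e)"
        using inj_on_subset[OF h sub] by (simp add: multiset.map_comp flip: image_mset_mset_set)
      also have "\<dots> = image_mset \<phi> (mset_set e)"
      proof (rule image_mset_cong)
        fix x assume "x \<in># mset_set e"
        then have x: "x \<in> verts F" using sub fe by auto
        then show "(?T \<phi> \<circ> h) x = \<phi> x" by (simp add: h'[OF x])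
      qed
      finally show ?thesis using p e by (simp add: labeled_copies_def)
    qed
    ultimately show "?T \<phi> \<in> labeled_copies (image_hypergraph h F) H"
      by (simp add: labeled_copies_def image_hypergraph_def)
  qed
  have "finite (verts F)" using u by (simp add: uniform_hypergraph_def)
  then have "finite ((h ` verts F) \<rightarrow>\<^sub>E verts H)" using V by (intro finite_PiE) auto
  then show "finite (labeled_copies (image_hypergraph h F) H)"
    by (rule finite_subset[rotated]) (auto simp: labeled_copies_def image_hypergraph_def)
qed

section \<open>Counts of cycles\<close>

context hypergraph_sequence
begin

context
  fixes r :: nat
  assumes r: "r \<ge> 2"
begin

text \<open>The numbers of vertices and of edges of the cycle.\<close>

abbreviation "cv \<equiv> card (verts (step_cycle ks r))"
abbreviation "ce \<equiv> card (edges (step_cycle ks r))"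

lemma cv1: "1 \<le> cv"
proof -
  have "2 * cv > 0" unfolding card_verts_cycle[OF partition r] using k_ge_1 r by simp
  then show ?thesis by simp
qed

lemma Cycle_iff_hom_sum:
  "Cycle p ks r H \<longleftrightarrow> (\<forall>\<epsilon>>0. eventually (\<lambda>n. hom_sum (edge_ind (H n)) (step_cycle ks r) (verts (H n))
      \<le> (p ^ ce + \<epsilon>) * real n ^ cv) sequentially)"
proof
  let ?c = "\<lambda>n. real (card (labeled_copies (step_cycle ks r) (H n)))"
  let ?h = "\<lambda>n. hom_sum (edge_ind (H n)) (step_cycle ks r) (verts (H n))"
  note cmp = labeled_copies_vs_hom_sum[OF uniform_step_cycle[OF partition r] finite_verts_H,
      unfolded card_H]
  {
    assume "Cycle p ks r H"
    then obtain err where err: "err \<in> o(\<lambda>n. real n ^ cv)" "\<And>n. ?c n \<le> p ^ ce * real n ^ cv + err n"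
      unfolding Cycle_def by blast
    have e0: "(\<lambda>n. err n / real n ^ cv + real (cv\<^sup>2) / real n) \<longlonglongrightarrow> 0 + 0"
      using smallo_iff_quotient_tendsto_0[of "\<lambda>n. real n ^ cv" err] err(1)
      by (intro tendsto_add const_over_n_tendsto_0) simp
    show "\<forall>\<epsilon>>0. eventually (\<lambda>n. ?h n \<le> (p ^ ce + \<epsilon>) * real n ^ cv) sequentially"
    proof (intro allI impI)
      fix \<epsilon> :: real assume "\<epsilon> > 0"
      then have "eventually (\<lambda>n. err n / real n ^ cv + real (cv\<^sup>2) / real n < \<epsilon>) sequentially"
        using order_tendstoD(2)[OF e0, of \<epsilon>] by simp
      then show "eventually (\<lambda>n. ?h n \<le> (p ^ ce + \<epsilon>) * real n ^ cv) sequentially"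
        using eventually_ge_at_top[of 1]
      proof eventually_elim
        case (elim n)
        have np: "real n ^ cv > 0" using elim by simp
        have "?h n \<le> p ^ ce * real n ^ cv + err n + real (cv\<^sup>2) * real n ^ (cv - 1)"
          using cmp(2)[of n] err(2)[of n] by simp
        also have "err n + real (cv\<^sup>2) * real n ^ (cv - 1)
            = (err n / real n ^ cv + real (cv\<^sup>2) * (real n ^ (cv - 1) / real n ^ cv)) * real n ^ cv"
          using np by (simp add: algebra_simps)
        then have "p ^ ce * real n ^ cv + err n + real (cv\<^sup>2) * real n ^ (cv - 1)
            = p ^ ce * real n ^ cv + (err n / real n ^ cv + real (cv\<^sup>2) / real n) * real n ^ cv"
          unfolding pow_pred_over_pow[OF cv1 elim(2)] by simp
        also have "\<dots> \<le> p ^ ce * real n ^ cv + \<epsilon> * real n ^ cv"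
          using elim np by (intro add_left_mono mult_right_mono) auto
        finally show ?case by (simp add: algebra_simps)
      qed
    qed
  }
  {
    assume A: "\<forall>\<epsilon>>0. eventually (\<lambda>n. ?h n \<le> (p ^ ce + \<epsilon>) * real n ^ cv) sequentially"
    define err where "err n = max 0 (?c n - p ^ ce * real n ^ cv)" for n
    have "err \<in> o(\<lambda>n. real n ^ cv)"
    proof (rule landau_o.smallI)
      fix \<epsilon> :: real assume "\<epsilon> > 0"
      then have "eventually (\<lambda>n. ?h n \<le> (p ^ ce + \<epsilon>) * real n ^ cv) sequentially" using A by blast
      then show "eventually (\<lambda>n. norm (err n) \<le> \<epsilon> * norm (real n ^ cv)) sequentially"
      proof eventually_elim
        case (elim n)
        then have "?c n - p ^ ce * real n ^ cv \<le> \<epsilon> * real n ^ cv"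
          using cmp(1)[of n] by (simp add: algebra_simps)
        moreover have "0 \<le> \<epsilon> * real n ^ cv" using \<open>\<epsilon> > 0\<close> by simp
        ultimately show ?case by (simp add: err_def)
      qed
    qed
    moreover have "\<forall>n. ?c n \<le> p ^ ce * real n ^ cv + err n" by (auto simp: err_def max_def)
    ultimately show "Cycle p ks r H" unfolding Cycle_def by blast
  }
qed

lemma Count_imp_Cycle:
  assumes "Count_linear p ks H"
  shows "Cycle p ks r H"
proof -
  let ?C = "step_cycle ks r"
  have u: "uniform_hypergraph k ?C" using uniform_step_cycle[OF partition r] .
  then have "finite (verts ?C)" by (simp add: uniform_hypergraph_def)
  then obtain h :: "nat \<times> step_vertex \<Rightarrow> nat" where h: "inj_on h (verts ?C)"
    using finite_imp_inj_to_nat_seg by metis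
  let ?F = "image_hypergraph h ?C"
  have "(\<lambda>n. real (card (labeled_copies ?F (H n))) - p ^ card (edges ?F) * real n ^ card (verts ?F))
      \<in> o(\<lambda>n. real n ^ card (verts ?F))"
    using assms uniform_image[OF u h] pi_linear_image[OF u pi_linear_step_cycle[OF partition r] h]
    unfolding Count_linear_def sum_parts by blast
  then have o: "(\<lambda>n. real (card (labeled_copies ?F (H n))) - p ^ ce
      * real n ^ cv) \<in> o(\<lambda>n. real n ^ cv)"
    unfolding card_image_hypergraph[OF u h] .
  moreover have "real (card (labeled_copies ?C (H n))) \<le> p ^ ce * real n ^ cv
      + (real (card (labeled_copies ?F (H n))) - p ^ ce * real n ^ cv)" for n
    using card_labeled_copies_image[OF u h finite_verts_H, of n] by simp
  ultimately show ?thesis unfolding Cycle_def by (intro bexI[OF _ o] allI)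
qed

end

text \<open>The trace of the power \<open>2 * l\<close> of the transfer matrix is at most the \<open>l\<close>th power of the
  trace of its square.\<close>

lemma Cycle_imp_Cycle_multiple:
  assumes l: "l \<ge> 1" and C: "Cycle p ks 2 H"
  shows "Cycle p ks (2 * l) H"
proof -
  have r: "2 * l \<ge> 2" using l by simp
  let ?v = "\<lambda>r. card (verts (step_cycle ks r))" and ?e = "\<lambda>r. card (edges (step_cycle ks r))"
  let ?h = "\<lambda>r n. hom_sum (edge_ind (H n)) (step_cycle ks r) (verts (H n))"
  have e: "?e (2 * l) = ?e 2 * l"
    by (simp add: card_edges_cycle[OF partition r] card_edges_cycle[OF partition order_refl])
  have v: "?v (2 * l) = ?v 2 * l"
    using card_verts_cycle[OF partition r] card_verts_cycle[OF partition order_refl]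
        by (simp add: mult_ac)
  have le: "?h (2 * l) n \<le> (?h 2 n) ^ l" for n
  proof -
    let ?D = "attach_index ks \<rightarrow>\<^sub>E verts (H n)"
    have D: "finite ?D" using finite_attach_index finite_verts_H by (intro finite_PiE) auto
    show ?thesis
      unfolding hom_sum_cycle_eq_trace[OF parts_ge_2 r parts_positive finite_verts_H]
          hom_sum_cycle_eq_trace[OF parts_ge_2 order_refl parts_positive finite_verts_H]
      by (rule mat_trace_pow_submult[OF D step_matrix_sym[OF parts_ge_2 first_part_positive
          finite_verts_H] l])
  qed
  have nonneg: "0 \<le> ?h r n" for r n
    unfolding hom_sum_def hom_weight_def by (intro sum_nonneg prod_nonneg) (simp add:
        edge_ind_bounds)
  show ?thesis
    unfolding Cycle_iff_hom_sum[OF r]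
  proof (intro allI impI)
    fix \<epsilon> :: real assume \<epsilon>: "\<epsilon> > 0"
    \<comment> \<open>\<open>\<delta>\<close> is chosen so small that the \<open>l\<close>th power of the bound stays below \<open>p ^ ?e (2 * l) + \<epsilon>\<close>\<close>
    have "((\<lambda>\<delta>. (p ^ ?e 2 + \<delta>) ^ l) \<longlongrightarrow> (p ^ ?e 2 + 0) ^ l) (at_right 0)"
      by (intro tendsto_power tendsto_add tendsto_const tendsto_ident_at)
    then have "eventually (\<lambda>\<delta>. (p ^ ?e 2 + \<delta>) ^ l < p ^ ?e (2 * l) + \<epsilon>) (at_right 0)"
      using \<epsilon> by (intro order_tendstoD(2)) (auto simp: e power_mult)
    moreover have "eventually (\<lambda>\<delta>::real. \<delta> > 0) (at_right 0)"
        by (simp add: eventually_at_right_less)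
    ultimately have "eventually (\<lambda>\<delta>. (p ^ ?e 2 + \<delta>) ^ l < p ^ ?e (2 * l) + \<epsilon> \<and> \<delta> > 0) (at_right 0)"
      by (rule eventually_conj)
    then obtain \<delta> where \<delta>: "(p ^ ?e 2 + \<delta>) ^ l < p ^ ?e (2 * l) + \<epsilon>" "\<delta> > 0"
      using eventually_happens[of _ "at_right (0::real)"] trivial_limit_at_right_real by blast
    have "eventually (\<lambda>n. ?h 2 n \<le> (p ^ ?e 2 + \<delta>) * real n ^ ?v 2) sequentially"
      using C \<delta>(2) unfolding Cycle_iff_hom_sum[OF order_refl] by blast
    then show "eventually (\<lambda>n. ?h (2 * l) n \<le> (p ^ ?e (2 * l)
        + \<epsilon>) * real n ^ ?v (2 * l)) sequentially"
    proof eventually_elim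
      case (elim n)
      have "?h (2 * l) n \<le> ((p ^ ?e 2 + \<delta>) * real n ^ ?v 2) ^ l"
        using le[of n] power_mono[OF elim nonneg, of l] by linarith
      also have "\<dots> = (p ^ ?e 2 + \<delta>) ^ l * real n ^ ?v (2 * l)"
        by (simp add: power_mult_distrib v power_mult)
      also have "\<dots> \<le> (p ^ ?e (2 * l) + \<epsilon>) * real n ^ ?v (2 * l)"
        using \<delta>(1) by (intro mult_right_mono) auto
      finally show ?case .
    qed
  qed
qed

section \<open>From cycle counts to eigenvalues\<close>

context
  assumes coregular: "\<And>n. coregular k (nat \<lfloor>p * real n\<rfloor>) (H n)"
begin

text \<open>The exact density of tuples forming an edge in a coregular hypergraph.\<close>

definition c :: "nat \<Rightarrow> real" where "c n = real (nat \<lfloor>p * real n\<rfloor>) / real n"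

lemma c_tendsto: "c \<longlonglongrightarrow> p"
proof (rule tendsto_sandwich[of "\<lambda>n. p - 1 / real n" _ _ "\<lambda>_. p"])
  have fl: "real (nat \<lfloor>p * real n\<rfloor>) = of_int \<lfloor>p * real n\<rfloor>" for n
    using p by simp
  show "\<forall>\<^sub>F n in sequentially. p - 1 / real n \<le> c n"
    using eventually_ge_at_top[of 1]
  proof eventually_elim
    case (elim n)
    have "(p * real n - 1) / real n \<le> of_int \<lfloor>p * real n\<rfloor> / real n"
      by (intro divide_right_mono) linarith+
    then show ?case using elim unfolding c_def fl by (simp add: diff_divide_distrib)
  qed
  show "\<forall>\<^sub>F n in sequentially. c n \<le> p"
    using eventually_ge_at_top[of 1]
  proof eventually_elim
    case (elim n)
    then show ?case unfolding c_def fl by (simp add: divide_le_eq)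
  qed
  show "(\<lambda>n. p - 1 / real n) \<longlonglongrightarrow> p"
    using tendsto_diff[OF tendsto_const[of p] const_over_n_tendsto_0[of 1]] by simp
qed simp

lemma edge_tuples_eq: "n \<ge> 1 \<Longrightarrow> edge_tuples (H n) k = c n * real n ^ k"
proof -
  assume n: "n \<ge> 1"
  have "real n ^ k = real n ^ (k - 1) * real n" using k_ge_1 by (cases k) simp_all
  then show ?thesis
    using edge_tuples_coregular[OF uniform coregular k_ge_1, of n] n by (simp add: c_def card_H)
qed

lemma q_tendsto: "q \<longlonglongrightarrow> p"
proof -
  have "(\<lambda>n. (q n - edge_tuples (H n) k / real n ^ k) + c n) \<longlonglongrightarrow> p"
    using tendsto_add[OF density_close c_tendsto] by simp
  moreover have "eventually (\<lambda>n. (q n - edge_tuples (H n) k / real n ^ k) + c n = q n) sequentially"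
    using eventually_ge_at_top[of 1] by eventually_elim (simp add: edge_tuples_eq)
  ultimately show ?thesis by (rule Lim_transform_eventually)
qed

lemma coregular_imp_edge_dense: "edge_dense p k H"
proof -
  define err where "err n = real (card (edges (H n))) - p * real (n choose k)" for n
  have "(\<lambda>n. (q n - p * (fact k * real (n choose k) / real n ^ k)) / fact k) \<longlonglongrightarrow> (p - p * 1) / fact k"
    by (intro tendsto_divide tendsto_diff tendsto_mult tendsto_const q_tendsto
        binomial_over_power_tendsto) simp
  moreover have eq: "(\<lambda>n. (q n - p * (fact k * real (n choose k) / real n ^ k)) / fact k)
      = (\<lambda>n. err n / real n ^ k)"
    by (rule ext) (simp add: q_def err_def diff_divide_distrib)
  ultimately have "(\<lambda>n. err n / real n ^ k) \<longlonglongrightarrow> 0" unfolding eq by simp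
  then have "err \<in> o(\<lambda>n. real n ^ k)" by (subst smallo_iff_quotient_tendsto_0) auto
  moreover have "\<forall>n. real (card (edges (H n))) \<ge> p * real (n choose k)
      + err n" by (simp add: err_def)
  ultimately show ?thesis unfolding edge_dense_def by blast
qed

lemma centered_marginal:
  assumes "set_mset S \<subseteq> verts (H n)" "size S = k - 1" "n \<ge> 1"
  shows "(\<Sum>x\<in>verts (H n). edge_ind (H n) (add_mset x S) - c n) = 0"
  using coregular_marginal[OF uniform coregular k_ge_1 assms(1,2)] assms(3)
  by (simp add: sum_subtractf card_H c_def)

text \<open>Subtracting \<open>c n\<close> makes all one-point marginals vanish, so the cycle sum of the centred
  indicator is the number of homomorphisms of the cycle minus its main term. It is therefore
  small, and it bounds a power of the centred tensor form.\<close>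

lemma Cycle_imp_centered_norm_small:
  assumes l: "l \<ge> 1" and C: "Cycle p ks (2 * l) H" and \<epsilon>: "\<epsilon> > 0"
  shows "eventually (\<lambda>n. \<forall>w. (\<forall>j<length ks. (\<Sum>x\<in>tuples (verts (H n)) (ks ! j). (w j x)\<^sup>2) = 1) \<longrightarrow>
      \<bar>tensor_form (\<lambda>e. edge_ind (H n) e - c n) (verts (H n)) ks w\<bar> \<le> \<epsilon> * R n) sequentially"
proof -
  have r: "2 * l \<ge> 2" using l by simp
  let ?C = "step_cycle ks (2 * l)"
  let ?v = "card (verts ?C)" and ?e = "card (edges ?C)"
  \<comment> \<open>the power of the tensor form bounded by the cycle sum; it is also the number of edges of the
      cycle\<close>
  define M where "M = 2 ^ (length ks - 1) * (2 * l)"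
  have "M \<noteq> 0" using l by (simp add: M_def)
  have v: "2 * ?v = k * M" using card_verts_cycle[OF partition r] by (simp add: M_def mult_ac)
  have RM: "R n ^ M = real n ^ ?v" for n
  proof -
    define M' where "M' = 2 ^ (length ks - 1) * l"
    have "M = 2 * M'" by (simp add: M_def M'_def)
    then have "?v = k * M'" using v by simp
    have "R n ^ M = (R n * R n) ^ M'"
      unfolding \<open>M = 2 * M'\<close> power_mult by (simp add: power2_eq_square)
    then show ?thesis unfolding R_square \<open>?v = k * M'\<close> power_mult .
  qed
  define \<delta> where "\<delta> = \<epsilon> ^ M / 2"
  have \<delta>: "\<delta> > 0" using \<epsilon> by (simp add: \<delta>_def)
  have hom: "eventually (\<lambda>n. hom_sum (edge_ind (H n)) ?C (verts (H n))
      \<le> (p ^ ?e + \<delta>) * real n ^ ?v) sequentially"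
    using C \<delta> unfolding Cycle_iff_hom_sum[OF r] by blast
  have "(\<lambda>n. c n ^ ?e) \<longlonglongrightarrow> p ^ ?e" by (intro tendsto_power c_tendsto)
  then have "eventually (\<lambda>n. c n ^ ?e > p ^ ?e - \<delta>) sequentially"
    using \<delta> by (intro order_tendstoD(1)) auto
  then show ?thesis
    using hom eventually_ge_at_top[of 1]
  proof eventually_elim
    case (elim n)
    let ?V = "verts (H n)" and ?g = "\<lambda>e. edge_ind (H n) e - c n"
    have np: "real n ^ ?v > 0" using elim by simp
    have "hom_sum (\<lambda>e. ?g e + c n) ?C ?V = hom_sum ?g ?C ?V + c n ^ ?e * real n ^ ?v"
      using hom_sum_cycle_add_const[OF partition r finite_verts_H centered_marginal[OF _ _
          elim(3)], where c = "c n"]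
      by (simp add: card_H)
    then have "hom_sum ?g ?C ?V = hom_sum (edge_ind (H n)) ?C ?V - c n ^ ?e * real n ^ ?v" by simp
    also have "\<dots> \<le> (p ^ ?e + \<delta>) * real n ^ ?v - (p ^ ?e - \<delta>) * real n ^ ?v"
      using elim np by (intro diff_mono mult_right_mono) auto
    also have "\<dots> = (\<epsilon> * R n) ^ M" by (simp add: \<delta>_def power_mult_distrib RM algebra_simps)
    finally have g: "hom_sum ?g ?C ?V \<le> (\<epsilon> * R n) ^ M" .
    show ?case
    proof (intro allI impI)
      fix w :: "nat \<Rightarrow> 'v list \<Rightarrow> real"
      assume w: "\<forall>j<length ks. (\<Sum>x\<in>tuples ?V (ks ! j). (w j x)\<^sup>2) = 1"
      have "\<bar>tensor_form ?g ?V ks w\<bar> ^ M \<le> hom_sum ?g ?C ?V"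
        unfolding hom_sum_cycle_eq_trace[OF parts_ge_2 r parts_positive finite_verts_H] M_def
        using w by (intro tensor_form_pow_le_trace[OF parts_ge_2 first_part_positive
            finite_verts_H]) auto
      also note g
      finally have "\<bar>tensor_form ?g ?V ks w\<bar> ^ M \<le> (\<epsilon> * R n) ^ M" .
      then show "\<bar>tensor_form ?g ?V ks w\<bar> \<le> \<epsilon> * R n"
        using \<epsilon> R_pos[OF elim(3)] \<open>M \<noteq> 0\<close> by (subst (asm) power_mono_iff) auto
    qed
  qed
qed

text \<open>Both forms differ from the centred one by a multiple of \<open>J\<close>, whose norm is \<open>R n\<close>: the
  first by \<open>c n\<close>, the second by \<open>c n - q n\<close>, which tends to 0.\<close>

lemma Cycle_imp_Eig:
  assumes l: "l \<ge> 1" and C: "Cycle p ks (2 * l) H"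
  shows "Eig p ks H"
proof -
  have add_const: "\<bar>tensor_form (\<lambda>e. edge_ind (H n) e - c n + a) (verts (H n)) ks w\<bar>
      \<le> (\<epsilon> + \<bar>a\<bar>) * R n"
    if small: "\<bar>tensor_form (\<lambda>e. edge_ind (H n) e - c n) (verts (H n)) ks w\<bar> \<le> \<epsilon> * R n"
      and w: "\<And>j. j < length ks \<Longrightarrow> (\<Sum>x\<in>tuples (verts (H n)) (ks ! j). (w j x)\<^sup>2) = 1"
    for n a \<epsilon> and w :: "nat \<Rightarrow> 'v list \<Rightarrow> real"
  proof -
    let ?V = "verts (H n)"
    have "\<bar>tensor_form (\<lambda>_. 1) ?V ks w\<bar> \<le> 1 * sqrt (real (card ?V) ^ sum_list ks)"
      by (rule tensor_form_bound[OF finite_verts_H _ w]) simp_all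
    then have one: "\<bar>tensor_form (\<lambda>_. 1) ?V ks w\<bar> \<le> R n" by (simp add: R_def card_H sum_parts)
    have "tensor_form (\<lambda>e. edge_ind (H n) e - c n + a) ?V ks w
        = tensor_form (\<lambda>e. edge_ind (H n) e - c n) ?V ks w + a * tensor_form (\<lambda>_. 1) ?V ks w"
      using tensor_form_diff[of "\<lambda>e. edge_ind (H n) e - c n" ?V ks w "- a" "\<lambda>_. 1"] by simp
    moreover have "\<bar>a * tensor_form (\<lambda>_. 1) ?V ks w\<bar> \<le> \<bar>a\<bar> * R n"
      unfolding abs_mult using one by (intro mult_left_mono) auto
    ultimately show ?thesis using small by (simp add: algebra_simps)
  qed
  have l1: "(\<lambda>n. lambda1 ks (H n) / R n - c n) \<longlonglongrightarrow> 0"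
    unfolding LIMSEQ_iff
  proof (intro allI impI)
    fix \<epsilon> :: real assume "\<epsilon> > 0"
    then have "eventually (\<lambda>n. \<forall>w. (\<forall>j<length ks. (\<Sum>x\<in>tuples (verts (H n)) (ks ! j). (w j x)\<^sup>2)
        = 1) \<longrightarrow>
      \<bar>tensor_form (\<lambda>e. edge_ind (H n) e - c n) (verts (H n)) ks w\<bar> \<le> \<epsilon> / 2 * R n) sequentially"
      by (intro Cycle_imp_centered_norm_small[OF l C]) simp
    then have "eventually (\<lambda>n. norm (lambda1 ks (H n) / R n - c n - 0) < \<epsilon>) sequentially"
      using eventually_ge_at_top[of 1]
    proof eventually_elim
      case (elim n)
      have c0: "0 \<le> c n" by (simp add: c_def)
      have Rp: "R n > 0" using R_pos[OF elim(2)] .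
      have "lambda1 ks (H n) \<le> (\<epsilon> / 2 + \<bar>c n\<bar>) * R n"
        unfolding lambda1_eq[OF finite_verts_H]
      proof (rule form_norm_least[OF finite_verts_H verts_H_nonempty[OF elim(2)]])
        fix w :: "nat \<Rightarrow> 'v list \<Rightarrow> real"
      assume w: "\<And>j. j < length ks \<Longrightarrow> (\<Sum>x\<in>tuples (verts (H n)) (ks ! j). (w j x)\<^sup>2) = 1"
        then have "\<bar>tensor_form (\<lambda>e. edge_ind (H n) e - c n) (verts (H n)) ks w\<bar> \<le> \<epsilon> / 2 * R n"
          using elim(1) by blast
        from add_const[OF this w, of "c n"]
        show "\<bar>tensor_form (edge_ind (H n)) (verts (H n)) ks w\<bar> \<le> (\<epsilon> / 2 + \<bar>c n\<bar>) * R n" by simp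
      qed
      then have "lambda1 ks (H n) / R n \<le> \<epsilon> / 2 + c n" using Rp c0 by (simp add: divide_le_eq)
      moreover have "c n \<le> lambda1 ks (H n) / R n"
      proof -
        have "c n * (R n * R n) / R n \<le> lambda1 ks (H n)"
          using ones_le_form_norm[OF elim(2)] unfolding edge_tuples_eq[OF elim(2)] R_square .
        then show ?thesis using Rp by (simp add: le_divide_eq)
      qed
      ultimately show ?case using \<open>\<epsilon> > 0\<close> by simp
    qed
    then show "\<exists>no. \<forall>n\<ge>no. norm (lambda1 ks (H n) / R n - c n - 0) < \<epsilon>"
      by (simp add: eventually_at_top_linorder)
  qed
  have l2: "(\<lambda>n. lambda2 ks (H n) / R n) \<longlonglongrightarrow> 0"
    unfolding LIMSEQ_iff
  proof (intro allI impI)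
    fix \<epsilon> :: real assume "\<epsilon> > 0"
    then have "eventually (\<lambda>n. \<forall>w. (\<forall>j<length ks. (\<Sum>x\<in>tuples (verts (H n)) (ks ! j). (w j x)\<^sup>2)
        = 1) \<longrightarrow>
      \<bar>tensor_form (\<lambda>e. edge_ind (H n) e - c n) (verts (H n)) ks w\<bar> \<le> \<epsilon> / 2 * R n) sequentially"
      by (intro Cycle_imp_centered_norm_small[OF l C]) simp
    moreover have "eventually (\<lambda>n. \<bar>c n - q n\<bar> < \<epsilon> / 2) sequentially"
      using tendsto_rabs[OF tendsto_diff[OF c_tendsto q_tendsto]] \<open>\<epsilon> > 0\<close>
      by (intro order_tendstoD(2)) auto
    ultimately have "eventually (\<lambda>n. norm (lambda2 ks (H n) / R n - 0) < \<epsilon>) sequentially"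
      using eventually_ge_at_top[of 1]
    proof eventually_elim
      case (elim n)
      let ?V = "verts (H n)"
      have Rp: "R n > 0" using R_pos[OF elim(3)] .
      have "lambda2 ks (H n) \<le> (\<epsilon> / 2 + \<bar>c n - q n\<bar>) * R n"
        unfolding lambda2_q
      proof (rule form_norm_least[OF finite_verts_H verts_H_nonempty[OF elim(3)]])
        fix w :: "nat \<Rightarrow> 'v list \<Rightarrow> real"
      assume w: "\<And>j. j < length ks \<Longrightarrow> (\<Sum>x\<in>tuples ?V (ks ! j). (w j x)\<^sup>2) = 1"
        then have "\<bar>tensor_form (\<lambda>e. edge_ind (H n) e - c n) ?V ks w\<bar> \<le> \<epsilon> / 2 * R n"
          using elim(1) by blast
        from add_const[OF this w, of "c n - q n"]
        show "\<bar>tensor_form (\<lambda>e. edge_ind (H n) e - q n) ?V ks w\<bar>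
            \<le> (\<epsilon> / 2 + \<bar>c n - q n\<bar>) * R n" by simp
      qed
      then have "lambda2 ks (H n) / R n \<le> \<epsilon> / 2 + \<bar>c n - q n\<bar>" using Rp by (simp add: divide_le_eq)
      moreover have "0 \<le> lambda2 ks (H n)"
      proof -
        have "\<bar>tensor_form (\<lambda>e. edge_ind (H n) e - q n) ?V ks (\<lambda>j _. 1 / sqrt (real n ^ (ks ! j)))\<bar>
            \<le> lambda2 ks (H n)"
          unfolding lambda2_q
        proof (rule form_norm_upper[OF finite_verts_H])
          show "\<bar>edge_ind (H n) e - q n\<bar> \<le> 1 + \<bar>q n\<bar>" for e
              using edge_ind_bounds[of "H n" e] by linarith
        qed (use elim(3) finite_verts_H in \<open>auto simp: card_tuples card_H power_divide\<close>)
        then show ?thesis by linarith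
      qed
      ultimately show ?case using elim(2) Rp by simp
    qed
    then show "\<exists>no. \<forall>n\<ge>no. norm (lambda2 ks (H n) / R n - 0) < \<epsilon>"
      by (simp add: eventually_at_top_linorder)
  qed
  have "(\<lambda>n. lambda1 ks (H n) / R n) \<longlonglongrightarrow> p"
    using tendsto_add[OF l1 c_tendsto] by simp
  then show ?thesis using l2 unfolding Eig_iff_tendsto by blast
qed

end

end

section \<open>The equivalences\<close>

theorem theorem2:
  fixes p :: real and k l :: nat and ks :: "nat list"
    and H :: "nat \<Rightarrow> 'v loop_hypergraph"
  assumes "0 < p" and "p < 1" and "k \<ge> 2" and "proper_partition k ks" and "l \<ge> 1"
    and "\<And>n. uniform_loop_hypergraph k (H n)"
    and "\<And>n. card (verts (H n)) = n"
  shows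
    "((\<forall>n. coregular k (nat \<lfloor>p * real n\<rfloor>) (H n)) \<longrightarrow>
        (Eig p ks H \<longleftrightarrow> Expand p ks H) \<and>
        (Expand p ks H \<longleftrightarrow> Count_linear p ks H) \<and>
        (Count_linear p ks H \<longleftrightarrow> Cycle p ks 2 H) \<and>
        (Cycle p ks 2 H \<longleftrightarrow> Cycle p ks (2 * l) H)) \<and>
     (edge_dense p k H \<longrightarrow>
        (Eig p ks H \<longrightarrow> Expand p ks H) \<and>
        (Expand p ks H \<longrightarrow> Count_linear p ks H) \<and>
        (Count_linear p ks H \<longrightarrow> Cycle p ks 2 H) \<and>
        (Cycle p ks 2 H \<longrightarrow> Cycle p ks (2 * l) H))"
proof -
  interpret hypergraph_sequence H ks k p
    using assms by unfold_locales auto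
  have forward: "Expand p ks H \<Longrightarrow> Count_linear p ks H" "Count_linear p ks H \<Longrightarrow> Cycle p ks 2 H"
    "Cycle p ks 2 H \<Longrightarrow> Cycle p ks (2 * l) H"
    using Expand_imp_Count Count_imp_Cycle[OF order_refl] Cycle_imp_Cycle_multiple[OF \<open>l \<ge> 1\<close>] by auto
  have converse: "(\<forall>n. coregular k (nat \<lfloor>p * real n\<rfloor>) (H n)) \<Longrightarrow> Cycle p ks (2 * l) H \<Longrightarrow> Eig p ks H"
    using Cycle_imp_Eig[OF _ \<open>l \<ge> 1\<close>] by blast
  show ?thesis
    using forward converse Eig_imp_Expand coregular_imp_edge_dense by blast
qed

end
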